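(* Let $\mathcal K$ be a separable, complex Hilbert space, $\Sigma:\mathfrak B(\mathbb R)\to\mathcal B(\mathcal K)$ a bounded, nonnegative operator-valued measure, and $\mu$ a control measure for $\Sigma$. Then the Hilbert spaces $L^2(\mathbb R;d\Sigma;\mathcal K)$ (Berezanskii's construction, by completion of a quotient of $C_{0,0}(\mathbb R;\mathcal K)$) and $L^2(\mathbb R;d\mu;\mathcal M_\Sigma)$ (the direct integral construction) are isometrically isomorphic.
   Context: Inner products are linear in the second argument. $\mathcal B(\cdot)$ denotes bounded linear operators, $\mathfrak B(\mathbb R)$ the Borel $\sigma$-algebra on $\mathbb R$. A bounded, nonnegative operator-valued measure is a map $\Sigma:\mathfrak B(\mathbb R)\to\mathcal B(\mathcal K)$ with $\Sigma(\emptyset)=0$, $0\le\Sigma(B)\in\mathcal B(\mathcal K)$ for all $B$, and $\Sigma$ strongly countably additive: $\Sigma(B)=\operatorname{s-lim}_{N\to\infty}\sum_{j=1}^N\Sigma(B_j)$ whenever $B=\bigcup_{j\in\mathbb N}B_j$ with pairwise disjoint Borel sets $B_j$. A control measure $\mu$ for $\Sigma$ is a ($\sigma$-finite) Borel measure on $\mathbb R$ such that $\mu(B)=0$ if and only if $\Sigma(B)=0$, for all $B\in\mathfrak B(\mathbb R)$. The distribution function of $\Sigma$ is written $\Sigma(\lambda)=\Sigma((-\infty,\lambda])$. Berezanskii's space $L^2(\mathbb R;d\Sigma;\mathcal K)$. Let $C_{0,0}(\mathbb R;\mathcal K)$ be the vector space of functions $\underline u:\mathbb R\to\mathcal K$ that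 are strongly continuous, have compact support, and take all their values in some finite-dimensional subspace $\mathcal K_{\underline u}$ of $\mathcal K$ (depending on $\underline u$). Equip it with the semi-inner product $(\underline u,\underline v)=\int_{\mathbb R}d(\underline u(\lambda),\Sigma(\lambda)\underline v(\lambda))_{\mathcal K}$, a Riemann--Stieltjes integral, i.e., the limit, as the mesh of partitions $\lambda_0<\lambda_1<\dots<\lambda_n$ of an interval containing the supports tends to $0$, of sums $\sum_j(\underline u(t_j),\Sigma((\lambda_{j-1},\lambda_j])\underline v(t_j))_{\mathcal K}$ with $t_j\in[\lambda_{j-1},\lambda_j]$. Let $\mathcal N=\{\underline u\in C_{0,0}(\mathbb R;\mathcal K)\,|\,(\underline u,\underline u)=0\}$. Then $L^2(\mathbb R;d\Sigma;\mathcal K)$ is the Hilbert space completion of $C_{0,0}(\mathbb R;\mathcal K)/\mathcal N$ with respect to the induced inner product. The space $L^2(\mathbb R;d\mu;\mathcal M_\Sigma)$. Let $\{e_n\}_{n\in\mathcal I}$, $\mathcal I=\{1,\dots,N\}$ or $\mathcal I=\mathbb N$, be linearly independent elements of $\mathcal K$ with dense linear span, and $\mathcal V=\mathrm{lin.span}\{e_n\,|\,n\in\mathcal I\}$. By Radon--Nikodym there are $\mu$-measurable $\phi_{m,n}$ with $\int_B d\mu(\lambda)\,\phi_{m,n}(\lambda)=(e_m,\Sigma(B)e_n)_{\mathcal K}$ for all $B\in\mathfrak B(\mathbb R)$, and there is a Borel set $E$ with $\mu(\mathbb R\setminus E)=0$ such that for $\lambda\in E$, $(v,w)_\lambda=\sum_{m,n}\phi_{m,n}(\lambda)\overline{\alpha_m}\beta_n$,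 for $v=\sum_n\alpha_ne_n$, $w=\sum_n\beta_ne_n\in\mathcal V$ (finite sums), is a semi-inner product on $\mathcal V$. For $\lambda\in E$ let $\mathcal N_\lambda=\{\xi\in\mathcal V\,|\,(\xi,\xi)_\lambda=0\}$ and let $\mathcal K_\lambda$ be the completion of $\mathcal V/\mathcal N_\lambda$; for $\lambda\in\mathbb R\setminus E$ put $\mathcal K_\lambda=\mathcal K$. Each $v\in\mathcal V$ defines $\underline v=\{\underline v(\lambda)\}_{\lambda\in\mathbb R}\in\prod_{\lambda\in\mathbb R}\mathcal K_\lambda$ by $\underline v(\lambda)=v$ (identified with its class in $\mathcal V/\mathcal N_\lambda\subseteq\mathcal K_\lambda$ for $\lambda\in E$). Set $\mathcal M_\Sigma=\{g\in\prod_{\lambda\in\mathbb R}\mathcal K_\lambda\,|\,\lambda\mapsto(\underline e_n(\lambda),g(\lambda))_{\mathcal K_\lambda}\text{ is }\mu\text{-measurable for all }n\in\mathcal I\}$. Then $L^2(\mathbb R;d\mu;\mathcal M_\Sigma)$ is the Hilbert space of all $f\in\mathcal M_\Sigma$ with $\int_{\mathbb R}d\mu(\lambda)\|f(\lambda)\|^2_{\mathcal K_\lambda}<\infty$, modulo equality $\mu$-a.e., with inner product $(f,g)=\int_{\mathbb R}d\mu(\lambda)\,(f(\lambda),g(\lambda))_{\mathcal K_\lambda}$. *)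

theory Defs
  imports "HOL-Analysis.Analysis"
begin

section \<open>Complex Hilbert spaces as types\<close>

text \<open>The inner product is linear in its second argument. The real inner product underlying
  the norm and the topology of the type is its real part.\<close>

class complex_inner = real_inner +
  fixes scaleC :: "complex \<Rightarrow> 'a \<Rightarrow> 'a"
    and cinner :: "'a \<Rightarrow> 'a \<Rightarrow> complex"
  assumes scaleC_add_right: "scaleC c (x + y) = scaleC c x + scaleC c y"
    and scaleC_add_left: "scaleC (c + d) x = scaleC c x + scaleC d x"
    and scaleC_scaleC: "scaleC c (scaleC d x) = scaleC (c * d) x"
    and scaleC_of_real: "scaleC (complex_of_real r) x = scaleR r x"
    and cinner_commute: "cinner x y = cnj (cinner y x)"
    and cinner_add_right: "cinner x (y + z) = cinner x y + cinner x z"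
    and cinner_scaleC_right: "cinner x (scaleC c y) = c * cinner x y"
    and inner_eq_Re_cinner: "inner x y = Re (cinner x y)"

class chilbert_space = complex_inner + complete_space

global_interpretation complex_vector:
  vector_space "scaleC :: complex \<Rightarrow> 'a \<Rightarrow> 'a::complex_inner"
proof
  fix x :: 'a
  show "scaleC 1 x = x"
    using scaleC_of_real[of 1 x] by simp
qed (simp_all add: scaleC_add_right scaleC_add_left scaleC_scaleC)

definition bounded_clinear :: "('a::complex_inner \<Rightarrow> 'a) \<Rightarrow> bool" where
  "bounded_clinear T \<longleftrightarrow> bounded_linear T \<and> (\<forall>c x. T (scaleC c x) = scaleC c (T x))"

definition nonneg_operator :: "('a::complex_inner \<Rightarrow> 'a) \<Rightarrow> bool" where
  "nonneg_operator T \<longleftrightarrow>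
     bounded_clinear T \<and> (\<forall>x. Im (cinner x (T x)) = 0 \<and> 0 \<le> Re (cinner x (T x)))"


section \<open>Spaces with a semi-inner product given by an explicit carrier\<close>

text \<open>Completions of quotients depend on parameters (here on a measure or on a real number),
  so they are not types but structures with a carrier set.\<close>

record 'a ips =
  carr :: "'a set"
  zer :: "'a"
  add :: "'a \<Rightarrow> 'a \<Rightarrow> 'a"
  smul :: "complex \<Rightarrow> 'a \<Rightarrow> 'a"
  ip :: "'a \<Rightarrow> 'a \<Rightarrow> complex"

definition sub :: "'a ips \<Rightarrow> 'a \<Rightarrow> 'a \<Rightarrow> 'a" where
  "sub S x y = add S x (smul S (- 1) y)"

definition nrm :: "'a ips \<Rightarrow> 'a \<Rightarrow> real" where
  "nrm S x = sqrt (Re (ip S x x))"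

definition cauchy_in :: "'a ips \<Rightarrow> (nat \<Rightarrow> 'a) \<Rightarrow> bool" where
  "cauchy_in S X \<longleftrightarrow> (\<forall>\<epsilon>>0. \<exists>M. \<forall>m\<ge>M. \<forall>n\<ge>M. nrm S (sub S (X m) (X n)) < \<epsilon>)"

locale semi_ip_space =
  fixes S :: "'a ips"
  assumes zer_closed: "zer S \<in> carr S"
    and add_closed: "x \<in> carr S \<Longrightarrow> y \<in> carr S \<Longrightarrow> add S x y \<in> carr S"
    and smul_closed: "x \<in> carr S \<Longrightarrow> smul S c x \<in> carr S"
    and add_assoc: "x \<in> carr S \<Longrightarrow> y \<in> carr S \<Longrightarrow> z \<in> carr S \<Longrightarrow>
          add S (add S x y) z = add S x (add S y z)"
    and add_commute: "x \<in> carr S \<Longrightarrow> y \<in> carr S \<Longrightarrow> add S x y = add S y x"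
    and add_zer: "x \<in> carr S \<Longrightarrow> add S x (zer S) = x"
    and add_inverse: "x \<in> carr S \<Longrightarrow> add S x (smul S (- 1) x) = zer S"
    and smul_one: "x \<in> carr S \<Longrightarrow> smul S 1 x = x"
    and smul_smul: "x \<in> carr S \<Longrightarrow> smul S c (smul S d x) = smul S (c * d) x"
    and smul_add_right: "x \<in> carr S \<Longrightarrow> y \<in> carr S \<Longrightarrow>
          smul S c (add S x y) = add S (smul S c x) (smul S c y)"
    and smul_add_left: "x \<in> carr S \<Longrightarrow> smul S (c + d) x = add S (smul S c x) (smul S d x)"
    and ip_commute: "x \<in> carr S \<Longrightarrow> y \<in> carr S \<Longrightarrow> ip S x y = cnj (ip S y x)"
    and ip_add_right: "x \<in> carr S \<Longrightarrow> y \<in> carr S \<Longrightarrow> z \<in> carr S \<Longrightarrow>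
          ip S x (add S y z) = ip S x y + ip S x z"
    and ip_smul_right: "x \<in> carr S \<Longrightarrow> y \<in> carr S \<Longrightarrow> ip S x (smul S c y) = c * ip S x y"
    and ip_nonneg: "x \<in> carr S \<Longrightarrow> 0 \<le> Re (ip S x x)"

locale hilbert_space = semi_ip_space +
  assumes ip_definite: "x \<in> carr S \<Longrightarrow> ip S x x = 0 \<Longrightarrow> x = zer S"
    and complete: "(\<And>n. X n \<in> carr S) \<Longrightarrow> cauchy_in S X \<Longrightarrow>
          \<exists>x\<in>carr S. (\<lambda>n. nrm S (sub S (X n) x)) \<longlonglongrightarrow> 0"

definition isometrically_isomorphic :: "'a ips \<Rightarrow> 'b ips \<Rightarrow> bool" where
  "isometrically_isomorphic S T \<longleftrightarrow>
     (\<exists>U. bij_betw U (carr S) (carr T) \<and>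
          (\<forall>x\<in>carr S. \<forall>y\<in>carr S. U (add S x y) = add T (U x) (U y)) \<and>
          (\<forall>c. \<forall>x\<in>carr S. U (smul S c x) = smul T c (U x)) \<and>
          (\<forall>x\<in>carr S. \<forall>y\<in>carr S. ip T (U x) (U y) = ip S x y))"


subsection \<open>Quotients and completions\<close>

definition coset :: "'a ips \<Rightarrow> 'a set \<Rightarrow> 'a \<Rightarrow> 'a set" where
  "coset S N x = {y \<in> carr S. sub S y x \<in> N}"

definition rep :: "'a set \<Rightarrow> 'a" where
  "rep A = (SOME a. a \<in> A)"

definition quot :: "'a ips \<Rightarrow> 'a set \<Rightarrow> 'a set ips" where
  "quot S N = \<lparr>
     carr = coset S N ` carr S,
     zer = coset S N (zer S),
     add = (\<lambda>A B. coset S N (add S (rep A) (rep B))),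
     smul = (\<lambda>c A. coset S N (smul S c (rep A))),
     ip = (\<lambda>A B. ip S (rep A) (rep B)) \<rparr>"

definition null_space :: "'a ips \<Rightarrow> 'a set" where
  "null_space S = {x \<in> carr S. ip S x x = 0}"

definition separation :: "'a ips \<Rightarrow> 'a set ips" where
  "separation S = quot S (null_space S)"

definition cauchy_space :: "'a ips \<Rightarrow> (nat \<Rightarrow> 'a) ips" where
  "cauchy_space S = \<lparr>
     carr = {X. (\<forall>n. X n \<in> carr S) \<and> cauchy_in S X},
     zer = (\<lambda>n. zer S),
     add = (\<lambda>X Y n. add S (X n) (Y n)),
     smul = (\<lambda>c X n. smul S c (X n)),
     ip = (\<lambda>X Y. lim (\<lambda>n. ip S (X n) (Y n))) \<rparr>"

text \<open>Since \<open>(X, X)\<close> is the limit of \<open>\<parallel>X n\<parallel>\<^sup>2\<close> in the space of Cauchy sequences, its null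
  vectors are the sequences converging to zero.\<close>

definition hilbert_completion :: "'a ips \<Rightarrow> (nat \<Rightarrow> 'a) set ips" where
  "hilbert_completion S = separation (cauchy_space S)"

definition completion_class :: "'a ips \<Rightarrow> 'a \<Rightarrow> (nat \<Rightarrow> 'a) set" where
  "completion_class S x = coset (cauchy_space S) (null_space (cauchy_space S)) (\<lambda>n. x)"


section \<open>Operator-valued measures\<close>

definition nonneg_operator_measure :: "(real set \<Rightarrow> 'k::complex_inner \<Rightarrow> 'k) \<Rightarrow> bool" where
  "nonneg_operator_measure \<Sigma> \<longleftrightarrow>
     \<Sigma> {} = (\<lambda>x. 0) \<and>
     (\<forall>B\<in>sets borel. nonneg_operator (\<Sigma> B)) \<and>
     (\<forall>B. range B \<subseteq> sets borel \<longrightarrow> disjoint_family B \<longrightarrow>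
        (\<forall>x. (\<lambda>j::nat. \<Sigma> (B j) x) sums \<Sigma> (\<Union>j. B j) x))"

definition control_measure :: "(real set \<Rightarrow> 'k::complex_inner \<Rightarrow> 'k) \<Rightarrow> real measure \<Rightarrow> bool" where
  "control_measure \<Sigma> \<mu> \<longleftrightarrow>
     sets \<mu> = sets borel \<and> sigma_finite_measure \<mu> \<and>
     (\<forall>B\<in>sets borel. emeasure \<mu> B = 0 \<longleftrightarrow> \<Sigma> B = (\<lambda>x. 0))"


section \<open>Berezanskii's space\<close>

definition supp :: "(real \<Rightarrow> 'k::real_normed_vector) \<Rightarrow> real set" where
  "supp u = closure {x. u x \<noteq> 0}"

definition C00 :: "(real \<Rightarrow> 'k::complex_inner) set" where
  "C00 = {u. continuous_on UNIV u \<and> compact (supp u) \<and>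
             (\<exists>F. finite F \<and> range u \<subseteq> complex_vector.span F)}"

text \<open>\<open>p 0 < \<dots> < p n\<close> is a partition of the interval from \<open>a\<close> to \<open>b\<close> with mesh below
  \<open>\<delta>\<close> and with tags \<open>t 0, \<dots>, t (n - 1)\<close>.\<close>

definition tagged_partition ::
    "real \<Rightarrow> real \<Rightarrow> real \<Rightarrow> nat \<Rightarrow> (nat \<Rightarrow> real) \<Rightarrow> (nat \<Rightarrow> real) \<Rightarrow> bool" where
  "tagged_partition a b \<delta> n p t \<longleftrightarrow>
     p 0 = a \<and> p n = b \<and>
     (\<forall>j<n. p j < p (Suc j) \<and> p (Suc j) - p j < \<delta> \<and> t j \<in> {p j..p (Suc j)})"

definition has_stieltjes_integral ::
    "(real set \<Rightarrow> 'k::complex_inner \<Rightarrow> 'k) \<Rightarrow> (real \<Rightarrow> 'k) \<Rightarrow> (real \<Rightarrow> 'k) \<Rightarrow> complex \<Rightarrow> bool" where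
  "has_stieltjes_integral \<Sigma> u v l \<longleftrightarrow>
     (\<forall>a b. a < b \<longrightarrow> supp u \<union> supp v \<subseteq> {a..b} \<longrightarrow>
        (\<forall>\<epsilon>>0. \<exists>\<delta>>0. \<forall>n p t. tagged_partition a b \<delta> n p t \<longrightarrow>
           cmod ((\<Sum>j<n. cinner (u (t j)) (\<Sigma> {p j<..p (Suc j)} (v (t j)))) - l) < \<epsilon>))"

definition stieltjes_integral ::
    "(real set \<Rightarrow> 'k::complex_inner \<Rightarrow> 'k) \<Rightarrow> (real \<Rightarrow> 'k) \<Rightarrow> (real \<Rightarrow> 'k) \<Rightarrow> complex" where
  "stieltjes_integral \<Sigma> u v = (THE l. has_stieltjes_integral \<Sigma> u v l)"

definition C00_space :: "(real set \<Rightarrow> 'k::complex_inner \<Rightarrow> 'k) \<Rightarrow> (real \<Rightarrow> 'k) ips" where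
  "C00_space \<Sigma> = \<lparr>
     carr = C00,
     zer = (\<lambda>x. 0),
     add = (\<lambda>u v x. u x + v x),
     smul = (\<lambda>c u x. scaleC c (u x)),
     ip = stieltjes_integral \<Sigma> \<rparr>"

definition berezanskii_space ::
    "(real set \<Rightarrow> 'k::complex_inner \<Rightarrow> 'k) \<Rightarrow> (nat \<Rightarrow> (real \<Rightarrow> 'k) set) set ips" where
  "berezanskii_space \<Sigma> = hilbert_completion (separation (C00_space \<Sigma>))"


section \<open>The direct integral\<close>

definition coeff :: "nat set \<Rightarrow> (nat \<Rightarrow> 'k::complex_inner) \<Rightarrow> 'k \<Rightarrow> nat \<Rightarrow> complex" where
  "coeff I e v n = complex_vector.representation (e ` I) v (e n)"

definition fibre_ip ::
    "nat set \<Rightarrow> (nat \<Rightarrow> 'k::complex_inner) \<Rightarrow> (nat \<Rightarrow> nat \<Rightarrow> real \<Rightarrow> complex) \<Rightarrow> real \<Rightarrow> 'k \<Rightarrow> 'k \<Rightarrow> complex"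
  where
  "fibre_ip I e \<phi> s v w =
     (\<Sum>m | m \<in> I \<and> coeff I e v m \<noteq> 0. \<Sum>n | n \<in> I \<and> coeff I e w n \<noteq> 0.
        \<phi> m n s * cnj (coeff I e v m) * coeff I e w n)"

definition pre_fibre ::
    "nat set \<Rightarrow> (nat \<Rightarrow> 'k::complex_inner) \<Rightarrow> (nat \<Rightarrow> nat \<Rightarrow> real \<Rightarrow> complex) \<Rightarrow> real \<Rightarrow> 'k ips" where
  "pre_fibre I e \<phi> s = \<lparr>
     carr = complex_vector.span (e ` I),
     zer = 0,
     add = (+),
     smul = scaleC,
     ip = fibre_ip I e \<phi> s \<rparr>"

text \<open>The choices entering the construction: the vectors \<open>e n\<close>, the densities \<open>\<phi> m n\<close> and the
  set \<open>E\<close>. As usual, \<open>\<mu>\<close>-measurable means measurable with respect to the completion of \<open>\<mu>\<close>.\<close>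

definition direct_integral_data ::
    "(real set \<Rightarrow> 'k::complex_inner \<Rightarrow> 'k) \<Rightarrow> real measure \<Rightarrow> nat set \<Rightarrow> (nat \<Rightarrow> 'k) \<Rightarrow>
     (nat \<Rightarrow> nat \<Rightarrow> real \<Rightarrow> complex) \<Rightarrow> real set \<Rightarrow> bool" where
  "direct_integral_data \<Sigma> \<mu> I e \<phi> E \<longleftrightarrow>
     (I = {1..} \<or> (\<exists>N. I = {1..N})) \<and>
     inj_on e I \<and> complex_vector.independent (e ` I) \<and>
     closure (complex_vector.span (e ` I)) = UNIV \<and>
     (\<forall>m\<in>I. \<forall>n\<in>I. integrable (completion \<mu>) (\<phi> m n) \<and>
        (\<forall>B\<in>sets borel.
           set_lebesgue_integral (completion \<mu>) B (\<phi> m n) = cinner (e m) (\<Sigma> B (e n)))) \<and>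
     E \<in> sets borel \<and> emeasure \<mu> (- E) = 0 \<and>
     (\<forall>s\<in>E. semi_ip_space (pre_fibre I e \<phi> s))"

text \<open>The fibres over \<open>E\<close> and over its complement have elements of different types, hence the
  sum type.\<close>

type_synonym 'k fibre = "'k + (nat \<Rightarrow> 'k set) set"

definition fibre_space ::
    "nat set \<Rightarrow> (nat \<Rightarrow> 'k::complex_inner) \<Rightarrow> (nat \<Rightarrow> nat \<Rightarrow> real \<Rightarrow> complex) \<Rightarrow> real set \<Rightarrow> real \<Rightarrow>
     'k fibre ips" where
  "fibre_space I e \<phi> E s =
     (if s \<in> E then
        let H = hilbert_completion (separation (pre_fibre I e \<phi> s)) in
        \<lparr> carr = Inr ` carr H,
          zer = Inr (zer H),
          add = (\<lambda>x y. Inr (add H (projr x) (projr y))),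
          smul = (\<lambda>c x. Inr (smul H c (projr x))),
          ip = (\<lambda>x y. ip H (projr x) (projr y)) \<rparr>
      else
        \<lparr> carr = range Inl,
          zer = Inl 0,
          add = (\<lambda>x y. Inl (projl x + projl y)),
          smul = (\<lambda>c x. Inl (scaleC c (projl x))),
          ip = (\<lambda>x y. cinner (projl x) (projl y)) \<rparr>)"

definition const_field ::
    "nat set \<Rightarrow> (nat \<Rightarrow> 'k::complex_inner) \<Rightarrow> (nat \<Rightarrow> nat \<Rightarrow> real \<Rightarrow> complex) \<Rightarrow> real set \<Rightarrow> 'k \<Rightarrow>
     real \<Rightarrow> 'k fibre" where
  "const_field I e \<phi> E v s =
     (if s \<in> E then
        let P = pre_fibre I e \<phi> s in
        Inr (completion_class (separation P) (coset P (null_space P) v))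
      else Inl v)"

definition measurable_fields ::
    "real measure \<Rightarrow> nat set \<Rightarrow> (nat \<Rightarrow> 'k::complex_inner) \<Rightarrow> (nat \<Rightarrow> nat \<Rightarrow> real \<Rightarrow> complex) \<Rightarrow>
     real set \<Rightarrow> (real \<Rightarrow> 'k fibre) set" where
  "measurable_fields \<mu> I e \<phi> E =
     {g. (\<forall>s. g s \<in> carr (fibre_space I e \<phi> E s)) \<and>
         (\<forall>n\<in>I. (\<lambda>s. ip (fibre_space I e \<phi> E s) (const_field I e \<phi> E (e n) s) (g s))
                  \<in> borel_measurable (completion \<mu>))}"

definition square_integrable_fields ::
    "real measure \<Rightarrow> nat set \<Rightarrow> (nat \<Rightarrow> 'k::complex_inner) \<Rightarrow> (nat \<Rightarrow> nat \<Rightarrow> real \<Rightarrow> complex) \<Rightarrow>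
     real set \<Rightarrow> (real \<Rightarrow> 'k fibre) ips" where
  "square_integrable_fields \<mu> I e \<phi> E = \<lparr>
     carr = {f \<in> measurable_fields \<mu> I e \<phi> E.
               integrable (completion \<mu>) (\<lambda>s. (nrm (fibre_space I e \<phi> E s) (f s))\<^sup>2)},
     zer = (\<lambda>s. zer (fibre_space I e \<phi> E s)),
     add = (\<lambda>f g s. add (fibre_space I e \<phi> E s) (f s) (g s)),
     smul = (\<lambda>c f s. smul (fibre_space I e \<phi> E s) c (f s)),
     ip = (\<lambda>f g. \<integral>s. ip (fibre_space I e \<phi> E s) (f s) (g s) \<partial>completion \<mu>) \<rparr>"

definition direct_integral_space ::
    "real measure \<Rightarrow> nat set \<Rightarrow> (nat \<Rightarrow> 'k::complex_inner) \<Rightarrow> (nat \<Rightarrow> nat \<Rightarrow> real \<Rightarrow> complex) \<Rightarrow>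
     real set \<Rightarrow> (real \<Rightarrow> 'k fibre) set ips" where
  "direct_integral_space \<mu> I e \<phi> E =
     quot (square_integrable_fields \<mu> I e \<phi> E)
       {f \<in> carr (square_integrable_fields \<mu> I e \<phi> E).
          AE s in \<mu>. f s = zer (fibre_space I e \<phi> E s)}"

end

theory Submission imports Defs begin

text \<open>Let \<open>D\<close> be the functions in \<open>C00\<close> with values in the span of finitely many \<open>e n\<close>. Their
  coordinates are continuous, so for \<open>u\<close> and \<open>v\<close> in \<open>D\<close> the Riemann--Stieltjes sums converge to
  \<open>\<integral> (u s, v s)\<^sub>s d\<mu>\<close>, since \<open>(e m, \<Sigma> B (e n)) = \<integral>\<^sub>B \<phi> m n d\<mu>\<close>. Hence sending \<open>u\<close> to
  the field of classes of \<open>u s\<close> is isometric from \<open>D\<close> into the direct integral. The set \<open>D\<close> is dense in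
  \<open>C00\<close>, because the \<open>e n\<close> have dense span. Its image is dense in the direct integral: a field \<open>g\<close>
  orthogonal to all \<open>f \<cdot> e n\<close>, with \<open>f\<close> continuous of compact support, satisfies
  \<open>(e n, g s)\<^sub>s = 0\<close> for almost every \<open>s\<close> and all \<open>n\<close>, so \<open>g\<close> vanishes almost everywhere.
  Two Hilbert spaces with a common dense set on which the inner products agree are isomorphic.\<close>


section \<open>Semi-inner product spaces\<close>

text \<open>The field \<open>J u\<close> makes sense only where \<open>u s\<close> lies in the span
  of the \<open>e n\<close>: the fibre over a point of \<open>E\<close> completes that span, and a
  general vector has no class in it. This is why \<open>D\<close> intervenes, and why the Stieltjes
  integral on all of \<open>C00\<close> is built without the densities: polarization reduces it to
  the finite positive measures \<open>(x, \<Sigma> B x)\<close>. The main obstacle is on the other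
  side. A measurable field is tested only against the \<open>e n\<close>, so measurability of its
  norm has to be derived. The squared norm is a supremum of countably many affine expressions in
  such pairings, because rational combinations of the \<open>e n\<close> are dense in every fibre at
  once. Completeness of the direct integral is then a Riesz-Fischer argument carried out fibrewise.
  All spaces here depend on terms such as \<open>\<mu>\<close> or \<open>s\<close>, so they are
  carrier structures, and Cauchy-Schwarz, completion and orthogonal projection are developed for
  these. Completeness is kept apart from definiteness, since it is proved before the null vectors
  are divided out.\<close>

abbreviation dst :: "'a ips \<Rightarrow> 'a \<Rightarrow> 'a \<Rightarrow> real" where
  "dst S x y \<equiv> nrm S (sub S x y)"

text \<open>Completeness without definiteness: spaces of Cauchy sequences and of square-integrable
  fields have it although they still contain nonzero null vectors.\<close>

definition complete_ips :: "'a ips \<Rightarrow> bool" where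
  "complete_ips S \<longleftrightarrow> (\<forall>X. (\<forall>n. X n \<in> carr S) \<longrightarrow> cauchy_in S X \<longrightarrow>
     (\<exists>x\<in>carr S. (\<lambda>n. dst S (X n) x) \<longlonglongrightarrow> 0))"

context semi_ip_space
begin

lemma sub_closed: "x \<in> carr S \<Longrightarrow> y \<in> carr S \<Longrightarrow> sub S x y \<in> carr S"
  by (simp add: sub_def add_closed smul_closed)

lemmas closed [simp] = zer_closed add_closed smul_closed sub_closed

lemma ip_add_left:
  "x \<in> carr S \<Longrightarrow> y \<in> carr S \<Longrightarrow> z \<in> carr S \<Longrightarrow> ip S (add S x y) z = ip S x z + ip S y z"
  by (metis add_closed complex_cnj_add ip_add_right ip_commute)

lemma ip_smul_left:
  "x \<in> carr S \<Longrightarrow> y \<in> carr S \<Longrightarrow> ip S (smul S c x) y = cnj c * ip S x y"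
  by (metis smul_closed complex_cnj_mult ip_smul_right ip_commute)

lemma ip_sub_left:
  "x \<in> carr S \<Longrightarrow> y \<in> carr S \<Longrightarrow> z \<in> carr S \<Longrightarrow> ip S (sub S x y) z = ip S x z - ip S y z"
  by (simp add: sub_def ip_add_left ip_smul_left)

lemma ip_sub_right:
  "x \<in> carr S \<Longrightarrow> y \<in> carr S \<Longrightarrow> z \<in> carr S \<Longrightarrow> ip S z (sub S x y) = ip S z x - ip S z y"
  by (simp add: sub_def ip_add_right ip_smul_right)

lemma ip_zer_right: "x \<in> carr S \<Longrightarrow> ip S x (zer S) = 0"
  by (metis add_inverse ip_sub_right right_minus_eq sub_def)

lemma ip_zer_left: "x \<in> carr S \<Longrightarrow> ip S (zer S) x = 0"
  by (metis complex_cnj_zero ip_commute ip_zer_right zer_closed)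

lemmas ip_simps = ip_add_left ip_add_right ip_smul_left ip_smul_right ip_sub_left ip_sub_right
  ip_zer_left ip_zer_right

lemma nrm_nonneg [simp]: "x \<in> carr S \<Longrightarrow> 0 \<le> nrm S x"
  by (simp add: nrm_def ip_nonneg)

lemma nrm_power2: "x \<in> carr S \<Longrightarrow> (nrm S x)\<^sup>2 = Re (ip S x x)"
  by (simp add: nrm_def ip_nonneg)

lemma ip_self: "x \<in> carr S \<Longrightarrow> ip S x x = of_real ((nrm S x)\<^sup>2)"
  using ip_commute[of x x] by (simp add: nrm_power2 complex_eq_iff)

lemma nrm_eq_0_iff: "x \<in> carr S \<Longrightarrow> nrm S x = 0 \<longleftrightarrow> ip S x x = 0"
  by (simp add: ip_self)

lemma Re_ip_commute: "x \<in> carr S \<Longrightarrow> y \<in> carr S \<Longrightarrow> Re (ip S y x) = Re (ip S x y)"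
  by (metis cnj.simps(1) ip_commute)

lemma nrm_add_power2: "x \<in> carr S \<Longrightarrow> y \<in> carr S \<Longrightarrow>
    (nrm S (add S x y))\<^sup>2 = (nrm S x)\<^sup>2 + 2 * Re (ip S x y) + (nrm S y)\<^sup>2"
  using Re_ip_commute[of x y] by (simp add: nrm_power2 ip_simps)

lemma nrm_sub_power2: "x \<in> carr S \<Longrightarrow> y \<in> carr S \<Longrightarrow>
    (dst S x y)\<^sup>2 = (nrm S x)\<^sup>2 - 2 * Re (ip S x y) + (nrm S y)\<^sup>2"
  using Re_ip_commute[of x y] by (simp add: nrm_power2 ip_simps)

lemma nrm_smul: "x \<in> carr S \<Longrightarrow> nrm S (smul S c x) = cmod c * nrm S x"
proof -
  assume x: "x \<in> carr S"
  have "ip S (smul S c x) (smul S c x) = c * cnj c * of_real ((nrm S x)\<^sup>2)"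
    using x by (simp add: ip_smul_left ip_smul_right ip_self[of x] del: of_real_power)
  also have "\<dots> = of_real ((cmod c * nrm S x)\<^sup>2)"
    by (simp add: complex_norm_square[symmetric] power_mult_distrib)
  finally have "(nrm S (smul S c x))\<^sup>2 = (cmod c * nrm S x)\<^sup>2"
    using x by (simp only: nrm_power2 smul_closed Re_complex_of_real)
  then show ?thesis
    using x by (simp add: power2_eq_iff_nonneg)
qed

text \<open>In a semi-inner product space \<open>nrm S y\<close> may vanish for \<open>y\<close>
  other than zero, so the usual division by it needs a separate case.\<close>

lemma cauchy_schwarz:
  assumes x: "x \<in> carr S" and y: "y \<in> carr S"
  shows "cmod (ip S x y) \<le> nrm S x * nrm S y"
proof -
  define z where "z = ip S x y"
  \<comment> \<open>The multiple of \<open>y\<close> carries the phase \<open>cnj z\<close>, which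
    makes the cross term real; only the real parameter \<open>r\<close> remains to be
    chosen.\<close>
  have *: "0 \<le> (nrm S x)\<^sup>2 - 2 * r * (cmod z)\<^sup>2 + r\<^sup>2 * (cmod z)\<^sup>2 * (nrm S y)\<^sup>2" for r :: real
  proof -
    have "0 \<le> (nrm S (add S x (smul S (of_real (- r) * cnj z) y)))\<^sup>2" by simp
    also have "\<dots> = (nrm S x)\<^sup>2 - 2 * r * (cmod z)\<^sup>2 + r\<^sup>2 * (cmod z)\<^sup>2 * (nrm S y)\<^sup>2"
      unfolding nrm_add_power2[OF x smul_closed[OF y]]
      using x y by (simp add: nrm_smul ip_smul_right z_def[symmetric] norm_mult power_mult_distrib
          cmod_power2) (simp add: power2_eq_square algebra_simps)
    finally show ?thesis .
  qed
  have "(cmod z)\<^sup>2 \<le> (nrm S x * nrm S y)\<^sup>2"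
  proof (cases "nrm S y = 0")
    case True
    \<comment> \<open>With the quadratic term gone, the bound is affine in \<open>r\<close>. The
      chosen \<open>r\<close> makes it equal to -1 unless \<open>z\<close> vanishes.\<close>
    have "z = 0"
    proof (rule ccontr)
      assume "z \<noteq> 0"
      then show False
        using *[of "((nrm S x)\<^sup>2 + 1) / (2 * (cmod z)\<^sup>2)"] True by simp
    qed
    then show ?thesis by simp
  next
    case False
    then have "0 \<le> (nrm S x)\<^sup>2 - (cmod z)\<^sup>2 / (nrm S y)\<^sup>2"
      using *[of "1 / (nrm S y)\<^sup>2"] by (simp add: power2_eq_square)
    then show ?thesis
      using False by (simp add: power_mult_distrib divide_simps)
  qed
  then show ?thesis
    unfolding z_def using x y by (simp add: power2_le_iff_abs_le)
qed

lemma nrm_triangle: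
  assumes x: "x \<in> carr S" and y: "y \<in> carr S"
  shows "nrm S (add S x y) \<le> nrm S x + nrm S y"
proof (rule power2_le_imp_le)
  have "Re (ip S x y) \<le> nrm S x * nrm S y"
    using cauchy_schwarz[OF x y] complex_Re_le_cmod order_trans by blast
  then show "(nrm S (add S x y))\<^sup>2 \<le> (nrm S x + nrm S y)\<^sup>2"
    using x y by (simp add: nrm_add_power2 power2_sum)
qed (use x y in simp)

text \<open>Two differently arranged sums are compared through their inner products, which
  \<open>ip_simps\<close> expands to scalars. This replaces rearrangements with the vector space
  axioms throughout.\<close>

lemma nrm_eqI: "x \<in> carr S \<Longrightarrow> y \<in> carr S \<Longrightarrow> ip S x x = ip S y y \<Longrightarrow> nrm S x = nrm S y"
  by (simp add: nrm_def)

lemma nrm_sub_commute: "x \<in> carr S \<Longrightarrow> y \<in> carr S \<Longrightarrow> dst S x y = dst S y x"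
  by (rule nrm_eqI) (simp_all add: ip_simps)

lemma nrm_sub_self [simp]: "x \<in> carr S \<Longrightarrow> dst S x x = 0"
  by (simp add: nrm_eq_0_iff ip_simps)

lemma nrm_zer [simp]: "nrm S (zer S) = 0"
  by (simp add: nrm_eq_0_iff ip_simps)

lemma nrm_sub_triangle:
  assumes "x \<in> carr S" "y \<in> carr S" "z \<in> carr S"
  shows "dst S x z \<le> dst S x y + dst S y z"
proof -
  have "dst S x z = nrm S (add S (sub S x y) (sub S y z))"
    by (rule nrm_eqI) (use assms in \<open>simp_all add: ip_simps\<close>)
  then show ?thesis using assms by (simp add: nrm_triangle)
qed

lemma nrm_sub_add_le:
  assumes "x \<in> carr S" "y \<in> carr S" "x' \<in> carr S" "y' \<in> carr S"
  shows "dst S (add S x y) (add S x' y') \<le> dst S x x' + dst S y y'"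
proof -
  have "dst S (add S x y) (add S x' y') = nrm S (add S (sub S x x') (sub S y y'))"
    by (rule nrm_eqI) (use assms in \<open>simp_all add: ip_simps\<close>)
  then show ?thesis using assms by (simp add: nrm_triangle)
qed

lemma nrm_sub_smul:
  assumes "x \<in> carr S" "y \<in> carr S"
  shows "dst S (smul S c x) (smul S c y) = cmod c * dst S x y"
proof -
  have "dst S (smul S c x) (smul S c y) = nrm S (smul S c (sub S x y))"
    by (rule nrm_eqI) (use assms in \<open>simp_all add: ip_simps algebra_simps\<close>)
  then show ?thesis using assms by (simp add: nrm_smul)
qed

lemma nrm_le_add_sub:
  assumes "x \<in> carr S" "y \<in> carr S"
  shows "nrm S x \<le> nrm S y + dst S x y"
proof -
  have "nrm S x = nrm S (add S y (sub S x y))"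
    by (rule nrm_eqI) (use assms in \<open>simp_all add: ip_simps\<close>)
  then show ?thesis using assms by (metis nrm_triangle sub_closed)
qed

lemma nrm_diff_le:
  assumes "x \<in> carr S" "y \<in> carr S"
  shows "\<bar>nrm S x - nrm S y\<bar> \<le> dst S x y"
  using nrm_le_add_sub[of x y] nrm_le_add_sub[of y x] nrm_sub_commute[of x y] assms by simp

lemma ip_diff_le:
  assumes "x \<in> carr S" "y \<in> carr S" "x' \<in> carr S" "y' \<in> carr S"
  shows "cmod (ip S x y - ip S x' y') \<le> dst S x x' * nrm S y + nrm S x' * dst S y y'"
proof -
  have "ip S x y - ip S x' y' = ip S (sub S x x') y + ip S x' (sub S y y')"
    using assms by (simp add: ip_simps)
  then show ?thesis
    using assms by (metis add_mono cauchy_schwarz norm_triangle_mono sub_closed)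
qed

lemma sub_eq_zer_imp_eq:
  assumes "x \<in> carr S" "y \<in> carr S" "sub S x y = zer S"
  shows "x = y"
proof -
  have "x = add S x (add S (smul S (- 1) y) y)"
    using assms by (metis add_commute add_inverse add_zer smul_closed)
  also have "\<dots> = add S (sub S x y) y"
    unfolding sub_def by (rule add_assoc[symmetric]) (use assms in simp_all)
  also have "\<dots> = y" using assms by (metis add_commute add_zer zer_closed)
  finally show ?thesis .
qed

section \<open>Convergent sequences and continuity of the inner product\<close>

lemma ip_tendsto:
  assumes X: "\<And>n. X n \<in> carr S" "x \<in> carr S" "(\<lambda>n. dst S (X n) x) \<longlonglongrightarrow> 0"
    and Y: "\<And>n. Y n \<in> carr S" "y \<in> carr S" "(\<lambda>n. dst S (Y n) y) \<longlonglongrightarrow> 0"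
  shows "(\<lambda>n. ip S (X n) (Y n)) \<longlonglongrightarrow> ip S x y"
proof -
  have "(\<lambda>n. dst S (X n) x * (nrm S y + dst S (Y n) y)
      + nrm S x * dst S (Y n) y) \<longlonglongrightarrow> 0 * (nrm S y + 0) + nrm S x * 0"
    by (intro tendsto_intros X Y)
  then have *: "(\<lambda>n. dst S (X n) x * (nrm S y + dst S (Y n) y)
      + nrm S x * dst S (Y n) y) \<longlonglongrightarrow> 0" by simp
  have "cmod (ip S (X n) (Y n) - ip S x y)
      \<le> dst S (X n) x * (nrm S y + dst S (Y n) y) + nrm S x * dst S (Y n) y" for n
  proof -
    have "dst S (X n) x * nrm S (Y n)
        \<le> dst S (X n) x * (nrm S y + dst S (Y n) y)"
      using X Y by (intro mult_left_mono nrm_le_add_sub) auto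
    then show ?thesis using ip_diff_le[of "X n" "Y n" x y] X Y by simp
  qed
  then have "(\<lambda>n. ip S (X n) (Y n) - ip S x y) \<longlonglongrightarrow> 0"
    by (intro Lim_null_comparison[OF _ *] always_eventually) auto
  then show ?thesis by (simp add: LIM_zero_iff)
qed

lemma nrm_tendsto:
  assumes "\<And>n. X n \<in> carr S" "x \<in> carr S" "(\<lambda>n. dst S (X n) x) \<longlonglongrightarrow> 0"
  shows "(\<lambda>n. nrm S (X n)) \<longlonglongrightarrow> nrm S x"
  unfolding nrm_def by (intro tendsto_intros ip_tendsto assms)

lemma cauchy_in_of_convergent:
  assumes X: "\<And>n. X n \<in> carr S" "x \<in> carr S" "(\<lambda>n. dst S (X n) x) \<longlonglongrightarrow> 0"
  shows "cauchy_in S X"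
  unfolding cauchy_in_def
proof (intro allI impI)
  fix \<epsilon> :: real assume "\<epsilon> > 0"
  then obtain M where M: "\<And>n. n \<ge> M \<Longrightarrow> dst S (X n) x < \<epsilon> / 2"
    using order_tendstoD(2)[OF X(3), of "\<epsilon> / 2"] by (auto simp: eventually_sequentially)
  have "dst S (X m) (X n) < \<epsilon>" if "m \<ge> M" "n \<ge> M" for m n
    using nrm_sub_triangle[of "X m" x "X n"] M[OF that(1)] M[OF that(2)] X nrm_sub_commute[of "X n" x]
    by simp
  then show "\<exists>M. \<forall>m\<ge>M. \<forall>n\<ge>M. dst S (X m) (X n) < \<epsilon>" by blast
qed

end

text \<open>The same map class covers both the passage to a quotient by null vectors and a relabelling
  of the elements.\<close>

definition isometric_image :: "('a \<Rightarrow> 'b) \<Rightarrow> 'a ips \<Rightarrow> 'b ips \<Rightarrow> bool" where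
  "isometric_image f S T \<longleftrightarrow> carr T = f ` carr S \<and> zer T = f (zer S) \<and>
     (\<forall>x\<in>carr S. \<forall>y\<in>carr S. add T (f x) (f y) = f (add S x y)) \<and>
     (\<forall>c. \<forall>x\<in>carr S. smul T c (f x) = f (smul S c x)) \<and>
     (\<forall>x\<in>carr S. \<forall>y\<in>carr S. ip T (f x) (f y) = ip S x y)"

lemma isometric_imageD:
  assumes "isometric_image f S T"
  shows "carr T = f ` carr S" "zer T = f (zer S)"
    "x \<in> carr S \<Longrightarrow> y \<in> carr S \<Longrightarrow> add T (f x) (f y) = f (add S x y)"
    "x \<in> carr S \<Longrightarrow> smul T c (f x) = f (smul S c x)"
    "x \<in> carr S \<Longrightarrow> y \<in> carr S \<Longrightarrow> ip T (f x) (f y) = ip S x y"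
  using assms by (auto simp: isometric_image_def)

lemma (in semi_ip_space) isometric_image_sub:
  "isometric_image f S T \<Longrightarrow> x \<in> carr S \<Longrightarrow> y \<in> carr S \<Longrightarrow> sub T (f x) (f y) = f (sub S x y)"
  by (simp add: sub_def isometric_imageD)

lemma (in semi_ip_space) isometric_image_nrm:
  "isometric_image f S T \<Longrightarrow> x \<in> carr S \<Longrightarrow> nrm T (f x) = nrm S x"
  by (simp add: nrm_def isometric_imageD)

lemma (in semi_ip_space) semi_ip_space_image:
  assumes "isometric_image f S T"
  shows "semi_ip_space T"
proof
  note D = isometric_imageD[OF assms]
  show "zer T \<in> carr T" by (simp add: D)
  fix x y z :: 'b and c d
  {
    assume "x \<in> carr T" "y \<in> carr T"
    then show "add T x y \<in> carr T" "add T x y = add T y x"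
      "smul T c (add T x y) = add T (smul T c x) (smul T c y)"
      by (auto simp: D add_commute smul_add_right)
    from \<open>x \<in> carr T\<close> \<open>y \<in> carr T\<close> show "ip T x y = cnj (ip T y x)"
      by (auto simp: D intro: ip_commute)
    from \<open>x \<in> carr T\<close> \<open>y \<in> carr T\<close> show "ip T x (smul T c y) = c * ip T x y"
      by (auto simp: D ip_smul_right)
  }
  {
    assume "x \<in> carr T"
    then show "smul T c x \<in> carr T" "add T x (zer T) = x" "add T x (smul T (- 1) x) = zer T"
      "smul T 1 x = x" "smul T c (smul T d x) = smul T (c * d) x"
      "smul T (c + d) x = add T (smul T c x) (smul T d x)" "0 \<le> Re (ip T x x)"
      by (auto simp: D add_zer add_inverse smul_one smul_smul smul_add_left ip_nonneg)
  }
  {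
    assume "x \<in> carr T" "y \<in> carr T" "z \<in> carr T"
    then show "add T (add T x y) z = add T x (add T y z)" "ip T x (add T y z) = ip T x y + ip T x z"
      by (auto simp: D add_assoc ip_add_right)
  }
qed

text \<open>The map may identify vectors, but it preserves distances, so any choice of preimages of
  a Cauchy sequence is again Cauchy and its limit can be mapped forward.\<close>

lemma (in semi_ip_space) complete_ips_image:
  assumes f: "isometric_image f S T" and S: "complete_ips S"
  shows "complete_ips T"
  unfolding complete_ips_def
proof (intro allI impI)
  fix Y assume "\<forall>n. Y n \<in> carr T" and Cau: "cauchy_in T Y"
  then have "\<forall>n. \<exists>x. x \<in> carr S \<and> Y n = f x" by (auto simp: isometric_imageD[OF f])
  then obtain X where X: "\<And>n. X n \<in> carr S" "\<And>n. Y n = f (X n)" by metis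
  have "dst T (Y m) (Y n) = dst S (X m) (X n)" for m n
    using X by (simp add: isometric_image_sub[OF f] isometric_image_nrm[OF f])
  then have "cauchy_in S X" using Cau by (simp add: cauchy_in_def)
  then obtain x where x: "x \<in> carr S" "(\<lambda>n. dst S (X n) x) \<longlonglongrightarrow> 0"
    using S X(1) unfolding complete_ips_def by blast
  then show "\<exists>y\<in>carr T. (\<lambda>n. dst T (Y n) y) \<longlonglongrightarrow> 0"
    using X by (auto simp: isometric_imageD[OF f] isometric_image_sub[OF f] isometric_image_nrm[OF f])
qed

lemma (in hilbert_space) complete_ips: "complete_ips S"
  using complete by (auto simp: complete_ips_def)

lemma hilbert_spaceI:
  assumes "semi_ip_space S" "complete_ips S"
    and "\<And>x. x \<in> carr S \<Longrightarrow> ip S x x = 0 \<Longrightarrow> x = zer S"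
  shows "hilbert_space S"
  using assms by (auto simp: hilbert_space_def hilbert_space_axioms_def complete_ips_def)

text \<open>Serves for the relabelling of the fibres by \<open>Inl\<close> and
  \<open>Inr\<close>.\<close>

lemma (in hilbert_space) hilbert_space_image:
  assumes f: "isometric_image f S T"
  shows "hilbert_space T"
proof (rule hilbert_spaceI)
  show "semi_ip_space T" by (rule semi_ip_space_image[OF f])
  show "complete_ips T" by (rule complete_ips_image[OF f complete_ips])
  show "x = zer T" if "x \<in> carr T" "ip T x x = 0" for x
    using that ip_definite by (auto simp: isometric_imageD[OF f])
qed

lemma (in hilbert_space) eq_iff_nrm_sub:
  "x \<in> carr S \<Longrightarrow> y \<in> carr S \<Longrightarrow> dst S x y = 0 \<longleftrightarrow> x = y"
  using ip_definite[of "sub S x y"] sub_eq_zer_imp_eq[of x y] by (auto simp: nrm_eq_0_iff ip_simps)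


section \<open>Quotient by the null vectors\<close>

context semi_ip_space
begin

lemma mem_null_space: "x \<in> null_space S \<longleftrightarrow> x \<in> carr S \<and> nrm S x = 0"
  by (auto simp: null_space_def nrm_eq_0_iff)

lemma coset_null_space:
  "x \<in> carr S \<Longrightarrow> coset S (null_space S) x = {y \<in> carr S. dst S y x = 0}"
  by (auto simp: coset_def mem_null_space)

lemma coset_eq_iff:
  assumes "x \<in> carr S" "y \<in> carr S"
  shows "coset S (null_space S) x = coset S (null_space S) y \<longleftrightarrow> dst S x y = 0"
proof
  show "dst S x y = 0" if "coset S (null_space S) x = coset S (null_space S) y"
  proof -
    have "x \<in> coset S (null_space S) x" using assms by (simp add: coset_null_space)
    then show ?thesis using assms that by (simp add: coset_null_space)
  qed
  assume 0: "dst S x y = 0"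
  have "dst S z x = 0 \<longleftrightarrow> dst S z y = 0" if "z \<in> carr S" for z
    using nrm_sub_triangle[of z x y] nrm_sub_triangle[of z y x] nrm_sub_commute[of x y] 0 that assms
      nrm_nonneg[of "sub S z x"] nrm_nonneg[of "sub S z y"] by (simp del: nrm_nonneg)
  then show "coset S (null_space S) x = coset S (null_space S) y"
    using assms by (auto simp: coset_null_space)
qed

lemma rep_coset:
  assumes "x \<in> carr S"
  shows "rep (coset S (null_space S) x) \<in> carr S" "dst S (rep (coset S (null_space S) x)) x = 0"
proof -
  have "x \<in> coset S (null_space S) x" using assms by (simp add: coset_null_space)
  then have "rep (coset S (null_space S) x) \<in> coset S (null_space S) x"
    unfolding rep_def by (rule someI)
  then show "rep (coset S (null_space S) x) \<in> carr S" "dst S (rep (coset S (null_space S) x)) x = 0"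
    using assms by (auto simp: coset_null_space)
qed

text \<open>The operations of \<open>quot\<close> act on representatives picked by
  \<open>rep\<close>. Such a representative differs from the given vector by a null vector, and the
  distance estimates show that this changes neither cosets nor inner products.\<close>

lemma isometric_image_separation: "isometric_image (coset S (null_space S)) S (separation S)"
proof -
  let ?c = "coset S (null_space S)"
  have "?c (add S (rep (?c x)) (rep (?c y))) = ?c (add S x y)" if "x \<in> carr S" "y \<in> carr S" for x y
    using that rep_coset[of x] rep_coset[of y] nrm_sub_add_le[of "rep (?c x)" "rep (?c y)" x y]
      nrm_nonneg[of "sub S (add S (rep (?c x)) (rep (?c y))) (add S x y)"]
    by (simp add: coset_eq_iff antisym)
  moreover have "?c (smul S c (rep (?c x))) = ?c (smul S c x)" if "x \<in> carr S" for x c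
    using that rep_coset[of x] by (simp add: coset_eq_iff nrm_sub_smul)
  moreover have "ip S (rep (?c x)) (rep (?c y)) = ip S x y" if "x \<in> carr S" "y \<in> carr S" for x y
    using that rep_coset[of x] rep_coset[of y] ip_diff_le[of "rep (?c x)" "rep (?c y)" x y] by simp
  ultimately show ?thesis
    by (simp add: isometric_image_def separation_def quot_def)
qed

lemma semi_ip_space_separation: "semi_ip_space (separation S)"
  by (rule semi_ip_space_image[OF isometric_image_separation])

text \<open>Completeness is inherited along the coset map, and definiteness is what the quotient
  adds. Both the completion and the direct integral become Hilbert spaces in this way.\<close>

lemma hilbert_space_separation:
  assumes "complete_ips S"
  shows "hilbert_space (separation S)"
proof (rule hilbert_spaceI)
  note D = isometric_imageD[OF isometric_image_separation]
  show "x = zer (separation S)" if x: "x \<in> carr (separation S)" "ip (separation S) x x = 0" for x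
  proof -
    obtain y where y: "y \<in> carr S" "x = coset S (null_space S) y" "ip S y y = 0"
      using x by (auto simp: D)
    then show ?thesis by (simp add: D coset_eq_iff nrm_eq_0_iff ip_simps)
  qed
qed (rule semi_ip_space_separation complete_ips_image[OF isometric_image_separation assms])+

end

section \<open>Isometric isomorphism from a common dense set\<close>

text \<open>Distances are determined by inner products, so \<open>b\<close> turns a sequence whose
  \<open>a\<close>-images converge into a Cauchy sequence. The maps start from a bare index set
  \<open>D\<close>; the statement can therefore be applied again with \<open>a\<close> and
  \<open>b\<close> exchanged.\<close>

lemma dense_isometry_extension:
  assumes "semi_ip_space H" "semi_ip_space K" "complete_ips K"
    and a: "\<And>d. d \<in> D \<Longrightarrow> a d \<in> carr H" and b: "\<And>d. d \<in> D \<Longrightarrow> b d \<in> carr K"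
    and ip_eq: "\<And>d d'. d \<in> D \<Longrightarrow> d' \<in> D \<Longrightarrow> ip K (b d) (b d') = ip H (a d) (a d')"
    and dense: "\<And>\<epsilon>. \<epsilon> > 0 \<Longrightarrow> \<exists>d\<in>D. dst H (a d) x < \<epsilon>"
    and x: "x \<in> carr H"
  shows "\<exists>y\<in>carr K. \<exists>d. (\<forall>n. d n \<in> D) \<and> (\<lambda>n. dst H (a (d n)) x) \<longlonglongrightarrow> 0 \<and>
           (\<lambda>n. dst K (b (d n)) y) \<longlonglongrightarrow> 0"
proof -
  interpret H: semi_ip_space H by fact
  interpret K: semi_ip_space K by fact
  have "\<forall>n. \<exists>d. d \<in> D \<and> dst H (a d) x < inverse (real (Suc n))"
    using dense by (metis inverse_Suc of_nat_Suc)
  then obtain d where d: "\<And>n. d n \<in> D" "\<And>n. dst H (a (d n)) x < inverse (real (Suc n))"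
    by metis
  have lim: "(\<lambda>n. dst H (a (d n)) x) \<longlonglongrightarrow> 0"
    by (rule tendsto_sandwich[OF _ _ tendsto_const LIMSEQ_inverse_real_of_nat])
      (use a d x in \<open>auto intro!: always_eventually less_imp_le\<close>)
  have "dst K (b (d m)) (b (d n)) = dst H (a (d m)) (a (d n))" for m n
    using a b d by (simp add: nrm_def K.ip_simps H.ip_simps ip_eq)
  moreover have "cauchy_in H (\<lambda>n. a (d n))"
    by (rule H.cauchy_in_of_convergent[OF _ x lim]) (use a d in auto)
  ultimately have "cauchy_in K (\<lambda>n. b (d n))" by (simp add: cauchy_in_def)
  then show ?thesis
    using \<open>complete_ips K\<close> b d lim unfolding complete_ips_def by metis
qed

text \<open>Preservation of inner products does all the work: a vector identity between images holds
  once the difference has inner product zero with itself, and that scalar can be computed on the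
  other side. Linearity, injectivity and surjectivity of \<open>U\<close> are all obtained
  so.\<close>

lemma isometrically_isomorphic_if_dense:
  assumes "hilbert_space H" "hilbert_space K"
    and a: "\<And>d. d \<in> D \<Longrightarrow> a d \<in> carr H" and b: "\<And>d. d \<in> D \<Longrightarrow> b d \<in> carr K"
    and ip_eq: "\<And>d d'. d \<in> D \<Longrightarrow> d' \<in> D \<Longrightarrow> ip K (b d) (b d') = ip H (a d) (a d')"
    and dense_a: "\<And>x \<epsilon>. x \<in> carr H \<Longrightarrow> \<epsilon> > 0 \<Longrightarrow> \<exists>d\<in>D. dst H (a d) x < \<epsilon>"
    and dense_b: "\<And>y \<epsilon>. y \<in> carr K \<Longrightarrow> \<epsilon> > 0 \<Longrightarrow> \<exists>d\<in>D. dst K (b d) y < \<epsilon>"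
  shows "isometrically_isomorphic H K"
proof -
  interpret H: hilbert_space H by fact
  interpret K: hilbert_space K by fact
  \<comment> \<open>\<open>R x y\<close> says that \<open>x\<close> and \<open>y\<close> are limits
    along one and the same sequence of indices. By \<open>ip_R\<close> it preserves inner products,
    whichever sequences are used.\<close>
  define R where "R x y \<longleftrightarrow> y \<in> carr K \<and> x \<in> carr H \<and> (\<exists>d. (\<forall>n. d n \<in> D) \<and>
    (\<lambda>n. dst H (a (d n)) x) \<longlonglongrightarrow> 0 \<and> (\<lambda>n. dst K (b (d n)) y) \<longlonglongrightarrow> 0)" for x y
  have ip_R: "ip K y y' = ip H x x'" if R: "R x y" "R x' y'" for x y x' y'
  proof -
    obtain d d' where d: "\<And>n. d n \<in> D" "(\<lambda>n. dst H (a (d n)) x) \<longlonglongrightarrow> 0"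
        "(\<lambda>n. dst K (b (d n)) y) \<longlonglongrightarrow> 0"
      and d': "\<And>n. d' n \<in> D" "(\<lambda>n. dst H (a (d' n)) x') \<longlonglongrightarrow> 0"
        "(\<lambda>n. dst K (b (d' n)) y') \<longlonglongrightarrow> 0"
      using R unfolding R_def by blast
    have "(\<lambda>n. ip H (a (d n)) (a (d' n))) \<longlonglongrightarrow> ip H x x'"
      using that by (intro H.ip_tendsto d d' a) (auto simp: R_def)
    moreover have "(\<lambda>n. ip K (b (d n)) (b (d' n))) \<longlonglongrightarrow> ip K y y'"
      using that by (intro K.ip_tendsto d d' b) (auto simp: R_def)
    ultimately show ?thesis
      using d d' by (simp add: ip_eq LIMSEQ_unique)
  qed
  have ex_R: "\<exists>y. R x y" if "x \<in> carr H" for x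
    using dense_isometry_extension[OF H.semi_ip_space_axioms K.semi_ip_space_axioms
        K.complete_ips a b ip_eq dense_a[OF that] that] that unfolding R_def by blast
  have ex_R': "\<exists>x. R x y" if "y \<in> carr K" for y
    using dense_isometry_extension[OF K.semi_ip_space_axioms H.semi_ip_space_axioms
        H.complete_ips b a ip_eq[symmetric] dense_b[OF that] that] that unfolding R_def by blast
  define U where "U x = (SOME y. R x y)" for x
  have U: "R x (U x)" if "x \<in> carr H" for x
    unfolding U_def using ex_R[OF that] by (rule someI_ex)
  have U_carr [simp]: "U x \<in> carr K" if "x \<in> carr H" for x using U[OF that] by (simp add: R_def)
  have U_ip [simp]: "ip K (U x) (U y) = ip H x y" if "x \<in> carr H" "y \<in> carr H" for x y
    using ip_R U that by blast
  have K_eqI: "y = z" if "y \<in> carr K" "z \<in> carr K" "ip K (sub K y z) (sub K y z) = 0" for y z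
    using that by (metis K.eq_iff_nrm_sub K.nrm_eq_0_iff K.sub_closed)
  have "inj_on U (carr H)"
  proof (rule inj_onI)
    fix x y assume *: "x \<in> carr H" "y \<in> carr H" "U x = U y"
    have "ip H (sub H x y) (sub H x y) = ip K (sub K (U x) (U y)) (sub K (U x) (U y))"
      using *(1,2) by (simp add: H.ip_simps K.ip_simps)
    then have "ip H (sub H x y) (sub H x y) = 0" using * by (simp add: K.ip_simps)
    then show "x = y" using * by (metis H.eq_iff_nrm_sub H.nrm_eq_0_iff H.sub_closed)
  qed
  moreover have "U ` carr H = carr K"
  proof (intro equalityI subsetI)
    fix y assume y: "y \<in> carr K"
    then obtain x where x: "R x y" using ex_R' by blast
    then have xH: "x \<in> carr H" by (simp add: R_def)
    \<comment> \<open>All inner products among \<open>y\<close> and \<open>U x\<close> equal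
      \<open>ip H x x\<close>, so their difference is a null vector.\<close>
    note ip_R[OF x x] ip_R[OF x U[OF xH]] ip_R[OF U[OF xH] x]
    then have "y = U x" by (intro K_eqI) (use y xH in \<open>simp_all add: K.ip_simps\<close>)
    then show "y \<in> U ` carr H" using xH by blast
  qed auto
  moreover have "U (add H x y) = add K (U x) (U y)" if "x \<in> carr H" "y \<in> carr H" for x y
    by (rule K_eqI) (use that in \<open>simp_all add: K.ip_simps H.ip_simps\<close>)
  moreover have "U (smul H c x) = smul K c (U x)" if "x \<in> carr H" for c x
    by (rule K_eqI) (use that in \<open>simp_all add: K.ip_simps H.ip_simps\<close>)
  ultimately show ?thesis
    unfolding isometrically_isomorphic_def bij_betw_def by (intro exI[of _ U]) auto
qed

section \<open>Completion\<close>

text \<open>Each term of a Cauchy sequence is replaced by an element of \<open>D\<close> within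
  \<open>1/(n+1)\<close>. The new sequence is Cauchy by a three-epsilon estimate, and its limit
  serves the old one too.\<close>

lemma complete_ips_if_dense:
  assumes "semi_ip_space T" and D: "D \<subseteq> carr T"
    and dense: "\<And>x \<epsilon>. x \<in> carr T \<Longrightarrow> \<epsilon> > 0 \<Longrightarrow> \<exists>d\<in>D. dst T d x < \<epsilon>"
    and conv: "\<And>X. (\<And>n. X n \<in> D) \<Longrightarrow> cauchy_in T X \<Longrightarrow>
      \<exists>x\<in>carr T. (\<lambda>n. dst T (X n) x) \<longlonglongrightarrow> 0"
  shows "complete_ips T"
  unfolding complete_ips_def
proof (intro allI impI)
  interpret semi_ip_space T by fact
  fix X assume X: "\<forall>n. X n \<in> carr T" and Cau: "cauchy_in T X"
  have "\<forall>n. \<exists>d. d \<in> D \<and> dst T d (X n) < inverse (real (Suc n))"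
    using dense X by (metis inverse_Suc of_nat_Suc)
  then obtain d where d: "\<And>n. d n \<in> D" "\<And>n. dst T (d n) (X n) < inverse (real (Suc n))"
    by metis
  have dT: "d n \<in> carr T" for n using d(1) D by blast
  have lim: "(\<lambda>n. dst T (d n) (X n)) \<longlonglongrightarrow> 0"
    by (rule tendsto_sandwich[OF _ _ tendsto_const LIMSEQ_inverse_real_of_nat])
      (use dT d(2) X in \<open>auto intro!: always_eventually less_imp_le\<close>)
  have "cauchy_in T d"
    unfolding cauchy_in_def
  proof (intro allI impI)
    fix \<epsilon> :: real assume "\<epsilon> > 0"
    then have "\<epsilon> / 3 > 0" by simp
    obtain M where M: "\<And>m n. m \<ge> M \<Longrightarrow> n \<ge> M \<Longrightarrow> dst T (X m) (X n) < \<epsilon> / 3"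
      using Cau \<open>\<epsilon> / 3 > 0\<close> unfolding cauchy_in_def by blast
    obtain M' where M': "\<And>n. n \<ge> M' \<Longrightarrow> dst T (d n) (X n) < \<epsilon> / 3"
      using order_tendstoD(2)[OF lim \<open>\<epsilon> / 3 > 0\<close>] by (auto simp: eventually_sequentially)
    have "dst T (d m) (d n) < \<epsilon>" if "m \<ge> max M M'" "n \<ge> max M M'" for m n
    proof -
      have "dst T (d m) (d n) \<le> dst T (d m) (X m) + dst T (X m) (d n)"
        using X dT by (intro nrm_sub_triangle) auto
      also have "dst T (X m) (d n) \<le> dst T (X m) (X n) + dst T (X n) (d n)"
        using X dT by (intro nrm_sub_triangle) auto
      finally show ?thesis
        using M[of m n] M'[of m] M'[of n] that X dT nrm_sub_commute[of "X n" "d n"] by simp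
    qed
    then show "\<exists>M. \<forall>m\<ge>M. \<forall>n\<ge>M. dst T (d m) (d n) < \<epsilon>" by blast
  qed
  then obtain x where x: "x \<in> carr T" "(\<lambda>n. dst T (d n) x) \<longlonglongrightarrow> 0"
    using conv[of d] d(1) by blast
  have bound: "(\<lambda>n. dst T (d n) (X n) + dst T (d n) x) \<longlonglongrightarrow> 0"
    using tendsto_add[OF lim x(2)] by simp
  have "dst T (X n) x \<le> dst T (d n) (X n) + dst T (d n) x" for n
    using nrm_sub_triangle[of "X n" "d n" x] nrm_sub_commute[of "X n" "d n"] X dT x by simp
  then have "(\<lambda>n. dst T (X n) x) \<longlonglongrightarrow> 0"
    by (intro tendsto_sandwich[OF _ _ tendsto_const bound]) (use X x in auto)
  then show "\<exists>x\<in>carr T. (\<lambda>n. dst T (X n) x) \<longlonglongrightarrow> 0" using x by blast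
qed

context semi_ip_space
begin

abbreviation "CS \<equiv> cauchy_space S"

lemma carr_cauchy_space: "carr CS = {X. (\<forall>n. X n \<in> carr S) \<and> cauchy_in S X}"
  and zer_cauchy_space: "zer CS = (\<lambda>n. zer S)"
  and add_cauchy_space: "add CS X Y = (\<lambda>n. add S (X n) (Y n))"
  and smul_cauchy_space: "smul CS c X = (\<lambda>n. smul S c (X n))"
  and sub_cauchy_space: "sub CS X Y = (\<lambda>n. sub S (X n) (Y n))"
  by (simp_all add: cauchy_space_def sub_def)

lemmas cauchy_space_simps =
  carr_cauchy_space zer_cauchy_space add_cauchy_space smul_cauchy_space sub_cauchy_space

lemma cauchy_in_bounded:
  assumes X: "\<And>n. X n \<in> carr S" and Cau: "cauchy_in S X"
  shows "\<exists>B>0. \<forall>n. nrm S (X n) \<le> B"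
proof -
  have "Cauchy (\<lambda>n. nrm S (X n))"
  proof (rule metric_CauchyI)
    fix \<epsilon> :: real assume "\<epsilon> > 0"
    then obtain M where "\<And>m n. m \<ge> M \<Longrightarrow> n \<ge> M \<Longrightarrow> dst S (X m) (X n) < \<epsilon>"
      using Cau unfolding cauchy_in_def by blast
    then show "\<exists>M. \<forall>m\<ge>M. \<forall>n\<ge>M. dist (nrm S (X m)) (nrm S (X n)) < \<epsilon>"
      unfolding dist_real_def using nrm_diff_le X by (meson le_less_trans)
  qed
  then have "Bseq (\<lambda>n. nrm S (X n))" by (simp add: Cauchy_convergent_iff convergent_imp_Bseq)
  then show ?thesis using X by (auto simp: Bseq_def)
qed

text \<open>The inner product of \<open>cauchy_space\<close> is written with \<open>lim\<close>,
  which says something only if the limit exists. Here existence is proved, and every later property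
  is obtained by passing to the limit.\<close>

lemma ip_cauchy_space_tendsto:
  assumes "X \<in> carr CS" "Y \<in> carr CS"
  shows "(\<lambda>n. ip S (X n) (Y n)) \<longlonglongrightarrow> ip CS X Y"
proof -
  have XY: "\<And>n. X n \<in> carr S" "cauchy_in S X" "\<And>n. Y n \<in> carr S" "cauchy_in S Y"
    using assms by (auto simp: carr_cauchy_space)
  obtain A B where A: "A > 0" "\<And>n. nrm S (X n) \<le> A" and B: "B > 0" "\<And>n. nrm S (Y n) \<le> B"
    using cauchy_in_bounded XY by metis
  have "Cauchy (\<lambda>n. ip S (X n) (Y n))"
  proof (rule metric_CauchyI)
    fix \<epsilon> :: real assume "\<epsilon> > 0"
    then have pos: "\<epsilon> / (2 * B) > 0" "\<epsilon> / (2 * A) > 0" using A B by auto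
    obtain M where M: "\<And>m n. m \<ge> M \<Longrightarrow> n \<ge> M \<Longrightarrow> dst S (X m) (X n) < \<epsilon> / (2 * B)"
      using XY(2) pos unfolding cauchy_in_def by blast
    obtain M' where M': "\<And>m n. m \<ge> M' \<Longrightarrow> n \<ge> M' \<Longrightarrow> dst S (Y m) (Y n) < \<epsilon> / (2 * A)"
      using XY(4) pos unfolding cauchy_in_def by blast
    have "dist (ip S (X m) (Y m)) (ip S (X n) (Y n)) < \<epsilon>"
      if mn: "m \<ge> max M M'" "n \<ge> max M M'" for m n
    proof -
      have "dist (ip S (X m) (Y m)) (ip S (X n) (Y n))
          \<le> dst S (X m) (X n) * nrm S (Y m) + nrm S (X n) * dst S (Y m) (Y n)"
        unfolding dist_norm using XY by (intro ip_diff_le) auto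
      also have "\<dots> \<le> dst S (X m) (X n) * B + A * dst S (Y m) (Y n)"
        using A B XY by (intro add_mono mult_left_mono mult_right_mono) auto
      also have "\<dots> < \<epsilon> / (2 * B) * B + A * (\<epsilon> / (2 * A))"
        using A B XY M M' mn by (intro add_strict_mono mult_strict_left_mono mult_strict_right_mono) auto
      also have "\<dots> = \<epsilon>" using A B by simp
      finally show ?thesis .
    qed
    then show "\<exists>M. \<forall>m\<ge>M. \<forall>n\<ge>M. dist (ip S (X m) (Y m)) (ip S (X n) (Y n)) < \<epsilon>" by blast
  qed
  then show ?thesis
    by (simp add: cauchy_space_def Cauchy_convergent_iff convergent_LIMSEQ_iff)
qed

lemma cauchy_in_add:
  assumes X: "\<And>n. X n \<in> carr S" "cauchy_in S X" and Y: "\<And>n. Y n \<in> carr S" "cauchy_in S Y"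
  shows "cauchy_in S (\<lambda>n. add S (X n) (Y n))"
  unfolding cauchy_in_def
proof (intro allI impI)
  fix \<epsilon> :: real assume "\<epsilon> > 0"
  then have pos: "\<epsilon> / 2 > 0" by simp
  obtain M where M: "\<And>m n. m \<ge> M \<Longrightarrow> n \<ge> M \<Longrightarrow> dst S (X m) (X n) < \<epsilon> / 2"
    using X(2) pos unfolding cauchy_in_def by blast
  obtain M' where M': "\<And>m n. m \<ge> M' \<Longrightarrow> n \<ge> M' \<Longrightarrow> dst S (Y m) (Y n) < \<epsilon> / 2"
    using Y(2) pos unfolding cauchy_in_def by blast
  have "dst S (add S (X m) (Y m)) (add S (X n) (Y n)) < \<epsilon>"
    if "m \<ge> max M M'" "n \<ge> max M M'" for m n
    using nrm_sub_add_le[of "X m" "Y m" "X n" "Y n"] M[of m n] M'[of m n] that X Y by simp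
  then show "\<exists>M. \<forall>m\<ge>M. \<forall>n\<ge>M. dst S (add S (X m) (Y m)) (add S (X n) (Y n)) < \<epsilon>"
    by blast
qed

lemma cauchy_in_smul:
  assumes X: "\<And>n. X n \<in> carr S" "cauchy_in S X"
  shows "cauchy_in S (\<lambda>n. smul S c (X n))"
  unfolding cauchy_in_def
proof (intro allI impI)
  fix \<epsilon> :: real assume "\<epsilon> > 0"
  \<comment> \<open>Adding 1 keeps the denominator positive when \<open>c = 0\<close>.\<close>
  then have pos: "\<epsilon> / (cmod c + 1) > 0" by (simp add: add_nonneg_pos)
  obtain M where M: "\<And>m n. m \<ge> M \<Longrightarrow> n \<ge> M \<Longrightarrow> dst S (X m) (X n) < \<epsilon> / (cmod c + 1)"
    using X(2) pos unfolding cauchy_in_def by blast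
  have "dst S (smul S c (X m)) (smul S c (X n)) < \<epsilon>" if "m \<ge> M" "n \<ge> M" for m n
  proof -
    have "cmod c * dst S (X m) (X n) \<le> (cmod c + 1) * dst S (X m) (X n)"
      using X by (intro mult_right_mono) auto
    also have "\<dots> < \<epsilon>"
      using M[OF that] by (simp add: pos_less_divide_eq add_nonneg_pos mult.commute)
    finally show ?thesis using X by (simp add: nrm_sub_smul)
  qed
  then show "\<exists>M. \<forall>m\<ge>M. \<forall>n\<ge>M. dst S (smul S c (X m)) (smul S c (X n)) < \<epsilon>" by blast
qed

lemma const_in_cauchy_space [simp]: "x \<in> carr S \<Longrightarrow> (\<lambda>n. x) \<in> carr CS"
  by (auto simp: carr_cauchy_space cauchy_in_def)

lemma semi_ip_space_cauchy_space: "semi_ip_space CS"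
proof
  let ?C = CS
  note lim = ip_cauchy_space_tendsto
  show "zer ?C \<in> carr ?C" by (simp add: zer_cauchy_space)
  fix X Y Z :: "nat \<Rightarrow> 'a" and c d :: complex
  show add_C: "add ?C X Y \<in> carr ?C" if "X \<in> carr ?C" "Y \<in> carr ?C" for X Y
    using that by (auto simp: cauchy_space_simps intro!: cauchy_in_add)
  show smul_C: "smul ?C c X \<in> carr ?C" if "X \<in> carr ?C" for c X
    using that by (auto simp: cauchy_space_simps intro!: cauchy_in_smul)
  {
    assume X: "X \<in> carr ?C"
    then show "add ?C X (zer ?C) = X" "add ?C X (smul ?C (- 1) X) = zer ?C" "smul ?C 1 X = X"
      "smul ?C c (smul ?C d X) = smul ?C (c * d) X"
      "smul ?C (c + d) X = add ?C (smul ?C c X) (smul ?C d X)"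
      by (auto simp: cauchy_space_simps add_zer add_inverse smul_one smul_smul smul_add_left)
    show "0 \<le> Re (ip ?C X X)"
      by (rule LIMSEQ_le_const[OF tendsto_Re[OF lim[OF X X]]])
        (use X in \<open>auto simp: cauchy_space_simps ip_nonneg\<close>)
  }
  {
    assume X: "X \<in> carr ?C" and Y: "Y \<in> carr ?C"
    then show "add ?C X Y = add ?C Y X"
      "smul ?C c (add ?C X Y) = add ?C (smul ?C c X) (smul ?C c Y)"
      by (auto simp: cauchy_space_simps smul_add_right add_commute)
    have "(\<lambda>n. ip S (X n) (Y n)) = (\<lambda>n. cnj (ip S (Y n) (X n)))"
      using X Y by (auto simp: cauchy_space_simps intro!: ip_commute)
    then show "ip ?C X Y = cnj (ip ?C Y X)"
      using lim[OF X Y] tendsto_cnj[OF lim[OF Y X]] LIMSEQ_unique by auto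
    have "(\<lambda>n. ip S (X n) (smul ?C c Y n)) = (\<lambda>n. c * ip S (X n) (Y n))"
      using X Y by (auto simp: cauchy_space_simps ip_smul_right)
    then show "ip ?C X (smul ?C c Y) = c * ip ?C X Y"
      using lim[OF X smul_C[OF Y, of c]] tendsto_mult_left[OF lim[OF X Y], of c] LIMSEQ_unique by auto
  }
  {
    assume X: "X \<in> carr ?C" and Y: "Y \<in> carr ?C" and Z: "Z \<in> carr ?C"
    then show "add ?C (add ?C X Y) Z = add ?C X (add ?C Y Z)"
      by (auto simp: cauchy_space_simps add_assoc)
    have "(\<lambda>n. ip S (X n) (add ?C Y Z n)) = (\<lambda>n. ip S (X n) (Y n) + ip S (X n) (Z n))"
      using X Y Z by (auto simp: cauchy_space_simps ip_add_right)
    then show "ip ?C X (add ?C Y Z) = ip ?C X Y + ip ?C X Z"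
      using lim[OF X add_C[OF Y Z]] tendsto_add[OF lim[OF X Y] lim[OF X Z]] LIMSEQ_unique by auto
  }
qed

lemma nrm_cauchy_space_tendsto:
  assumes "X \<in> carr CS"
  shows "(\<lambda>n. nrm S (X n)) \<longlonglongrightarrow> nrm CS X"
  unfolding nrm_def by (intro tendsto_intros ip_cauchy_space_tendsto assms)

lemma ip_cauchy_space_const: "ip CS (\<lambda>n. x) (\<lambda>n. y) = ip S x y"
  by (simp add: cauchy_space_def)

lemma nrm_cauchy_space_const: "nrm CS (\<lambda>n. x) = nrm S x"
  by (simp add: nrm_def ip_cauchy_space_const)

text \<open>The distance from the constant sequence \<open>X n\<close> to \<open>X\<close> is the
  limit over \<open>k\<close> of \<open>dst S (X n) (X k)\<close>, which the Cauchy property makes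
  small.\<close>

lemma nrm_cauchy_space_sub_const_tendsto:
  assumes X: "X \<in> carr CS"
  shows "(\<lambda>n. dst CS (\<lambda>_. X n) X) \<longlonglongrightarrow> 0"
proof (rule LIMSEQ_I)
  interpret C: semi_ip_space CS by (rule semi_ip_space_cauchy_space)
  have XS: "X n \<in> carr S" for n using X by (simp add: carr_cauchy_space)
  fix \<epsilon> :: real assume "\<epsilon> > 0"
  then have pos: "\<epsilon> / 2 > 0" by simp
  obtain M where M: "\<And>m n. m \<ge> M \<Longrightarrow> n \<ge> M \<Longrightarrow> dst S (X m) (X n) < \<epsilon> / 2"
    using X pos unfolding carr_cauchy_space cauchy_in_def by blast
  have "norm (dst CS (\<lambda>_. X n) X - 0) < \<epsilon>" if n: "n \<ge> M" for n
  proof -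
    have "(\<lambda>k. dst S (X n) (X k)) \<longlonglongrightarrow> dst CS (\<lambda>_. X n) X"
      using nrm_cauchy_space_tendsto[OF C.sub_closed[OF const_in_cauchy_space[OF XS] X], of n]
      by (simp add: sub_cauchy_space)
    then have "dst CS (\<lambda>_. X n) X \<le> \<epsilon> / 2"
      using M[OF n] by (intro LIMSEQ_le_const2) (auto intro: less_imp_le)
    then show ?thesis using X XS \<open>\<epsilon> > 0\<close> by simp
  qed
  then show "\<exists>M. \<forall>n\<ge>M. norm (dst CS (\<lambda>_. X n) X - 0) < \<epsilon>"
    by blast
qed

lemma const_dense_in_cauchy_space:
  assumes X: "X \<in> carr CS" and "\<epsilon> > 0"
  shows "\<exists>x\<in>carr S. dst CS (\<lambda>n. x) X < \<epsilon>"
  using order_tendstoD(2)[OF nrm_cauchy_space_sub_const_tendsto[OF X] \<open>\<epsilon> > 0\<close>] X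
  by (auto simp: eventually_sequentially carr_cauchy_space)

text \<open>By density it suffices to treat a Cauchy sequence of constant sequences. Their values
  form a single Cauchy sequence in \<open>S\<close>, and this element of the space is the limit; no
  diagonal argument is required.\<close>

lemma complete_ips_cauchy_space: "complete_ips CS"
proof (rule complete_ips_if_dense[OF semi_ip_space_cauchy_space])
  let ?D = "(\<lambda>x n. x) ` carr S"
  show "?D \<subseteq> carr CS" by auto
  show "\<exists>d\<in>?D. dst CS d X < \<epsilon>"
    if "X \<in> carr CS" "\<epsilon> > 0" for X \<epsilon>
    using const_dense_in_cauchy_space[OF that] by auto
  fix X assume X: "\<And>n. X n \<in> ?D" and Cau: "cauchy_in CS X"
  then obtain x where x: "\<And>n. x n \<in> carr S" "\<And>n. X n = (\<lambda>_. x n)"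
    unfolding image_iff by metis
  have "dst CS (X m) (X n) = dst S (x m) (x n)" for m n
    by (simp add: x(2) sub_cauchy_space nrm_cauchy_space_const)
  then have "x \<in> carr CS"
    using Cau x by (simp add: carr_cauchy_space cauchy_in_def)
  then show "\<exists>Y\<in>carr CS. (\<lambda>n. dst CS (X n) Y) \<longlonglongrightarrow> 0"
    using nrm_cauchy_space_sub_const_tendsto x by auto
qed

lemma hilbert_space_completion: "hilbert_space (hilbert_completion S)"
  unfolding hilbert_completion_def
  by (rule semi_ip_space.hilbert_space_separation[OF semi_ip_space_cauchy_space complete_ips_cauchy_space])

lemmas isometric_image_completion =
  semi_ip_space.isometric_image_separation[OF semi_ip_space_cauchy_space, folded hilbert_completion_def]

lemma completion_class_carr: "x \<in> carr S \<Longrightarrow> completion_class S x \<in> carr (hilbert_completion S)"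
  and completion_class_add: "x \<in> carr S \<Longrightarrow> y \<in> carr S \<Longrightarrow>
    add (hilbert_completion S) (completion_class S x) (completion_class S y) = completion_class S (add S x y)"
  and completion_class_smul: "x \<in> carr S \<Longrightarrow>
    smul (hilbert_completion S) c (completion_class S x) = completion_class S (smul S c x)"
  and completion_class_ip: "x \<in> carr S \<Longrightarrow> y \<in> carr S \<Longrightarrow>
    ip (hilbert_completion S) (completion_class S x) (completion_class S y) = ip S x y"
  by (simp_all add: completion_class_def isometric_imageD[OF isometric_image_completion]
      add_cauchy_space smul_cauchy_space ip_cauchy_space_const)

lemma completion_class_dense:
  assumes "X \<in> carr (hilbert_completion S)" "\<epsilon> > 0"
  shows "\<exists>x\<in>carr S. dst (hilbert_completion S) (completion_class S x) X < \<epsilon>"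
proof -
  interpret C: semi_ip_space CS by (rule semi_ip_space_cauchy_space)
  obtain Y where Y: "Y \<in> carr CS" "X = coset CS (null_space CS) Y"
    using assms by (auto simp: isometric_imageD[OF isometric_image_completion])
  obtain x where "x \<in> carr S" "dst CS (\<lambda>n. x) Y < \<epsilon>"
    using const_dense_in_cauchy_space[OF Y(1) \<open>\<epsilon> > 0\<close>] by blast
  then show ?thesis
    using Y by (auto simp: completion_class_def C.isometric_image_sub[OF isometric_image_completion]
        C.isometric_image_nrm[OF isometric_image_completion] intro!: bexI[of _ x])
qed

end

text \<open>The canonical map of a semi-inner product space into its completed quotient. It serves
  both for \<open>C00\<close> and for the fibres, where \<open>const_field\<close> contains the same
  composite.\<close>

definition cembed :: "'a ips \<Rightarrow> 'a \<Rightarrow> (nat \<Rightarrow> 'a set) set" where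
  "cembed S x = completion_class (separation S) (coset S (null_space S) x)"

context semi_ip_space
begin

abbreviation "HC \<equiv> hilbert_completion (separation S)"

lemma hilbert_space_completion_separation: "hilbert_space (hilbert_completion (separation S))"
  by (rule semi_ip_space.hilbert_space_completion[OF semi_ip_space_separation])

lemma cembed_carr:
    "x \<in> carr S \<Longrightarrow> cembed S x \<in> carr HC"
  and cembed_add: "x \<in> carr S \<Longrightarrow> y \<in> carr S \<Longrightarrow>
    add HC (cembed S x) (cembed S y)
      = cembed S (add S x y)"
  and cembed_smul: "x \<in> carr S \<Longrightarrow>
    smul HC c (cembed S x) = cembed S (smul S c x)"
  and cembed_ip: "x \<in> carr S \<Longrightarrow> y \<in> carr S \<Longrightarrow>
    ip HC (cembed S x) (cembed S y) = ip S x y"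
proof -
  interpret Q: semi_ip_space "separation S" by (rule semi_ip_space_separation)
  note D = isometric_imageD[OF isometric_image_separation]
  show "x \<in> carr S \<Longrightarrow> cembed S x \<in> carr HC"
    "x \<in> carr S \<Longrightarrow> y \<in> carr S \<Longrightarrow>
    add HC (cembed S x) (cembed S y)
      = cembed S (add S x y)"
    "x \<in> carr S \<Longrightarrow>
    smul HC c (cembed S x) = cembed S (smul S c x)"
    "x \<in> carr S \<Longrightarrow> y \<in> carr S \<Longrightarrow>
    ip HC (cembed S x) (cembed S y) = ip S x y"
    by (simp_all add: cembed_def D Q.completion_class_carr Q.completion_class_add
        Q.completion_class_smul Q.completion_class_ip)
qed

lemma cembed_dense:
  assumes "X \<in> carr HC" "\<epsilon> > 0"
  shows "\<exists>x\<in>carr S. dst HC (cembed S x) X < \<epsilon>"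
  using semi_ip_space.completion_class_dense[OF semi_ip_space_separation assms]
  by (auto simp: cembed_def isometric_imageD[OF isometric_image_separation])

end

section \<open>Density from a trivial orthogonal complement\<close>

text \<open>A quantitative form of the orthogonality of a minimal residual: if subtracting multiples
  of \<open>a\<close> lowers the squared norm of \<open>z\<close> by at most
  \<open>\<delta>\<close>, the pairing is small. It applies along a minimising sequence, before any
  minimum is known to be attained.\<close>

lemma (in hilbert_space) nearly_orthogonal:
  assumes a: "a \<in> carr S" and z: "z \<in> carr S" and "0 \<le> \<delta>"
    and min: "\<And>c. (nrm S z)\<^sup>2 - \<delta> \<le> (dst S z (smul S c a))\<^sup>2"
  shows "(cmod (ip S a z))\<^sup>2 \<le> \<delta> * (nrm S a)\<^sup>2"
proof -
  have zz: "ip S z a = cnj (ip S a z)" using a z by (intro ip_commute)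
  \<comment> \<open>Only multiples in the direction of \<open>ip S a z\<close> are tested. The
    optimal factor \<open>r\<close> is the inverse of the squared norm of \<open>a\<close>, inserted
    below.\<close>
  have *: "2 * r * (cmod (ip S a z))\<^sup>2 \<le> \<delta> + r\<^sup>2 * (cmod (ip S a z))\<^sup>2 * (nrm S a)\<^sup>2" for r :: real
  proof -
    have "(dst S z (smul S (of_real r * ip S a z) a))\<^sup>2
        = (nrm S z)\<^sup>2 - 2 * Re (of_real r * (ip S a z * cnj (ip S a z))) + (r * cmod (ip S a z) * nrm S a)\<^sup>2"
      unfolding nrm_sub_power2[OF z smul_closed[OF a]]
      using a z by (simp add: nrm_smul norm_mult power_mult_distrib ip_smul_right zz algebra_simps)
    also have "ip S a z * cnj (ip S a z) = of_real ((cmod (ip S a z))\<^sup>2)"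
      by (simp only: complex_norm_square)
    finally show ?thesis
      using min[of "of_real r * ip S a z"] by (simp add: power_mult_distrib)
  qed
  show ?thesis
  proof (cases "nrm S a = 0")
    case True
    have "cmod (ip S a z) \<le> 0" using cauchy_schwarz[OF a z] True by simp
    then show ?thesis using True by simp
  next
    case False
    have "(cmod (ip S a z))\<^sup>2 / (nrm S a)\<^sup>2 \<le> \<delta>"
      using *[of "1 / (nrm S a)\<^sup>2"] False by (simp add: power2_eq_square)
    then show ?thesis using False by (simp add: pos_divide_le_eq)
  qed
qed

text \<open>The projection argument: a minimising sequence in the subspace \<open>A\<close>
  converges to some \<open>y\<close>, the residual \<open>x - y\<close> is orthogonal to
  \<open>A\<close>, and hence \<open>x = y\<close> is a limit of elements of
  \<open>A\<close>.\<close>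

lemma (in hilbert_space) dense_if_orthogonal_trivial:
  assumes A: "A \<subseteq> carr S" "A \<noteq> {}"
    and A_add: "\<And>a b. a \<in> A \<Longrightarrow> b \<in> A \<Longrightarrow> add S a b \<in> A"
    and A_smul: "\<And>c a. a \<in> A \<Longrightarrow> smul S c a \<in> A"
    and orth: "\<And>x. x \<in> carr S \<Longrightarrow> (\<And>a. a \<in> A \<Longrightarrow> ip S a x = 0) \<Longrightarrow> x = zer S"
    and x: "x \<in> carr S" and "\<epsilon> > 0"
  shows "\<exists>a\<in>A. dst S a x < \<epsilon>"
proof -
  have AS: "a \<in> carr S" if "a \<in> A" for a using A that by blast
  define q where "q a = (dst S x a)\<^sup>2" for a
  define \<delta> where "\<delta> = Inf (q ` A)"
  have bdd: "bdd_below (q ` A)" by (rule bdd_belowI[of _ 0]) (auto simp: q_def)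
  have q_ge: "\<delta> \<le> q a" if "a \<in> A" for a
    unfolding \<delta>_def using bdd that by (simp add: cINF_lower)
  have "\<exists>a\<in>A. q a < \<delta> + r" if "r > 0" for r
    using cInf_lessD[of "q ` A" "\<delta> + r"] A that unfolding \<delta>_def by auto
  then have "\<forall>n. \<exists>a. a \<in> A \<and> q a < \<delta> + inverse (real (Suc n))"
    by (metis inverse_Suc of_nat_Suc)
  then obtain a where a: "\<And>n. a n \<in> A" "\<And>n. q (a n) < \<delta> + inverse (real (Suc n))" by metis
  have para: "(dst S (a m) (a n))\<^sup>2 \<le> 2 * inverse (real (Suc m)) + 2 * inverse (real (Suc n))" for m n
  proof -
    \<comment> \<open>The midpoint lies in \<open>A\<close>, so its squared distance to
      \<open>x\<close> is at least the infimum. The parallelogram law then bounds the distance of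
      \<open>a m\<close> and \<open>a n\<close>.\<close>
    define h where "h = smul S (1/2) (add S (a m) (a n))"
    have h: "h \<in> A" using a A_add A_smul by (simp add: h_def)
    have "(dst S (a m) (a n))\<^sup>2 = 2 * q (a m) + 2 * q (a n) - 4 * q h"
      using x AS[OF a(1)] Re_ip_commute[of "a m" "a n"] Re_ip_commute[OF x] AS[OF h]
      by (simp add: q_def nrm_sub_power2 h_def nrm_smul power_mult_distrib nrm_add_power2 ip_simps power_divide
          algebra_simps)
    then show ?thesis using q_ge[OF h] a(2)[of m] a(2)[of n] by linarith
  qed
  have "cauchy_in S a"
    unfolding cauchy_in_def
  proof (intro allI impI)
    fix \<epsilon> :: real assume "\<epsilon> > 0"
    then obtain M where M: "inverse (real (Suc M)) < \<epsilon>\<^sup>2 / 4"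
      using reals_Archimedean[of "\<epsilon>\<^sup>2 / 4"] by auto
    have "dst S (a m) (a n) < \<epsilon>" if "m \<ge> M" "n \<ge> M" for m n
    proof -
      have "inverse (real (Suc m)) \<le> inverse (real (Suc M))" "inverse (real (Suc n)) \<le> inverse (real (Suc M))"
        using that by (simp_all add: le_imp_inverse_le)
      then have "(dst S (a m) (a n))\<^sup>2 < \<epsilon>\<^sup>2" using para[of m n] M by linarith
      then show ?thesis using \<open>\<epsilon> > 0\<close> by (simp add: power2_less_imp_less)
    qed
    then show "\<exists>M. \<forall>m\<ge>M. \<forall>n\<ge>M. dst S (a m) (a n) < \<epsilon>" by blast
  qed
  then obtain y where y: "y \<in> carr S" "(\<lambda>n. dst S (a n) y) \<longlonglongrightarrow> 0"
    using complete[of a] AS a by blast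
  have xy: "(\<lambda>n. dst S (sub S x (a n)) (sub S x y)) \<longlonglongrightarrow> 0"
  proof -
    have "dst S (sub S x (a n)) (sub S x y) = dst S (a n) y" for n
      by (rule nrm_eqI) (use x y AS[OF a(1)] in \<open>simp_all add: ip_simps\<close>)
    then show ?thesis using y by simp
  qed
  have "sub S x y = zer S"
  proof (rule orth)
    fix b assume b: "b \<in> A"
    have "(\<lambda>n. ip S b (sub S x (a n))) \<longlonglongrightarrow> ip S b (sub S x y)"
      by (rule ip_tendsto[OF _ _ _ _ _ xy]) (use x y AS[OF b] AS[OF a(1)] in auto)
    then have lim: "(\<lambda>n. (cmod (ip S b (sub S x (a n))))\<^sup>2) \<longlonglongrightarrow> (cmod (ip S b (sub S x y)))\<^sup>2"
      by (intro tendsto_intros)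
    \<comment> \<open>Moving \<open>a n\<close> within \<open>A\<close> gains at most the defect
      \<open>1/(n+1)\<close>, so the residual is nearly orthogonal to \<open>b\<close>; in the limit
      it is exactly so.\<close>
    have "(cmod (ip S b (sub S x (a n))))\<^sup>2 \<le> inverse (real (Suc n)) * (nrm S b)\<^sup>2" for n
    proof (rule nearly_orthogonal)
      fix c
      have "(dst S (sub S x (a n)) (smul S c b))\<^sup>2 = q (add S (a n) (smul S c b))"
        unfolding q_def by (intro arg_cong[of _ _ "\<lambda>t. t\<^sup>2"] nrm_eqI)
          (use x AS[OF b] AS[OF a(1)] in \<open>simp_all add: ip_simps\<close>)
      then show "(dst S x (a n))\<^sup>2 - inverse (real (Suc n)) \<le> (dst S (sub S x (a n)) (smul S c b))\<^sup>2"
        using q_ge[of "add S (a n) (smul S c b)"] a(1)[of n] a(2)[of n] b A_add A_smul by (simp add: q_def)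
    qed (use x AS[OF b] AS[OF a(1)] in auto)
    moreover have "(\<lambda>n. inverse (real (Suc n)) * (nrm S b)\<^sup>2) \<longlonglongrightarrow> 0"
      using tendsto_mult_right[OF LIMSEQ_inverse_real_of_nat] by simp
    ultimately have "(cmod (ip S b (sub S x y)))\<^sup>2 \<le> 0"
      using LIMSEQ_le[OF lim] by blast
    then show "ip S b (sub S x y) = 0" by simp
  qed (use x y in simp)
  then have "x = y" using x y sub_eq_zer_imp_eq by blast
  then obtain n where "dst S (a n) x < \<epsilon>"
    using order_tendstoD(2)[OF y(2) \<open>\<epsilon> > 0\<close>] by (auto simp: eventually_sequentially)
  then show ?thesis using a by blast
qed

section \<open>Square-integrable fields\<close>

lemma (in semi_ip_space) cauchy_in_geometric:
  assumes Y: "\<And>n. Y n \<in> carr S" and B: "\<And>k. dst S (Y (Suc k)) (Y k) \<le> B * (1/2) ^ k"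
  shows "cauchy_in S Y"
  unfolding cauchy_in_def
proof (intro allI impI)
  \<comment> \<open>The exact value of the geometric sum from \<open>m\<close> to
    \<open>n - 1\<close>, which lets the induction close; the subtracted term is discarded
    afterwards.\<close>
  have le: "dst S (Y n) (Y m) \<le> 2 * B * ((1/2) ^ m - (1/2) ^ n)" if "m \<le> n" for m n
    using that
  proof (induction n rule: dec_induct)
    case base
    then show ?case using Y by simp
  next
    case (step n)
    have "dst S (Y (Suc n)) (Y m) \<le> dst S (Y (Suc n)) (Y n) + dst S (Y n) (Y m)"
      using Y by (intro nrm_sub_triangle)
    also have "\<dots> \<le> B * (1/2) ^ n + 2 * B * ((1/2) ^ m - (1/2) ^ n)"
      using B step by (intro add_mono) auto
    finally show ?case by (simp add: algebra_simps)
  qed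
  have "B \<ge> 0" using order_trans[OF nrm_nonneg B[of 0]] Y by simp
  fix \<epsilon> :: real assume "\<epsilon> > 0"
  obtain M where M: "2 * B * (1/2) ^ M < \<epsilon>"
    using \<open>\<epsilon> > 0\<close> order_tendstoD(2)[OF tendsto_mult_right_zero[OF LIMSEQ_power_zero[of "1/2::real"]], of \<epsilon> "2 * B"]
    by (auto simp: eventually_sequentially)
  have *: "dst S (Y n) (Y m) < \<epsilon>" if "M \<le> m" "m \<le> n" for m n
  proof -
    have "(1/2::real) ^ m - (1/2) ^ n \<le> (1/2) ^ M"
      using power_decreasing[OF that(1), of "1/2::real"] zero_le_power[of "1/2::real" n] by linarith
    then have "2 * B * ((1/2) ^ m - (1/2) ^ n) \<le> 2 * B * (1/2) ^ M"
      using \<open>B \<ge> 0\<close> by (intro mult_left_mono) auto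
    then show ?thesis using le[OF that(2)] M by linarith
  qed
  have "dst S (Y m) (Y n) < \<epsilon>" if "M \<le> m" "M \<le> n" for m n
    using *[of m n] *[of n m] that nrm_sub_commute[OF Y Y, of m n] by (cases "m \<le> n") auto
  then show "\<exists>M. \<forall>m\<ge>M. \<forall>n\<ge>M. dst S (Y m) (Y n) < \<epsilon>" by blast
qed

text \<open>The countable family \<open>w\<close> has to be dense in every fibre, whereas the
  vectors \<open>e n\<close> only span a dense subspace. For the application \<open>w\<close> will
  enumerate rational combinations of the \<open>e n\<close>.\<close>

locale measurable_hilbert_field =
  fixes M :: "'s measure" and H :: "'s \<Rightarrow> 'b ips" and w :: "nat \<Rightarrow> 's \<Rightarrow> 'b"
  assumes space_M: "space M = UNIV"
    and fibre: "hilbert_space (H s)"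
    and w_carr: "w k s \<in> carr (H s)"
    and w_measurable: "(\<lambda>s. nrm (H s) (w k s)) \<in> borel_measurable M"
    and w_dense: "x \<in> carr (H s) \<Longrightarrow> \<epsilon> > 0 \<Longrightarrow> \<exists>k. dst (H s) x (w k s) < \<epsilon>"
begin

sublocale F: hilbert_space "H s" for s
  by (rule fibre)

definition fields :: "('s \<Rightarrow> 'b) set" where
  "fields = {g. (\<forall>s. g s \<in> carr (H s)) \<and> (\<forall>k. (\<lambda>s. ip (H s) (w k s) (g s)) \<in> borel_measurable M)}"

definition L2 :: "('s \<Rightarrow> 'b) ips" where
  "L2 = \<lparr> carr = {f \<in> fields. integrable M (\<lambda>s. (nrm (H s) (f s))\<^sup>2)},
     zer = (\<lambda>s. zer (H s)),
     add = (\<lambda>f g s. add (H s) (f s) (g s)),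
     smul = (\<lambda>c f s. smul (H s) c (f s)),
     ip = (\<lambda>f g. \<integral>s. ip (H s) (f s) (g s) \<partial>M) \<rparr>"

lemma carr_L2: "f \<in> carr L2 \<longleftrightarrow> f \<in> fields \<and> integrable M (\<lambda>s. (nrm (H s) (f s))\<^sup>2)"
  and zer_L2: "zer L2 = (\<lambda>s. zer (H s))"
  and add_L2: "add L2 f g = (\<lambda>s. add (H s) (f s) (g s))"
  and smul_L2: "smul L2 c f = (\<lambda>s. smul (H s) c (f s))"
  and ip_L2: "ip L2 f g = (\<integral>s. ip (H s) (f s) (g s) \<partial>M)"
  and sub_L2: "sub L2 f g = (\<lambda>s. sub (H s) (f s) (g s))"
  by (simp_all add: L2_def sub_def)

lemma fields_carr: "f \<in> fields \<Longrightarrow> f s \<in> carr (H s)"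
  and fields_measurable: "f \<in> fields \<Longrightarrow> (\<lambda>s. ip (H s) (w k s) (f s)) \<in> borel_measurable M"
  by (simp_all add: fields_def)

text \<open>Completing the square, each term equals the squared norm of \<open>x\<close> minus the
  squared distance from \<open>x\<close> to \<open>w k\<close>, so density makes the supremum exact.
  As the terms involve \<open>x\<close> only through its pairing with \<open>w k\<close>, the
  squared norm of a field becomes measurable.\<close>

lemma nrm_power2_eq_SUP:
  assumes x: "x \<in> carr (H s)"
  shows "bdd_above (range (\<lambda>k. 2 * Re (ip (H s) (w k s) x) - (nrm (H s) (w k s))\<^sup>2))"
    and "(nrm (H s) x)\<^sup>2 = (SUP k. 2 * Re (ip (H s) (w k s) x) - (nrm (H s) (w k s))\<^sup>2)"
proof -
  have eq: "2 * Re (ip (H s) (w k s) x) - (nrm (H s) (w k s))\<^sup>2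
      = (nrm (H s) x)\<^sup>2 - (dst (H s) x (w k s))\<^sup>2" for k
    using x w_carr F.Re_ip_commute[OF w_carr x] by (simp add: F.nrm_sub_power2)
  show bdd: "bdd_above (range (\<lambda>k. 2 * Re (ip (H s) (w k s) x) - (nrm (H s) (w k s))\<^sup>2))"
    unfolding eq by (rule bdd_aboveI[of _ "(nrm (H s) x)\<^sup>2"]) auto
  show "(nrm (H s) x)\<^sup>2 = (SUP k. 2 * Re (ip (H s) (w k s) x) - (nrm (H s) (w k s))\<^sup>2)"
  proof (rule antisym)
    show "(SUP k. 2 * Re (ip (H s) (w k s) x) - (nrm (H s) (w k s))\<^sup>2) \<le> (nrm (H s) x)\<^sup>2"
      unfolding eq by (rule cSUP_least) auto
    show "(nrm (H s) x)\<^sup>2 \<le> (SUP k. 2 * Re (ip (H s) (w k s) x) - (nrm (H s) (w k s))\<^sup>2)"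
    proof (rule field_le_epsilon)
      fix \<epsilon> :: real assume "\<epsilon> > 0"
      then obtain k where k: "dst (H s) x (w k s) < sqrt \<epsilon>"
        using w_dense[OF x, of "sqrt \<epsilon>"] by auto
      then have "(dst (H s) x (w k s))\<^sup>2 < \<epsilon>"
        using x w_carr \<open>\<epsilon> > 0\<close> by (metis F.nrm_nonneg F.sub_closed power_strict_mono real_sqrt_pow2 less_imp_le
            pos2)
      moreover have "2 * Re (ip (H s) (w k s) x) - (nrm (H s) (w k s))\<^sup>2
          \<le> (SUP k. 2 * Re (ip (H s) (w k s) x) - (nrm (H s) (w k s))\<^sup>2)"
        by (rule cSUP_upper[OF _ bdd]) simp
      ultimately show "(nrm (H s) x)\<^sup>2
          \<le> (SUP k. 2 * Re (ip (H s) (w k s) x) - (nrm (H s) (w k s))\<^sup>2) + \<epsilon>"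
        using eq[of k] by linarith
    qed
  qed
qed

lemma nrm_power2_measurable:
  assumes f: "f \<in> fields"
  shows "(\<lambda>s. (nrm (H s) (f s))\<^sup>2) \<in> borel_measurable M"
proof -
  have "(\<lambda>s. SUP k. 2 * Re (ip (H s) (w k s) (f s)) - (nrm (H s) (w k s))\<^sup>2) \<in> borel_measurable M"
    using f fields_measurable[OF f] w_measurable
    by (intro borel_measurable_cSUP nrm_power2_eq_SUP(1)[OF fields_carr[OF f]]) auto
  then show ?thesis by (simp add: nrm_power2_eq_SUP(2)[OF fields_carr[OF f]])
qed

lemma fields_zer: "(\<lambda>s. zer (H s)) \<in> fields"
  by (simp add: fields_def F.ip_zer_right w_carr)

lemma fields_add: "f \<in> fields \<Longrightarrow> g \<in> fields \<Longrightarrow> (\<lambda>s. add (H s) (f s) (g s)) \<in> fields"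
  by (auto simp: fields_def F.ip_add_right w_carr intro!: borel_measurable_add borel_measurable_times borel_measurable_diff)

lemma fields_smul: "f \<in> fields \<Longrightarrow> (\<lambda>s. smul (H s) c (f s)) \<in> fields"
  by (auto simp: fields_def F.ip_smul_right w_carr intro!: borel_measurable_add borel_measurable_times borel_measurable_diff)

lemma fields_sub: "f \<in> fields \<Longrightarrow> g \<in> fields \<Longrightarrow> (\<lambda>s. sub (H s) (f s) (g s)) \<in> fields"
  by (auto simp: fields_def F.ip_sub_right w_carr intro!: borel_measurable_add borel_measurable_times borel_measurable_diff)

text \<open>The real part comes from the squared norms of \<open>f\<close>, \<open>g\<close> and
  their sum; the imaginary part is the real part with \<open>g\<close> replaced by its multiple by
  \<open>- \<i>\<close>.\<close>

lemma ip_measurable: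
  assumes f: "f \<in> fields" and g: "g \<in> fields"
  shows "(\<lambda>s. ip (H s) (f s) (g s)) \<in> borel_measurable M"
proof -
  have Re: "(\<lambda>s. Re (ip (H s) (f s) (g s))) \<in> borel_measurable M" if g: "g \<in> fields" for g
  proof -
    have "(\<lambda>s. ((nrm (H s) (add (H s) (f s) (g s)))\<^sup>2 - (nrm (H s) (f s))\<^sup>2 - (nrm (H s) (g s))\<^sup>2) / 2)
        \<in> borel_measurable M"
      using nrm_power2_measurable[OF fields_add[OF f g]] nrm_power2_measurable[OF f] nrm_power2_measurable[OF g]
      by measurable
    then show ?thesis by (simp add: F.nrm_add_power2 fields_carr[OF f] fields_carr[OF g])
  qed
  have "(\<lambda>s. Im (ip (H s) (f s) (g s))) \<in> borel_measurable M"
    using Re[OF fields_smul[OF g, of "- \<i>"]]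
    by (simp add: F.ip_smul_right fields_carr[OF f] fields_carr[OF g])
  then show ?thesis using Re[OF g] by (simp add: borel_measurable_complex_iff)
qed

section \<open>Square-integrable fields as a semi-inner product space\<close>

lemma nrm_add_power2_le:
  "x \<in> carr (H s) \<Longrightarrow> y \<in> carr (H s) \<Longrightarrow>
    (nrm (H s) (add (H s) x y))\<^sup>2 \<le> 2 * (nrm (H s) x)\<^sup>2 + 2 * (nrm (H s) y)\<^sup>2"
  using F.nrm_add_power2[of x s y] F.nrm_sub_power2[of x s y] zero_le_power2[of "dst (H s) x y"]
  by linarith

lemma L2_add: "f \<in> carr L2 \<Longrightarrow> g \<in> carr L2 \<Longrightarrow> (\<lambda>s. add (H s) (f s) (g s)) \<in> carr L2"
  unfolding carr_L2
proof (intro conjI fields_add)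
  assume f: "f \<in> fields \<and> integrable M (\<lambda>s. (nrm (H s) (f s))\<^sup>2)"
    and g: "g \<in> fields \<and> integrable M (\<lambda>s. (nrm (H s) (g s))\<^sup>2)"
  show "integrable M (\<lambda>s. (nrm (H s) (add (H s) (f s) (g s)))\<^sup>2)"
  proof (rule Bochner_Integration.integrable_bound)
    show "integrable M (\<lambda>s. 2 * (nrm (H s) (f s))\<^sup>2 + 2 * (nrm (H s) (g s))\<^sup>2)" using f g by auto
    show "(\<lambda>s. (nrm (H s) (add (H s) (f s) (g s)))\<^sup>2) \<in> borel_measurable M"
      using f g by (intro nrm_power2_measurable fields_add) auto
  qed (use f g fields_carr in \<open>auto intro!: nrm_add_power2_le\<close>)
qed auto

lemma L2_smul: "f \<in> carr L2 \<Longrightarrow> (\<lambda>s. smul (H s) c (f s)) \<in> carr L2"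
  by (auto simp: carr_L2 fields_smul F.nrm_smul[OF fields_carr] power_mult_distrib)

lemma cmod_ip_le:
  assumes "x \<in> carr (H s)" "y \<in> carr (H s)"
  shows "cmod (ip (H s) x y) \<le> (nrm (H s) x)\<^sup>2 + (nrm (H s) y)\<^sup>2"
proof -
  have "cmod (ip (H s) x y) \<le> nrm (H s) x * nrm (H s) y" using assms by (rule F.cauchy_schwarz)
  also have "\<dots> \<le> (nrm (H s) x)\<^sup>2 + (nrm (H s) y)\<^sup>2"
    using sum_squares_bound[of "nrm (H s) x" "nrm (H s) y"]
      mult_nonneg_nonneg[OF F.nrm_nonneg[OF assms(1)] F.nrm_nonneg[OF assms(2)]] by linarith
  finally show ?thesis .
qed

lemma integrable_ip:
  assumes f: "f \<in> carr L2" and g: "g \<in> carr L2"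
  shows "integrable M (\<lambda>s. ip (H s) (f s) (g s))"
proof (rule Bochner_Integration.integrable_bound)
  show "integrable M (\<lambda>s. (nrm (H s) (f s))\<^sup>2 + (nrm (H s) (g s))\<^sup>2)" using f g by (auto simp: carr_L2)
  show "(\<lambda>s. ip (H s) (f s) (g s)) \<in> borel_measurable M"
    using f g by (intro ip_measurable) (auto simp: carr_L2)
qed (use f g fields_carr in \<open>auto simp: carr_L2 intro!: cmod_ip_le\<close>)

lemma semi_ip_space_L2: "semi_ip_space L2"
proof
  have carr: "f s \<in> carr (H s)" if "f \<in> carr L2" for f s using that by (simp add: carr_L2 fields_carr)
  show "zer L2 \<in> carr L2" by (simp add: zer_L2 carr_L2 fields_zer)
  fix f g h :: "'s \<Rightarrow> 'b" and c d :: complex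
  show add_C: "add L2 f g \<in> carr L2" if "f \<in> carr L2" "g \<in> carr L2" for f g
    using that by (simp add: add_L2 L2_add)
  show smul_C: "smul L2 c f \<in> carr L2" if "f \<in> carr L2" for c f
    using that by (simp add: smul_L2 L2_smul)
  {
    assume f: "f \<in> carr L2"
    note [simp] = carr[OF f]
    from f show "add L2 f (zer L2) = f" "add L2 f (smul L2 (- 1) f) = zer L2" "smul L2 1 f = f"
      "smul L2 c (smul L2 d f) = smul L2 (c * d) f"
      "smul L2 (c + d) f = add L2 (smul L2 c f) (smul L2 d f)"
      by (auto simp: add_L2 smul_L2 zer_L2 F.add_zer F.add_inverse F.smul_one F.smul_smul F.smul_add_left)
    have "ip L2 f f = (\<integral>s. complex_of_real ((nrm (H s) (f s))\<^sup>2) \<partial>M)"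
      unfolding ip_L2 by (intro Bochner_Integration.integral_cong) (use f in \<open>auto simp: F.ip_self\<close>)
    then show "0 \<le> Re (ip L2 f f)"
      by (simp only: integral_complex_of_real Re_complex_of_real) simp
  }
  {
    assume f: "f \<in> carr L2" and g: "g \<in> carr L2"
    note [simp] = carr[OF f] carr[OF g]
    from f g show "add L2 f g = add L2 g f" "smul L2 c (add L2 f g) = add L2 (smul L2 c f) (smul L2 c g)"
      by (auto simp: add_L2 smul_L2 F.smul_add_right F.add_commute)
    have "ip L2 f g = (\<integral>s. cnj (ip (H s) (g s) (f s)) \<partial>M)"
      unfolding ip_L2 by (intro Bochner_Integration.integral_cong) (use f g in \<open>auto intro: F.ip_commute\<close>)
    then show "ip L2 f g = cnj (ip L2 g f)" by (simp add: ip_L2)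
    show "ip L2 f (smul L2 c g) = c * ip L2 f g"
      using f g by (simp add: ip_L2 smul_L2 F.ip_smul_right)
  }
  {
    assume f: "f \<in> carr L2" and g: "g \<in> carr L2" and h: "h \<in> carr L2"
    note [simp] = carr[OF f] carr[OF g] carr[OF h]
    from f g h show "add L2 (add L2 f g) h = add L2 f (add L2 g h)"
      by (auto simp: add_L2 F.add_assoc)
    show "ip L2 f (add L2 g h) = ip L2 f g + ip L2 f h"
      using f g h integrable_ip[OF f g] integrable_ip[OF f h] by (simp add: ip_L2 add_L2 F.ip_add_right)
  }
qed

sublocale L2: semi_ip_space L2
  by (rule semi_ip_space_L2)

lemma nrm_L2_power2:
  assumes f: "f \<in> carr L2"
  shows "(nrm L2 f)\<^sup>2 = (\<integral>s. (nrm (H s) (f s))\<^sup>2 \<partial>M)"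
proof -
  have "ip L2 f f = (\<integral>s. complex_of_real ((nrm (H s) (f s))\<^sup>2) \<partial>M)"
    unfolding ip_L2 by (intro Bochner_Integration.integral_cong) (use f in \<open>auto simp: F.ip_self carr_L2 fields_carr\<close>)
  then show ?thesis
    by (simp only: L2.nrm_power2[OF f] integral_complex_of_real Re_complex_of_real)
qed

text \<open>Identifies equality almost everywhere with equality up to null vectors, so that the
  direct integral is a \<open>separation\<close> and the general quotient results apply.\<close>

lemma null_space_L2: "null_space L2 = {f \<in> carr L2. AE s in M. f s = zer (H s)}"
proof -
  have "ip L2 f f = 0 \<longleftrightarrow> (AE s in M. f s = zer (H s))" if f: "f \<in> carr L2" for f
  proof -
    have "ip L2 f f = 0 \<longleftrightarrow> (\<integral>s. (nrm (H s) (f s))\<^sup>2 \<partial>M) = 0"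
      using f by (simp add: L2.nrm_eq_0_iff[symmetric] nrm_L2_power2[symmetric])
    also have "\<dots> \<longleftrightarrow> (AE s in M. (nrm (H s) (f s))\<^sup>2 = 0)"
      using f by (intro integral_nonneg_eq_0_iff_AE) (auto simp: carr_L2)
    also have "\<dots> \<longleftrightarrow> (AE s in M. f s = zer (H s))"
    proof (rule AE_cong)
      fix s
      have "f s \<in> carr (H s)" using f by (simp add: carr_L2 fields_carr)
      then have "nrm (H s) (f s) = 0 \<longleftrightarrow> f s = zer (H s)"
        using F.ip_definite[of "f s" s] F.nrm_eq_0_iff[of "f s" s] F.nrm_zer[of s] by metis
      then show "(nrm (H s) (f s))\<^sup>2 = 0 \<longleftrightarrow> f s = zer (H s)" by simp
    qed
    finally show ?thesis .
  qed
  then show ?thesis by (auto simp: null_space_def)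
qed

text \<open>The first half of the Riesz-Fischer argument: a rapidly converging subsequence is Cauchy
  in almost every fibre. The limit is so far only a measurable field; its integrability is left to
  Fatou's lemma.\<close>

lemma cauchy_in_L2_limit:
  assumes X: "\<And>n. X n \<in> carr L2" and r: "\<And>k. dst L2 (X (r (Suc k))) (X (r k)) \<le> (1/4) ^ k"
  shows "\<exists>g\<in>fields. AE s in M. (\<lambda>k. dst (H s) (X (r k) s) (g s)) \<longlonglongrightarrow> 0"
proof -
  have Xf: "X n \<in> fields" for n using X by (simp add: carr_L2)
  note [simp] = fields_carr[OF Xf]
  define d where "d k s = (dst (H s) (X (r (Suc k)) s) (X (r k) s))\<^sup>2" for k s
  have d_meas [measurable]: "d k \<in> borel_measurable M" for k
    unfolding d_def using Xf by (intro nrm_power2_measurable fields_sub)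
  have d_nonneg: "0 \<le> d k s" for k s by (simp add: d_def)
  have subX: "sub L2 (X (r (Suc k))) (X (r k)) \<in> carr L2" for k using X by simp
  \<comment> \<open>The squared distances integrate to at most \<open>(1/16)^k\<close>. After
    weighting with \<open>4^k\<close> they are still summable, and finiteness of the sum at
    \<open>s\<close> forces distances of order \<open>(1/2)^k\<close> there.\<close>
  have "(\<integral>\<^sup>+s. ennreal (4 ^ k * d k s) \<partial>M) \<le> ennreal ((1/4) ^ k)" for k
  proof -
    have int: "integrable M (d k)"
      using subX[of k] unfolding carr_L2 sub_L2 d_def[abs_def] by simp
    have "(\<integral>\<^sup>+s. ennreal (4 ^ k * d k s) \<partial>M) = ennreal (\<integral>s. 4 ^ k * d k s \<partial>M)"
      using int by (intro nn_integral_eq_integral) (auto simp: d_nonneg)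
    also have "(\<integral>s. 4 ^ k * d k s \<partial>M) = 4 ^ k * (dst L2 (X (r (Suc k))) (X (r k)))\<^sup>2"
      using nrm_L2_power2[OF subX[of k]] by (simp add: sub_L2 d_def)
    also have "\<dots> \<le> 4 ^ k * ((1/4) ^ k)\<^sup>2"
      using r X by (intro mult_left_mono power_mono) auto
    also have "\<dots> = (1/4) ^ k" by (simp add: power2_eq_square power_divide)
    finally show ?thesis by (simp add: ennreal_leI)
  qed
  then have "(\<Sum>k. \<integral>\<^sup>+s. ennreal (4 ^ k * d k s) \<partial>M) \<le> (\<Sum>k. ennreal ((1/4) ^ k))"
    by (intro suminf_le) auto
  also have "\<dots> = ennreal (\<Sum>k. (1/4) ^ k)" by (intro suminf_ennreal2) (auto simp: summable_geometric)
  finally have "(\<integral>\<^sup>+s. (\<Sum>k. ennreal (4 ^ k * d k s)) \<partial>M) < \<infinity>"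
    by (subst nn_integral_suminf) (auto simp: le_less_trans)
  then have "AE s in M. (\<Sum>k. ennreal (4 ^ k * d k s)) \<noteq> \<infinity>"
    by (intro nn_integral_PInf_AE) auto
  then obtain Z where Z: "Z \<in> null_sets M" "\<And>s. s \<notin> Z \<Longrightarrow> (\<Sum>k. ennreal (4 ^ k * d k s)) \<noteq> \<infinity>"
    by (rule AE_E3) (auto simp: space_M)
  have "\<exists>y\<in>carr (H s). (\<lambda>k. dst (H s) (X (r k) s) y) \<longlonglongrightarrow> 0" if s: "s \<notin> Z" for s
  proof (rule F.complete)
    obtain C where C: "(\<Sum>k. ennreal (4 ^ k * d k s)) = ennreal C" "C \<ge> 0"
      using Z(2)[OF s] by (cases "\<Sum>k. ennreal (4 ^ k * d k s)") auto
    show "cauchy_in (H s) (\<lambda>k. X (r k) s)"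
    proof (rule F.cauchy_in_geometric)
      fix k
      have "ennreal (4 ^ k * d k s) \<le> ennreal C"
        unfolding C(1)[symmetric] using sum_le_suminf[of "\<lambda>k. ennreal (4 ^ k * d k s)" "{k}"] by simp
      then have "4 ^ k * d k s \<le> C" using C(2) by simp
      moreover have "(sqrt C * (1/2) ^ k)\<^sup>2 = C / 4 ^ k"
      proof -
        have "((1/2::real) ^ k)\<^sup>2 = 1 / 4 ^ k"
          by (simp add: power2_eq_square power_mult_distrib[symmetric] power_one_over)
        then show ?thesis using C(2) by (simp add: power_mult_distrib)
      qed
      ultimately have "d k s \<le> (sqrt C * (1/2) ^ k)\<^sup>2"
        by (simp add: pos_le_divide_eq mult.commute)
      then show "dst (H s) (X (r (Suc k)) s) (X (r k) s) \<le> sqrt C * (1/2) ^ k"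
        using C(2) unfolding d_def by (elim power2_le_imp_le) simp
    qed simp
  qed simp
  then obtain y where y: "\<And>s. s \<notin> Z \<Longrightarrow> y s \<in> carr (H s)"
      "\<And>s. s \<notin> Z \<Longrightarrow> (\<lambda>k. dst (H s) (X (r k) s) (y s)) \<longlonglongrightarrow> 0"
    by metis
  \<comment> \<open>The value zero on the null set \<open>Z\<close> keeps \<open>g\<close> a
    pointwise limit of measurable fields, namely of the subsequence cut off by the indicator of the
    complement of \<open>Z\<close>.\<close>
  define g where "g s = (if s \<in> Z then zer (H s) else y s)" for s
  have g_carr: "g s \<in> carr (H s)" for s using y by (simp add: g_def)
  have "g \<in> fields"
    unfolding fields_def
  proof (intro CollectI conjI allI)
    fix j
    show "(\<lambda>s. ip (H s) (w j s) (g s)) \<in> borel_measurable M"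
    proof (rule borel_measurable_LIMSEQ_metric)
      have Zs: "Z \<in> sets M" using Z by auto
      show "(\<lambda>s. indicator (- Z) s * ip (H s) (w j s) (X (r k) s)) \<in> borel_measurable M" for k
        using fields_measurable[OF Xf] Zs space_M
        by (intro borel_measurable_times borel_measurable_indicator) (metis Compl_eq_Diff_UNIV sets.compl_sets)+
      fix s
      show "(\<lambda>k. indicator (- Z) s * ip (H s) (w j s) (X (r k) s)) \<longlonglongrightarrow> ip (H s) (w j s) (g s)"
      proof (cases "s \<in> Z")
        case True
        then show ?thesis by (simp add: g_def F.ip_zer_right w_carr)
      next
        case False
        have "(\<lambda>k. ip (H s) (w j s) (X (r k) s)) \<longlonglongrightarrow> ip (H s) (w j s) (y s)"
          using False y Xf w_carr by (intro F.ip_tendsto) auto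
        then show ?thesis using False by (simp add: g_def)
      qed
    qed
  qed (rule g_carr)
  moreover have "AE s in M. (\<lambda>k. dst (H s) (X (r k) s) (g s)) \<longlonglongrightarrow> 0"
    using y by (intro AE_I'[OF Z(1)]) (auto simp: g_def)
  ultimately show ?thesis by blast
qed

text \<open>Fatou's lemma for the squared fibre distances to a fixed \<open>f\<close>. Applied with
  \<open>f\<close> a term of the sequence itself, it gives both membership of the limit in the space
  and the rate of convergence.\<close>

lemma L2_fatou:
  assumes X: "\<And>k. X k \<in> carr L2" and f: "f \<in> carr L2" and g: "g \<in> fields"
    and lim: "AE s in M. (\<lambda>k. dst (H s) (X k s) (g s)) \<longlonglongrightarrow> 0"
    and B: "\<forall>\<^sub>F k in sequentially. dst L2 f (X k) \<le> B" and "B \<ge> 0"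
  shows "g \<in> carr L2" "dst L2 f g \<le> B"
proof -
  have Xf: "X n \<in> fields" for n using X by (simp add: carr_L2)
  note [simp] = fields_carr[OF Xf]
  have ff: "f \<in> fields" using f by (simp add: carr_L2)
  note [simp] = fields_carr[OF ff] fields_carr[OF g]
  define q where "q k s = ennreal ((dst (H s) (f s) (X k s))\<^sup>2)" for k s
  have q_meas: "q k \<in> borel_measurable M" for k
    unfolding q_def using nrm_power2_measurable[OF fields_sub[OF ff Xf]] by measurable
  have "AE s in M. ennreal ((dst (H s) (f s) (g s))\<^sup>2) = liminf (\<lambda>k. q k s)"
    using lim
  proof (rule AE_mp, intro AE_I2 impI)
    fix s assume l: "(\<lambda>k. dst (H s) (X k s) (g s)) \<longlonglongrightarrow> 0"
    have "dst (H s) (sub (H s) (f s) (X k s)) (sub (H s) (f s) (g s))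
        = dst (H s) (X k s) (g s)" for k
      by (rule F.nrm_eqI) (use ff g Xf in \<open>simp_all add: F.ip_simps\<close>)
    then have "(\<lambda>k. dst (H s) (f s) (X k s)) \<longlonglongrightarrow> dst (H s) (f s) (g s)"
      using l ff g Xf by (intro F.nrm_tendsto) auto
    then have "(\<lambda>k. q k s) \<longlonglongrightarrow> ennreal ((dst (H s) (f s) (g s))\<^sup>2)"
      unfolding q_def by (intro tendsto_intros)
    then show "ennreal ((dst (H s) (f s) (g s))\<^sup>2) = liminf (\<lambda>k. q k s)"
      using lim_imp_Liminf[of sequentially] by (metis sequentially_bot)
  qed
  then have "(\<integral>\<^sup>+s. ennreal ((dst (H s) (f s) (g s))\<^sup>2) \<partial>M) = (\<integral>\<^sup>+s. liminf (\<lambda>k. q k s) \<partial>M)"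
    by (rule nn_integral_cong_AE)
  also have "\<dots> \<le> liminf (\<lambda>k. \<integral>\<^sup>+s. q k s \<partial>M)"
    using q_meas by (rule nn_integral_liminf)
  also have "\<dots> \<le> limsup (\<lambda>k. \<integral>\<^sup>+s. q k s \<partial>M)"
    by (rule Liminf_le_Limsup) simp
  also have "\<dots> \<le> ennreal (B\<^sup>2)"
  proof (rule Limsup_bounded)
    show "\<forall>\<^sub>F k in sequentially. (\<integral>\<^sup>+s. q k s \<partial>M) \<le> ennreal (B\<^sup>2)"
      using B
    proof eventually_elim
      case (elim k)
      have sk: "sub L2 f (X k) \<in> carr L2" using f X by simp
      then have "integrable M (\<lambda>s. (dst (H s) (f s) (X k s))\<^sup>2)"
        by (simp add: carr_L2 sub_L2)
      then have "(\<integral>\<^sup>+s. q k s \<partial>M) = ennreal (\<integral>s. (dst (H s) (f s) (X k s))\<^sup>2 \<partial>M)"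
        unfolding q_def by (intro nn_integral_eq_integral) auto
      also have "\<dots> = ennreal ((dst L2 f (X k))\<^sup>2)"
        using nrm_L2_power2[OF sk] by (simp add: sub_L2)
      also have "\<dots> \<le> ennreal (B\<^sup>2)"
        using elim sk by (intro ennreal_leI power_mono) auto
      finally show ?case .
    qed
  qed
  finally have le: "(\<integral>\<^sup>+s. ennreal ((dst (H s) (f s) (g s))\<^sup>2) \<partial>M) \<le> ennreal (B\<^sup>2)" .
  have "integrable M (\<lambda>s. (dst (H s) (f s) (g s))\<^sup>2)"
    using nrm_power2_measurable[OF fields_sub[OF ff g]] le
    by (intro integrableI_nonneg) (auto intro: le_less_trans)
  then have fg: "(\<lambda>s. sub (H s) (f s) (g s)) \<in> carr L2"
    by (simp add: carr_L2 fields_sub ff g)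
  then have "sub L2 f (\<lambda>s. sub (H s) (f s) (g s)) \<in> carr L2" using f by (intro L2.sub_closed)
  \<comment> \<open>Integrability is known for \<open>f - g\<close> and is wanted for
    \<open>g\<close>, which has the norm of \<open>f - (f - g)\<close>.\<close>
  moreover have "dst (H s) (f s) (sub (H s) (f s) (g s)) = nrm (H s) (g s)" for s
    by (rule F.nrm_eqI) (use ff g in \<open>simp_all add: F.ip_simps\<close>)
  ultimately show gL: "g \<in> carr L2" using g by (simp add: carr_L2 sub_L2)
  have "ennreal ((dst L2 f g)\<^sup>2) = (\<integral>\<^sup>+s. ennreal ((dst (H s) (f s) (g s))\<^sup>2) \<partial>M)"
    using nrm_L2_power2[OF fg] fg by (simp add: sub_L2 carr_L2 nn_integral_eq_integral)
  then have "(dst L2 f g)\<^sup>2 \<le> B\<^sup>2" using le by (metis ennreal_le_iff zero_le_power2)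
  then show "dst L2 f g \<le> B" using \<open>B \<ge> 0\<close> by (rule power2_le_imp_le)
qed

text \<open>The subsequence \<open>r\<close> produces the limit field, and comparing an arbitrary
  late term with the tail of that subsequence gives convergence of the whole sequence.\<close>

lemma complete_ips_L2: "complete_ips L2"
  unfolding complete_ips_def
proof (intro allI impI)
  fix X assume "\<forall>n. X n \<in> carr L2" and Cau: "cauchy_in L2 X"
  then have X: "\<And>n. X n \<in> carr L2" by blast
  have "\<forall>k::nat. \<exists>N. \<forall>m\<ge>N. \<forall>n\<ge>N. dst L2 (X m) (X n) < (1/4) ^ k"
    using Cau unfolding cauchy_in_def by (intro allI) (metis zero_less_divide_1_iff zero_less_numeral zero_less_power)
  then obtain N where N: "\<And>k m n. m \<ge> N k \<Longrightarrow> n \<ge> N k \<Longrightarrow> dst L2 (X m) (X n) < (1/4) ^ k"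
    by metis
  \<comment> \<open>Summing the thresholds makes \<open>r k\<close> exceed \<open>N j\<close> for
    all \<open>j \<le> k\<close> simultaneously.\<close>
  define r where "r k = (\<Sum>i\<le>k. N i) + k" for k
  have r_ge: "N j \<le> r k" if "j \<le> k" for j k
    using member_le_sum[of j "{..k}" N] that by (simp add: r_def)
  have "dst L2 (X (r (Suc k))) (X (r k)) \<le> (1/4) ^ k" for k
    using N[of k "r (Suc k)" "r k"] r_ge by (simp add: less_imp_le)
  then obtain g where g: "g \<in> fields"
      "AE s in M. (\<lambda>k. dst (H s) (X (r k) s) (g s)) \<longlonglongrightarrow> 0"
    using cauchy_in_L2_limit[of X r] X by blast
  have bound: "g \<in> carr L2 \<and> dst L2 (X n) g \<le> (1/4) ^ k" if n: "n \<ge> N k" for n k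
  proof -
    have "\<forall>\<^sub>F j in sequentially. dst L2 (X n) (X (r j)) \<le> (1/4) ^ k"
      using N[of k n] n r_ge[of k] by (auto simp: eventually_sequentially intro!: exI[of _ k] less_imp_le)
    then show ?thesis
      using L2_fatou[of "\<lambda>k. X (r k)" "X n" g "(1/4) ^ k"] X g by auto
  qed
  have "(\<lambda>n. dst L2 (X n) g) \<longlonglongrightarrow> 0"
  proof (rule LIMSEQ_I)
    fix \<epsilon> :: real assume "\<epsilon> > 0"
    then obtain k where k: "(1/4::real) ^ k < \<epsilon>" using real_arch_pow_inv[of \<epsilon> "1/4"] by auto
    then have "norm (dst L2 (X n) g - 0) < \<epsilon>" if "n \<ge> N k" for n
      using bound[OF that] X by simp
    then show "\<exists>M. \<forall>n\<ge>M. norm (dst L2 (X n) g - 0) < \<epsilon>" by blast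
  qed
  moreover have "g \<in> carr L2" using bound by blast
  ultimately show "\<exists>g\<in>carr L2. (\<lambda>n. dst L2 (X n) g) \<longlonglongrightarrow> 0" by blast
qed

end

section \<open>Complex inner product types\<close>

abbreviation cspan :: "'k::complex_inner set \<Rightarrow> 'k set" where
  "cspan \<equiv> complex_vector.span"

text \<open>The type seen as a carrier structure. The calculus of \<open>semi_ip_space\<close> then
  gives the rules for \<open>cinner\<close>, and the same structure is the fibre outside
  \<open>E\<close> up to relabelling.\<close>

definition type_ips :: "'k::complex_inner ips" where
  "type_ips = \<lparr> carr = UNIV, zer = 0, add = (+), smul = scaleC, ip = cinner \<rparr>"

lemma scaleC_minus_one: "scaleC (- 1) x = - (x :: 'k::complex_inner)"
  using complex_vector.scale_minus_left[of 1 x] by simp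

lemma nrm_type_ips: "nrm type_ips (x :: 'k::complex_inner) = norm x"
  by (simp add: nrm_def type_ips_def norm_eq_sqrt_inner inner_eq_Re_cinner)

lemma sub_type_ips: "sub type_ips x (y :: 'k::complex_inner) = x - y"
  by (simp add: sub_def type_ips_def scaleC_minus_one)

lemma semi_ip_space_type_ips: "semi_ip_space (type_ips :: 'k::complex_inner ips)"
proof
  fix x y z :: 'k and c d
  show "add type_ips x (smul type_ips (- 1) x) = zer type_ips"
    by (simp add: type_ips_def scaleC_minus_one)
  show "ip type_ips x y = cnj (ip type_ips y x)" by (simp add: type_ips_def cinner_commute[of x y])
  show "0 \<le> Re (ip type_ips x x)" by (simp add: type_ips_def inner_eq_Re_cinner[symmetric])
qed (auto simp: type_ips_def scaleC_add_right scaleC_add_left scaleC_scaleC cinner_add_right cinner_scaleC_right)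

lemma hilbert_space_type_ips: "hilbert_space (type_ips :: 'k::chilbert_space ips)"
proof (rule hilbert_spaceI[OF semi_ip_space_type_ips])
  interpret semi_ip_space "type_ips :: 'k ips" by (rule semi_ip_space_type_ips)
  show "complete_ips (type_ips :: 'k ips)"
    unfolding complete_ips_def
  proof (intro allI impI)
    fix X :: "nat \<Rightarrow> 'k" assume "cauchy_in type_ips X"
    then have "Cauchy X"
      by (simp add: cauchy_in_def Cauchy_def nrm_type_ips sub_type_ips dist_norm)
    then obtain x where "X \<longlonglongrightarrow> x" by (auto simp: Cauchy_convergent_iff convergent_def)
    then have "(\<lambda>n. dst type_ips (X n) x) \<longlonglongrightarrow> 0"
      by (simp add: nrm_type_ips sub_type_ips LIM_zero_iff tendsto_norm_zero_iff)
    then show "\<exists>x\<in>carr type_ips. (\<lambda>n. dst type_ips (X n) x) \<longlonglongrightarrow> 0"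
      by (auto simp: type_ips_def)
  qed
  fix x :: 'k assume "ip type_ips x x = 0"
  then have "nrm type_ips x = 0" by (simp add: nrm_def)
  then show "x = zer type_ips" by (simp add: nrm_type_ips) (simp add: type_ips_def)
qed

lemma cinner_add_left: "cinner (x + y) z = cinner x z + cinner y (z :: 'k::complex_inner)"
  using semi_ip_space.ip_add_left[OF semi_ip_space_type_ips, of x y z] by (simp add: type_ips_def)

lemma cinner_scaleC_left: "cinner (scaleC c x) y = cnj c * cinner x (y :: 'k::complex_inner)"
  using semi_ip_space.ip_smul_left[OF semi_ip_space_type_ips, of x y c] by (simp add: type_ips_def)

lemma cinner_diff_left: "cinner (x - y) z = cinner x z - cinner y (z :: 'k::complex_inner)"
  using cinner_add_left[of "x - y" y z] by simp

lemma cinner_diff_right: "cinner z (x - y) = cinner z x - cinner z (y :: 'k::complex_inner)"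
  using cinner_add_right[of z "x - y" y] by simp

lemma cinner_zero_right: "cinner x (0 :: 'k::complex_inner) = 0"
  using semi_ip_space.ip_zer_right[OF semi_ip_space_type_ips, of x] by (simp add: type_ips_def)

lemma cinner_zero_left: "cinner 0 (x :: 'k::complex_inner) = 0"
  using semi_ip_space.ip_zer_left[OF semi_ip_space_type_ips, of x] by (simp add: type_ips_def)

lemma cinner_norm_le: "cmod (cinner x (y :: 'k::complex_inner)) \<le> norm x * norm y"
  using semi_ip_space.cauchy_schwarz[OF semi_ip_space_type_ips, of x y] by (simp add: nrm_type_ips)
    (simp add: type_ips_def)

lemma cinner_self: "cinner x (x :: 'k::complex_inner) = of_real ((norm x)\<^sup>2)"
  using semi_ip_space.ip_self[OF semi_ip_space_type_ips, of x] by (simp add: nrm_type_ips)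
    (simp add: type_ips_def)

lemma cinner_sum_right: "cinner x (\<Sum>i\<in>A. f i) = (\<Sum>i\<in>A. cinner x (f i :: 'k::complex_inner))"
  by (induction A rule: infinite_finite_induct) (auto simp: cinner_zero_right cinner_add_right)

lemma cinner_sum_left: "cinner (\<Sum>i\<in>A. f i) x = (\<Sum>i\<in>A. cinner (f i) (x :: 'k::complex_inner))"
  by (induction A rule: infinite_finite_induct) (auto simp: cinner_zero_left cinner_add_left)

lemma scaleC_scaleR: "scaleC c (scaleR r x) = scaleR r (scaleC c (x :: 'k::complex_inner))"
  by (simp add: scaleC_of_real[symmetric] scaleC_scaleC mult.commute)

lemma norm_scaleC: "norm (scaleC c x) = cmod c * norm (x :: 'k::complex_inner)"
  using semi_ip_space.nrm_smul[OF semi_ip_space_type_ips, of x c] by (simp add: nrm_type_ips)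
    (simp add: type_ips_def nrm_type_ips[unfolded type_ips_def])

lemma bounded_linear_cinner_right: "bounded_linear (cinner (x :: 'k::complex_inner))"
proof (rule bounded_linear_intro)
  show "cinner x (r *\<^sub>R y) = r *\<^sub>R cinner x y" for r y
    by (simp add: scaleC_of_real[symmetric] cinner_scaleC_right scaleR_conv_of_real)
  show "norm (cinner x y) \<le> norm y * norm x" for y
    using cinner_norm_le[of x y] by (simp add: mult.commute)
qed (rule cinner_add_right)

lemmas continuous_on_cinner_right = bounded_linear.continuous_on[OF bounded_linear_cinner_right]

lemma continuous_on_scaleC:
  assumes f: "continuous_on A f" and g: "continuous_on A g"
  shows "continuous_on A (\<lambda>s. scaleC (f s) (g s :: 'k::complex_inner))"
proof -
  have "bounded_bilinear (scaleC :: complex \<Rightarrow> 'k \<Rightarrow> 'k)"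
  proof
    show "\<exists>K. \<forall>a b. norm (scaleC a (b::'k)) \<le> norm a * norm b * K"
      by (rule exI[of _ 1]) (simp add: norm_scaleC)
    show "scaleC (r *\<^sub>R c) x = r *\<^sub>R scaleC c x" for r c and x :: 'k
      by (simp add: scaleC_of_real[symmetric] scaleC_scaleC scaleR_conv_of_real)
  qed (rule scaleC_add_left scaleC_add_right scaleC_scaleR)+
  then show ?thesis using f g by (rule bounded_bilinear.continuous_on)
qed

section \<open>Orthonormal bases of finite-dimensional spans\<close>

definition orthonormal :: "'k::complex_inner set \<Rightarrow> bool" where
  "orthonormal B \<longleftrightarrow> (\<forall>b\<in>B. \<forall>c\<in>B. cinner b c = (if b = c then 1 else 0))"

lemma orthonormal_expansion:
  assumes "finite B" "orthonormal B" "w \<in> cspan B"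
  shows "w = (\<Sum>b\<in>B. scaleC (cinner b w) b)"
proof -
  obtain r where r: "w = (\<Sum>b\<in>B. scaleC (r b) b)"
    using assms(1,3) by (auto simp: complex_vector.span_finite)
  have "cinner c w = r c" if "c \<in> B" for c
  proof -
    have "cinner c w = (\<Sum>b\<in>B. r b * (if c = b then 1 else 0))"
      unfolding r cinner_sum_right using assms(2) that
      by (intro sum.cong) (auto simp: cinner_scaleC_right orthonormal_def)
    also have "\<dots> = r c" using assms(1) that by (simp add: if_distrib[of "times _"] cong: if_cong)
    finally show ?thesis .
  qed
  then show ?thesis using r by simp
qed

text \<open>With respect to an orthonormal basis the coordinates of \<open>u s\<close> are the inner
  products \<open>cinner b (u s)\<close>, which inherit continuity from \<open>u\<close>. A general
  spanning set offers no such formula.\<close>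

lemma gram_schmidt:
  assumes "finite (F :: 'k::complex_inner set)"
  shows "\<exists>B. finite B \<and> orthonormal B \<and> cspan B = cspan F"
  using assms
proof (induction F rule: finite_induct)
  case empty
  then show ?case by (intro exI[of _ "{}"]) (auto simp: orthonormal_def)
next
  case (insert x F)
  then obtain B where B: "finite B" "orthonormal B" "cspan B = cspan F" by blast
  \<comment> \<open>The orthogonal projection of \<open>x\<close> to the span of \<open>B\<close>;
    the remainder \<open>y\<close> is normalised, or dropped if it vanishes.\<close>
  define z where "z = (\<Sum>b\<in>B. scaleC (cinner b x) b)"
  define y where "y = x - z"
  have z: "z \<in> cspan B"
    unfolding z_def by (intro complex_vector.span_sum complex_vector.span_scale complex_vector.span_base)
  have "cspan (insert x F) = cspan (insert x B)"
    by (simp add: complex_vector.span_insert B(3))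
  also have "\<dots> = cspan (insert y B)"
    using z by (intro complex_vector.eq_span_insert_eq) (simp add: y_def)
  finally have span_y: "cspan (insert x F) = cspan (insert y B)" .
  have orth: "cinner c y = 0" if "c \<in> B" for c
  proof -
    have "cinner c z = (\<Sum>b\<in>B. cinner b x * (if c = b then 1 else 0))"
      unfolding z_def cinner_sum_right using B(2) that
      by (intro sum.cong) (auto simp: cinner_scaleC_right orthonormal_def)
    also have "\<dots> = cinner c x" using B(1) that by (simp add: if_distrib[of "times _"] cong: if_cong)
    finally have "cinner c (y + z) = cinner c y + cinner c x" by (simp add: cinner_add_right)
    then show ?thesis by (simp add: y_def)
  qed
  show ?case
  proof (cases "y = 0")
    case True
    then show ?thesis using B span_y by (intro exI[of _ B]) (simp add: complex_vector.span_insert_0)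
  next
    case False
    define e where "e = scaleC (of_real (inverse (norm y))) y"
    have ee: "cinner e e = 1"
      using False by (simp add: e_def cinner_scaleC_left cinner_scaleC_right cinner_self[of y] power2_eq_square
          field_simps)
    have ce: "cinner c e = 0" if "c \<in> B" for c using orth[OF that] by (simp add: e_def cinner_scaleC_right)
    have ec: "cinner e c = 0" if "c \<in> B" for c using ce[OF that] cinner_commute[of e c] by simp
    have "orthonormal (insert e B)"
      using B(2) ee ce ec unfolding orthonormal_def by auto
    moreover have "cspan (insert e B) = cspan (insert y B)"
    proof -
      have y_e: "y = scaleC (of_real (norm y)) e"
        using False by (simp add: e_def scaleC_scaleC)
      have "insert e B \<subseteq> cspan (insert y B)"
        by (auto simp: e_def intro: complex_vector.span_base intro!: complex_vector.span_scale)
      moreover have "y \<in> cspan (insert e B)"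
        by (subst y_e) (intro complex_vector.span_scale complex_vector.span_base, simp)
      then have "insert y B \<subseteq> cspan (insert e B)"
        by (auto intro: complex_vector.span_base)
      ultimately show ?thesis
        by (metis complex_vector.span_mono complex_vector.span_span subset_antisym)
    qed
    ultimately show ?thesis using B span_y by (intro exI[of _ "insert e B"]) simp
  qed
qed


section \<open>Riemann sums over tagged partitions\<close>

text \<open>The filter of tagged partitions as the mesh shrinks. Convergence of Riemann sums becomes
  an ordinary \<open>tendsto\<close>, with the limit laws and uniqueness at hand.\<close>

definition partitions :: "real \<Rightarrow> real \<Rightarrow> (nat \<times> (nat \<Rightarrow> real) \<times> (nat \<Rightarrow> real)) filter" where
  "partitions a b = (INF \<delta>\<in>{0<..}. principal {(n, p, t). tagged_partition a b \<delta> n p t})"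

definition rsum :: "(real \<Rightarrow> real \<Rightarrow> real \<Rightarrow> complex) \<Rightarrow> nat \<times> (nat \<Rightarrow> real) \<times> (nat \<Rightarrow> real) \<Rightarrow> complex" where
  "rsum g = (\<lambda>(n, p, t). \<Sum>j<n. g (p j) (p (Suc j)) (t j))"

lemma eventually_partitions:
  "eventually P (partitions a b) \<longleftrightarrow> (\<exists>\<delta>>0. \<forall>n p t. tagged_partition a b \<delta> n p t \<longrightarrow> P (n, p, t))"
proof -
  have "eventually P (partitions a b) \<longleftrightarrow>
      (\<exists>\<delta>\<in>{0<..}. eventually P (principal {(n, p, t). tagged_partition a b \<delta> n p t}))"
    unfolding partitions_def
  proof (rule eventually_INF_base)
    fix \<delta> \<delta>' :: real assume "\<delta> \<in> {0<..}" "\<delta>' \<in> {0<..}"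
    then show "\<exists>x\<in>{0<..}. principal {(n, p, t). tagged_partition a b x n p t}
        \<le> inf (principal {(n, p, t). tagged_partition a b \<delta> n p t})
              (principal {(n, p, t). tagged_partition a b \<delta>' n p t})"
      by (intro bexI[of _ "min \<delta> \<delta>'"]) (auto simp: tagged_partition_def)
  qed (auto intro: exI[of _ 1])
  then show ?thesis by (auto simp: eventually_principal)
qed

text \<open>Nontriviality of the filter is what makes the Stieltjes integral unique. Equal
  subintervals tagged at their left ends give partitions of any mesh.\<close>

lemma partitions_neq_bot:
  assumes "a < b"
  shows "partitions a b \<noteq> bot"
proof
  assume "partitions a b = bot"
  then have "eventually (\<lambda>_. False) (partitions a b)" by simp
  then obtain \<delta> where \<delta>: "\<delta> > 0" "\<And>n p t. \<not> tagged_partition a b \<delta> n p t"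
    by (auto simp: eventually_partitions)
  obtain n :: nat where n: "(b - a) / \<delta> < real n" using reals_Archimedean2 by blast
  moreover have "0 < (b - a) / \<delta>" using assms \<delta> by simp
  ultimately have n0: "real n > 0" by linarith
  then have "(b - a) / real n < \<delta>" using n \<delta>(1) by (simp add: field_simps)
  moreover define h where "h = (b - a) / real n"
  ultimately have "0 < h" "h < \<delta>" "a + real n * h = b" using n0 assms by (simp_all add: h_def)
  then have "tagged_partition a b \<delta> n (\<lambda>j. a + real j * h) (\<lambda>j. a + real j * h)"
    unfolding tagged_partition_def by (auto simp: distrib_right)
  then show False using \<delta>(2) by blast
qed

lemma tendsto_partitions:
  "(f \<longlongrightarrow> l) (partitions a b) \<longleftrightarrow>
    (\<forall>\<epsilon>>0. \<exists>\<delta>>0. \<forall>n p t. tagged_partition a b \<delta> n p t \<longrightarrow> cmod (f (n, p, t) - l) < \<epsilon>)"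
  by (simp add: tendsto_iff eventually_partitions dist_norm)

lemma has_stieltjes_integral_iff:
  "has_stieltjes_integral \<Sigma> u v l \<longleftrightarrow> (\<forall>a b. a < b \<longrightarrow> supp u \<union> supp v \<subseteq> {a..b} \<longrightarrow>
     (rsum (\<lambda>x y t. cinner (u t) (\<Sigma> {x<..y} (v t))) \<longlongrightarrow> l) (partitions a b))"
  by (simp add: has_stieltjes_integral_def tendsto_partitions rsum_def)

lemma rsum_sum: "rsum (\<lambda>x y t. \<Sum>i\<in>A. g i x y t) P = (\<Sum>i\<in>A. rsum (g i) P)"
  unfolding rsum_def by (auto split: prod.splits intro: sum.swap)

lemma rsum_cmult: "rsum (\<lambda>x y t. c * g x y t) P = c * rsum g P"
  by (simp add: rsum_def sum_distrib_left split: prod.splits)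

lemma rsum_add: "rsum (\<lambda>x y t. g x y t + h x y t) P = rsum g P + rsum h P"
  by (simp add: rsum_def sum.distrib split: prod.splits)

lemma rsum_cnj: "rsum (\<lambda>x y t. cnj (g x y t)) P = cnj (rsum g P)"
  by (simp add: rsum_def split: prod.splits)

text \<open>The half-open cells tile the interval from \<open>p 0\<close> to \<open>p n\<close>,
  open on the left, so at most one summand survives at \<open>s\<close>. The conjunct
  \<open>p 0 \<le> p n\<close> carries the induction and is used later to locate a cell inside the
  whole interval.\<close>

lemma step_function_cases:
  fixes p :: "nat \<Rightarrow> real" and c :: "nat \<Rightarrow> complex"
  assumes "\<And>j. j < n \<Longrightarrow> p j \<le> p (Suc j)"
  shows "p 0 \<le> p n \<and>
    (if s \<in> {p 0<..p n}
     then \<exists>k<n. s \<in> {p k<..p (Suc k)} \<and> (\<Sum>j<n. c j * indicator {p j<..p (Suc j)} s) = c k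
     else (\<Sum>j<n. c j * indicator {p j<..p (Suc j)} s) = 0)"
  using assms
proof (induction n)
  case 0
  then show ?case by simp
next
  case (Suc n)
  have IH: "p 0 \<le> p n \<and>
    (if s \<in> {p 0<..p n}
     then \<exists>k<n. s \<in> {p k<..p (Suc k)} \<and> (\<Sum>j<n. c j * indicator {p j<..p (Suc j)} s) = c k
     else (\<Sum>j<n. c j * indicator {p j<..p (Suc j)} s) = 0)"
    by (rule Suc.IH) (use Suc.prems in simp)
  have le: "p n \<le> p (Suc n)" using Suc.prems by simp
  consider "s \<in> {p 0<..p n}" | "s \<in> {p n<..p (Suc n)}" | "s \<notin> {p 0<..p (Suc n)}"
    using IH le by fastforce
  then show ?case
  proof cases
    case 1
    then obtain k where "k < n" "s \<in> {p k<..p (Suc k)}"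
        "(\<Sum>j<n. c j * indicator {p j<..p (Suc j)} s) = c k" using IH by auto
    then show ?thesis using 1 le IH by (auto intro!: exI[of _ k])
  next
    case 2
    then show ?thesis using IH le by (auto intro!: exI[of _ n])
  next
    case 3
    then show ?thesis using IH le by (auto simp: indicator_def)
  qed
qed

lemma integrable_continuous_mult:
  fixes f \<phi> :: "real \<Rightarrow> complex"
  assumes M: "sets borel \<subseteq> sets M" and \<phi>: "integrable M \<phi>"
    and f: "continuous_on UNIV f" and supp: "\<And>s. s \<notin> {a..b} \<Longrightarrow> f s = 0"
  shows "integrable M (\<lambda>s. f s * \<phi> s)"
proof -
  have space_M: "space M = UNIV"
  proof -
    have "UNIV \<in> sets M" using M by auto
    then show ?thesis using sets.sets_into_space by blast
  qed
  have fM: "f \<in> borel_measurable M"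
    using borel_measurable_continuous_onI[OF f] M space_M by (auto simp: measurable_def)
  have "compact (f ` {a..b})" using f by (intro compact_continuous_image) (auto intro: continuous_on_subset)
  then obtain B where "\<And>s. s \<in> {a..b} \<Longrightarrow> cmod (f s) \<le> B"
    using compact_imp_bounded bounded_iff by (metis imageI)
  then have B: "cmod (f s) \<le> max B 0" for s using supp by (cases "s \<in> {a..b}") (auto simp: le_max_iff_disj)
  show ?thesis
  proof (rule Bochner_Integration.integrable_bound)
    show "integrable M (\<lambda>s. max B 0 * cmod (\<phi> s))" using \<phi> by simp
    show "(\<lambda>s. f s * \<phi> s) \<in> borel_measurable M" using fM \<phi> by measurable
    show "AE s in M. norm (f s * \<phi> s) \<le> norm (max B 0 * cmod (\<phi> s))"
      using B by (auto simp: norm_mult intro!: mult_right_mono)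
  qed
qed

text \<open>A Riemann sum is the integral of \<open>\<phi>\<close> against the step function with
  the tagged values of \<open>f\<close>. Uniform continuity brings this step function uniformly
  close to \<open>f\<close>, and integrability of \<open>\<phi>\<close> does the rest.\<close>

lemma rsum_tendsto_integral:
  fixes f \<phi> :: "real \<Rightarrow> complex"
  assumes M: "sets borel \<subseteq> sets M" and \<phi>: "integrable M \<phi>"
    and f: "continuous_on UNIV f" and supp: "\<And>s. s \<notin> {a..b} \<Longrightarrow> f s = 0" and "a < b"
  shows "(rsum (\<lambda>x y t. f t * (LINT s:{x<..y}|M. \<phi> s)) \<longlongrightarrow> (LINT s|M. f s * \<phi> s)) (partitions a b)"
  unfolding tendsto_partitions
proof (intro allI impI)
  \<comment> \<open>The cells are open on the left and miss the point \<open>a\<close>, where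
    \<open>\<phi>\<close> may carry mass. Continuity from the left gives \<open>f a = 0\<close>, so
    nothing is lost.\<close>
  have fa: "f a = 0"
  proof (rule LIMSEQ_unique)
    have "(\<lambda>n. a - inverse (real (Suc n))) \<longlonglongrightarrow> a - 0"
      by (intro tendsto_intros LIMSEQ_inverse_real_of_nat)
    then show "(\<lambda>n. f (a - inverse (real (Suc n)))) \<longlonglongrightarrow> f a"
      using f by (intro continuous_on_tendsto_compose[OF f]) auto
    have "f (a - inverse (real (Suc n))) = 0" for n by (rule supp) simp
    then show "(\<lambda>n. f (a - inverse (real (Suc n)))) \<longlonglongrightarrow> 0" by simp
  qed
  have "uniformly_continuous_on {a..b} f"
    using f by (intro compact_uniformly_continuous) (auto intro: continuous_on_subset)
  \<comment> \<open>One more than the integral of the modulus of \<open>\<phi>\<close>: positive in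
    every case, and the final bound \<open>\<epsilon> / K * (K - 1)\<close> is strict.\<close>
  define K where "K = (LINT s|M. cmod (\<phi> s)) + 1"
  have K: "K > 0" by (simp add: K_def add_nonneg_pos)
  fix \<epsilon> :: real assume "\<epsilon> > 0"
  then have "\<epsilon> / K > 0" using K by simp
  then obtain \<delta> where \<delta>: "\<delta> > 0"
      "\<And>s t. s \<in> {a..b} \<Longrightarrow> t \<in> {a..b} \<Longrightarrow> dist s t < \<delta> \<Longrightarrow> dist (f s) (f t) < \<epsilon> / K"
    using \<open>uniformly_continuous_on {a..b} f\<close> unfolding uniformly_continuous_on_def by metis
  have f\<phi>: "integrable M (\<lambda>s. f s * \<phi> s)" by (rule integrable_continuous_mult[OF M \<phi> f supp])
  have "cmod (rsum (\<lambda>x y t. f t * (LINT s:{x<..y}|M. \<phi> s)) (n, p, t) - (LINT s|M. f s * \<phi> s)) < \<epsilon>"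
    if P: "tagged_partition a b \<delta> n p t" for n p t
  proof -
    define g where "g s = (\<Sum>j<n. f (t j) * indicator {p j<..p (Suc j)} s)" for s
    have ind: "integrable M (\<lambda>s. indicator {p j<..p (Suc j)} s *\<^sub>R \<phi> s)" for j
      using M by (intro integrable_mult_indicator \<phi>) auto
    have g\<phi>_eq: "g s * \<phi> s = (\<Sum>j<n. f (t j) * (indicator {p j<..p (Suc j)} s *\<^sub>R \<phi> s))" for s
      unfolding g_def sum_distrib_right by (intro sum.cong) (auto split: split_indicator)
    have g\<phi>: "integrable M (\<lambda>s. g s * \<phi> s)"
      unfolding g\<phi>_eq by (intro Bochner_Integration.integrable_sum integrable_mult_right ind)
    have sum_eq: "rsum (\<lambda>x y t. f t * (LINT s:{x<..y}|M. \<phi> s)) (n, p, t) = (LINT s|M. g s * \<phi> s)"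
      unfolding g\<phi>_eq rsum_def set_lebesgue_integral_def prod.case
      by (simp only: Bochner_Integration.integral_sum[OF integrable_mult_right[OF ind]]
          integral_mult_right_zero)
    have close: "cmod (g s - f s) \<le> \<epsilon> / K" for s
    proof -
      have p: "p 0 = a" "p n = b" and pj: "\<And>j. j < n \<Longrightarrow> p j \<le> p (Suc j)"
        using P by (auto simp: tagged_partition_def less_imp_le)
      note cases = step_function_cases[of n p s "\<lambda>j. f (t j)", OF pj, folded g_def, unfolded p]
      show ?thesis
      proof (cases "s \<in> {a<..b}")
        case True
        then obtain k where k: "k < n" "s \<in> {p k<..p (Suc k)}" "g s = f (t k)" using cases by auto
        have mono: "a \<le> p k" "p (Suc k) \<le> b"
        proof -
          show "a \<le> p k"
            using step_function_cases[of k p s "\<lambda>_. 0"] pj k(1) p by auto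
          show "p (Suc k) \<le> b"
            using step_function_cases[of "n - Suc k" "\<lambda>j. p (Suc k + j)" s "\<lambda>_. 0"] pj k(1) p by auto
        qed
        have tk: "t k \<in> {p k..p (Suc k)}" "p (Suc k) - p k < \<delta>"
          using P k(1) by (auto simp: tagged_partition_def)
        then have "dist (t k) s < \<delta>" using k(2) by (auto simp: dist_real_def abs_less_iff)
        then have "dist (f (t k)) (f s) < \<epsilon> / K"
          using tk mono k(2) True by (intro \<delta>(2)) auto
        then show ?thesis using k(3) by (simp add: dist_norm)
      next
        case False
        then have "f s = 0" using supp[of s] fa by (cases "s = a") auto
        then show ?thesis using cases False \<open>\<epsilon> / K > 0\<close> by auto
      qed
    qed
    have "cmod ((LINT s|M. g s * \<phi> s) - (LINT s|M. f s * \<phi> s)) = cmod (LINT s|M. (g s - f s) * \<phi> s)"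
      using f\<phi> g\<phi> by (simp add: left_diff_distrib)
    also have "\<dots> \<le> (LINT s|M. cmod ((g s - f s) * \<phi> s))" by (rule integral_norm_bound)
    also have "\<dots> \<le> (LINT s|M. \<epsilon> / K * cmod (\<phi> s))"
    proof (rule integral_mono)
      show "integrable M (\<lambda>s. cmod ((g s - f s) * \<phi> s))" using f\<phi> g\<phi> by (simp add: left_diff_distrib)
      show "integrable M (\<lambda>s. \<epsilon> / K * cmod (\<phi> s))" using \<phi> by simp
      show "cmod ((g s - f s) * \<phi> s) \<le> \<epsilon> / K * cmod (\<phi> s)" for s
        using close[of s] by (simp only: norm_mult) (intro mult_right_mono, auto)
    qed
    also have "\<dots> = \<epsilon> / K * (K - 1)" by (simp add: K_def)
    also have "\<dots> < \<epsilon>" using K \<open>\<epsilon> > 0\<close> by (simp add: field_simps)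
    finally show ?thesis unfolding sum_eq .
  qed
  then show "\<exists>\<delta>>0. \<forall>n p t. tagged_partition a b \<delta> n p t \<longrightarrow>
      cmod (rsum (\<lambda>x y t. f t * (LINT s:{x<..y}|M. \<phi> s)) (n, p, t) - (LINT s|M. f s * \<phi> s)) < \<epsilon>"
    using \<delta>(1) by blast
qed


section \<open>Scalar measures of an operator-valued measure\<close>

lemma bounded_clinearD:
  assumes "bounded_clinear T"
  shows "T (x + y) = T x + T y" "T (scaleC c x) = scaleC c (T x)" "T 0 = 0" "T (- x) = - T x"
    "T (x - y) = T x - T y" "T (\<Sum>i\<in>A. f i) = (\<Sum>i\<in>A. T (f i))"
proof -
  have T: "bounded_linear T" using assms by (simp add: bounded_clinear_def)
  show "T (scaleC c x) = scaleC c (T x)" using assms by (simp add: bounded_clinear_def)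
  note linear = bounded_linear.linear[OF T]
  show "T (x + y) = T x + T y" "T 0 = 0" "T (- x) = - T x" "T (x - y) = T x - T y"
    "T (\<Sum>i\<in>A. f i) = (\<Sum>i\<in>A. T (f i))"
    using linear_add[OF linear] linear_0[OF linear] linear_neg[OF linear] linear_diff[OF linear]
      linear_sum[OF linear] by auto
qed

text \<open>Writes an off-diagonal form through four diagonal ones, and the diagonal ones are finite
  positive measures in the set variable when \<open>T\<close> is \<open>\<Sigma> B\<close>.\<close>

lemma cinner_polarization:
  assumes T: "bounded_clinear T"
  shows "cinner x (T y) = (cinner (x + y) (T (x + y)) - cinner (x + scaleC (- 1) y) (T (x + scaleC (- 1) y))
    - \<i> * cinner (x + scaleC \<i> y) (T (x + scaleC \<i> y))
    + \<i> * cinner (x + scaleC (- \<i>) y) (T (x + scaleC (- \<i>) y))) / 4"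
  by (simp add: bounded_clinearD[OF T] cinner_add_left cinner_add_right cinner_scaleC_left
      cinner_scaleC_right cinner_diff_left cinner_diff_right algebra_simps)

text \<open>A real quadratic form on a complex space is Hermitian: testing \<open>x + y\<close> and
  \<open>x + \<i> y\<close> controls the imaginary and the real parts.\<close>

lemma nonneg_operator_self_adjoint:
  assumes "nonneg_operator T"
  shows "cinner x (T y) = cnj (cinner y (T x))"
proof -
  have T: "bounded_clinear T" and Im: "\<And>x. Im (cinner x (T x)) = 0"
    using assms by (auto simp: nonneg_operator_def)
  note lin = bounded_clinearD[OF T] cinner_add_left cinner_add_right cinner_scaleC_left cinner_scaleC_right
  have "Im (cinner x (T y) + cinner y (T x)) = 0"
    using Im[of "x + y"] Im[of x] Im[of y] by (simp add: lin)
  moreover have "Re (cinner x (T y)) - Re (cinner y (T x)) = 0"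
    using Im[of "x + scaleC \<i> y"] Im[of x] Im[of y] by (simp add: lin)
  ultimately show ?thesis by (simp add: complex_eq_iff)
qed

definition scalar_measure :: "(real set \<Rightarrow> 'k::complex_inner \<Rightarrow> 'k) \<Rightarrow> 'k \<Rightarrow> real measure" where
  "scalar_measure \<Sigma> x = measure_of UNIV (sets borel) (\<lambda>B. ennreal (Re (cinner x (\<Sigma> B x))))"

locale operator_measure =
  fixes \<Sigma> :: "real set \<Rightarrow> 'k::complex_inner \<Rightarrow> 'k"
  assumes nonneg_operator_measure: "nonneg_operator_measure \<Sigma>"
begin

lemma nonneg_operator: "B \<in> sets borel \<Longrightarrow> nonneg_operator (\<Sigma> B)"
  using nonneg_operator_measure by (simp add: nonneg_operator_measure_def)

lemma bounded_clinear: "B \<in> sets borel \<Longrightarrow> bounded_clinear (\<Sigma> B)"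
  using nonneg_operator by (simp add: nonneg_operator_def)

lemma sets_scalar_measure [simp]: "sets (scalar_measure \<Sigma> x) = sets borel"
  using sets.sigma_sets_eq[of "borel :: real measure"] by (simp add: scalar_measure_def)

lemma space_scalar_measure [simp]: "space (scalar_measure \<Sigma> x) = UNIV"
  by (simp add: scalar_measure_def space_measure_of_conv)

text \<open>Strong convergence over a disjoint union passes to the inner product with
  \<open>x\<close>, and nonnegativity moves the real series into \<open>ennreal\<close>.\<close>

lemma emeasure_scalar_measure:
  assumes "B \<in> sets borel"
  shows "emeasure (scalar_measure \<Sigma> x) B = ennreal (Re (cinner x (\<Sigma> B x)))"
proof (rule emeasure_measure_of[OF scalar_measure_def])
  show "sets borel \<subseteq> Pow UNIV" by simp
  show "B \<in> sets (scalar_measure \<Sigma> x)" using assms by simp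
  show "positive (sets (scalar_measure \<Sigma> x)) (\<lambda>B. ennreal (Re (cinner x (\<Sigma> B x))))"
    using nonneg_operator_measure by (simp add: positive_def nonneg_operator_measure_def cinner_zero_right)
  show "countably_additive (sets (scalar_measure \<Sigma> x)) (\<lambda>B. ennreal (Re (cinner x (\<Sigma> B x))))"
  proof (rule countably_additiveI)
    fix A :: "nat \<Rightarrow> real set" assume A: "range A \<subseteq> sets (scalar_measure \<Sigma> x)" "disjoint_family A"
    have "(\<lambda>j. \<Sigma> (A j) x) sums \<Sigma> (\<Union>j. A j) x"
      using nonneg_operator_measure A by (simp add: nonneg_operator_measure_def)
    then have "(\<lambda>n. Re (cinner x (\<Sum>j<n. \<Sigma> (A j) x))) \<longlonglongrightarrow> Re (cinner x (\<Sigma> (\<Union>j. A j) x))"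
      unfolding sums_def
      by (intro tendsto_Re bounded_linear.tendsto[OF bounded_linear_cinner_right])
    then have sums: "(\<lambda>j. Re (cinner x (\<Sigma> (A j) x))) sums Re (cinner x (\<Sigma> (\<Union>j. A j) x))"
      by (simp add: sums_def cinner_sum_right)
    have "0 \<le> Re (cinner x (\<Sigma> (A j) x))" for j
      using nonneg_operator[of "A j"] A by (auto simp: nonneg_operator_def)
    then show "(\<Sum>j. ennreal (Re (cinner x (\<Sigma> (A j) x)))) = ennreal (Re (cinner x (\<Sigma> (\<Union>j. A j) x)))"
      using sums by (subst suminf_ennreal2) (auto simp: sums_iff)
  qed
qed

lemma finite_scalar_measure: "finite_measure (scalar_measure \<Sigma> x)"
  by (rule finite_measureI) (simp add: emeasure_scalar_measure)

lemma cinner_eq_measure: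
  assumes "B \<in> sets borel"
  shows "cinner x (\<Sigma> B x) = of_real (measure (scalar_measure \<Sigma> x) B)"
  using nonneg_operator[OF assms]
  by (simp add: measure_def emeasure_scalar_measure[OF assms] nonneg_operator_def complex_eq_iff)

lemma rsum_tendsto_scalar:
  assumes f: "continuous_on UNIV f" "\<And>s. s \<notin> {a..b} \<Longrightarrow> f s = 0" "a < b"
  shows "(rsum (\<lambda>x y t. f t * cinner z (\<Sigma> {x<..y} z)) \<longlongrightarrow> (LINT s|scalar_measure \<Sigma> z. f s)) (partitions a b)"
proof -
  interpret finite_measure "scalar_measure \<Sigma> z" by (rule finite_scalar_measure)
  have "(LINT s:{x<..y}|scalar_measure \<Sigma> z. 1) = cinner z (\<Sigma> {x<..y} z)" for x y
    by (simp add: set_lebesgue_integral_def cinner_eq_measure scaleR_conv_of_real)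
  then show ?thesis
    using rsum_tendsto_integral[of "scalar_measure \<Sigma> z" "\<lambda>_. 1" f a b] f by simp
qed

text \<open>The integral of \<open>f\<close> against the complex measure
  \<open>(x, \<Sigma> B y)\<close>, assembled by polarization so that only positive measures are
  integrated against.\<close>

definition scalar_integral :: "(real \<Rightarrow> complex) \<Rightarrow> 'k \<Rightarrow> 'k \<Rightarrow> complex" where
  "scalar_integral f x y = ((LINT s|scalar_measure \<Sigma> (x + y). f s)
    - (LINT s|scalar_measure \<Sigma> (x + scaleC (- 1) y). f s)
    - \<i> * (LINT s|scalar_measure \<Sigma> (x + scaleC \<i> y). f s)
    + \<i> * (LINT s|scalar_measure \<Sigma> (x + scaleC (- \<i>) y). f s)) / 4"

lemma rsum_tendsto_scalar_integral:
  assumes f: "continuous_on UNIV f" "\<And>s. s \<notin> {a..b} \<Longrightarrow> f s = 0" "a < b"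
  shows "(rsum (\<lambda>r s t. f t * cinner x (\<Sigma> {r<..s} y)) \<longlongrightarrow> scalar_integral f x y) (partitions a b)"
proof -
  define R where "R z = rsum (\<lambda>r s t. f t * cinner z (\<Sigma> {r<..s} z))" for z
  have "rsum (\<lambda>r s t. f t * cinner x (\<Sigma> {r<..s} y)) = (\<lambda>P. (R (x + y) P - R (x + scaleC (- 1) y) P
      - \<i> * R (x + scaleC \<i> y) P + \<i> * R (x + scaleC (- \<i>) y) P) / 4)"
  proof
    fix P
    have "f t * cinner x (\<Sigma> {r<..s} y) = (f t * cinner (x + y) (\<Sigma> {r<..s} (x + y))
       - f t * cinner (x + scaleC (- 1) y) (\<Sigma> {r<..s} (x + scaleC (- 1) y))
       - \<i> * (f t * cinner (x + scaleC \<i> y) (\<Sigma> {r<..s} (x + scaleC \<i> y)))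
       + \<i> * (f t * cinner (x + scaleC (- \<i>) y) (\<Sigma> {r<..s} (x + scaleC (- \<i>) y)))) / 4" for r s t
      by (subst cinner_polarization[OF bounded_clinear]) (simp_all add: algebra_simps)
    then show "rsum (\<lambda>r s t. f t * cinner x (\<Sigma> {r<..s} y)) P = (R (x + y) P - R (x + scaleC (- 1) y) P
      - \<i> * R (x + scaleC \<i> y) P + \<i> * R (x + scaleC (- \<i>) y) P) / 4"
      unfolding R_def by (cases P) (simp only: rsum_def sum_divide_distrib[symmetric] sum.distrib
          sum_subtractf sum_distrib_left prod.case)
  qed
  then show ?thesis
    unfolding scalar_integral_def
    by (simp only:) (intro tendsto_intros rsum_tendsto_scalar[OF f, folded R_def], simp_all)
qed


section \<open>The semi-inner product on continuous functions\<close>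

abbreviation "Cc \<equiv> C00_space \<Sigma>"

lemma C00_D:
  assumes "u \<in> C00"
  shows "continuous_on UNIV u" "compact (supp u)"
    "\<exists>B. finite B \<and> orthonormal B \<and> range u \<subseteq> cspan B"
proof -
  show "continuous_on UNIV u" "compact (supp u)" using assms by (auto simp: C00_def)
  obtain F where F: "finite F" "range u \<subseteq> cspan F" using assms by (auto simp: C00_def)
  then show "\<exists>B. finite B \<and> orthonormal B \<and> range u \<subseteq> cspan B"
    using gram_schmidt[OF F(1)] by metis
qed

section \<open>Supports and closure properties of \<open>C00\<close>\<close>

lemma supp_outside: "supp u \<subseteq> A \<Longrightarrow> s \<notin> A \<Longrightarrow> u s = 0"
  unfolding supp_def using closure_subset[of "{x. u x \<noteq> 0}"] by auto

lemma supp_mono: "(\<And>s. v s \<noteq> 0 \<Longrightarrow> u s \<noteq> 0) \<Longrightarrow> supp v \<subseteq> supp u"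
  unfolding supp_def by (intro closure_mono) auto

lemma supp_add: "supp (\<lambda>s. u s + v s) \<subseteq> supp u \<union> supp v"
  unfolding supp_def closure_Un[symmetric] by (intro closure_mono) auto

lemma compact_supp_subset: "supp v \<subseteq> K \<Longrightarrow> compact K \<Longrightarrow> compact (supp v)"
  unfolding supp_def by (metis closed_closure compact_Int_closed inf.absorb_iff2)

lemma compact_subset_interval:
  assumes "compact (K :: real set)"
  shows "\<exists>a b. a < b \<and> K \<subseteq> {a..b}"
proof -
  obtain c where "\<And>x. x \<in> K \<Longrightarrow> \<bar>x\<bar> \<le> c"
    using compact_imp_bounded[OF assms] by (auto simp: bounded_iff)
  then show ?thesis by (intro exI[of _ "- \<bar>c\<bar> - 1"] exI[of _ "\<bar>c\<bar> + 1"]) (force simp: abs_le_iff)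
qed

lemma C00_zero: "(\<lambda>s. 0) \<in> C00"
  by (auto simp: C00_def supp_def intro!: exI[of _ "{}"])

lemma C00_add:
  assumes u: "u \<in> C00" and v: "v \<in> C00"
  shows "(\<lambda>s. u s + v s) \<in> C00"
proof -
  obtain F G where F: "finite F" "range u \<subseteq> cspan F"
    and G: "finite G" "range v \<subseteq> cspan G"
    using u v by (auto simp: C00_def)
  have "range (\<lambda>s. u s + v s) \<subseteq> cspan (F \<union> G)"
    using F(2) G(2) complex_vector.span_mono[of F "F \<union> G"] complex_vector.span_mono[of G "F \<union> G"]
    by (auto intro!: complex_vector.span_add)
  moreover have "compact (supp (\<lambda>s. u s + v s))"
    by (rule compact_supp_subset[OF supp_add compact_Un[OF C00_D(2)[OF u] C00_D(2)[OF v]]])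
  ultimately show ?thesis
    using F(1) G(1) C00_D(1)[OF u] C00_D(1)[OF v]
    by (auto simp: C00_def intro!: continuous_on_add exI[of _ "F \<union> G"])
qed

lemma C00_mult:
  assumes u: "u \<in> C00" and f: "continuous_on UNIV f"
  shows "(\<lambda>s. scaleC (f s) (u s)) \<in> C00"
proof -
  obtain F where F: "finite F" "range u \<subseteq> cspan F" using u by (auto simp: C00_def)
  then have "range (\<lambda>s. scaleC (f s) (u s)) \<subseteq> cspan F"
    by (auto intro!: complex_vector.span_scale)
  moreover have "compact (supp (\<lambda>s. scaleC (f s) (u s)))"
    by (rule compact_supp_subset[OF supp_mono C00_D(2)[OF u]]) auto
  ultimately show ?thesis
    using F(1) C00_D(1)[OF u] f by (auto simp: C00_def intro!: continuous_on_scaleC exI[of _ F])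
qed

lemma C00_const_mult:
  assumes f: "continuous_on UNIV f" and supp: "\<And>s. s \<notin> {a..b} \<Longrightarrow> f s = 0"
  shows "(\<lambda>s. scaleC (f s) x) \<in> C00"
proof -
  have "supp (\<lambda>s. scaleC (f s) x) \<subseteq> {a..b}"
    unfolding supp_def
  proof (rule closure_minimal)
    show "{s. scaleC (f s) x \<noteq> 0} \<subseteq> {a..b}"
    proof
      fix s assume "s \<in> {s. scaleC (f s) x \<noteq> 0}"
      then show "s \<in> {a..b}" using supp[of s] by (cases "s \<in> {a..b}") auto
    qed
  qed simp
  then have "compact (supp (\<lambda>s. scaleC (f s) x))" by (rule compact_supp_subset) simp
  moreover have "range (\<lambda>s. scaleC (f s) x) \<subseteq> cspan {x}"
    by (auto intro!: complex_vector.span_scale[OF complex_vector.span_base])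
  ultimately show ?thesis
    using f by (auto simp: C00_def intro!: continuous_on_scaleC exI[of _ "{x}"])
qed

text \<open>In orthonormal bases the Riemann sums split into finitely many scalar ones with
  continuous integrands. The limit is a sum of \<open>scalar_integral\<close> terms, in which the
  interval does not occur, so one value serves all admissible intervals.\<close>

lemma ex_has_stieltjes_integral:
  assumes u: "u \<in> C00" and v: "v \<in> C00"
  shows "\<exists>l. has_stieltjes_integral \<Sigma> u v l"
proof -
  obtain B where B: "finite B" "orthonormal B" "range u \<subseteq> cspan B" using C00_D(3)[OF u] by blast
  obtain C where C: "finite C" "orthonormal C" "range v \<subseteq> cspan C" using C00_D(3)[OF v] by blast
  define f where "f b c s = cnj (cinner b (u s)) * cinner c (v s)" for b c s
  have expand: "cinner (u t) (\<Sigma> {x<..y} (v t)) = (\<Sum>b\<in>B. \<Sum>c\<in>C. f b c t * cinner b (\<Sigma> {x<..y} c))" for x y t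
  proof -
    have "u t = (\<Sum>b\<in>B. scaleC (cinner b (u t)) b)" using B by (intro orthonormal_expansion) auto
    moreover have "v t = (\<Sum>c\<in>C. scaleC (cinner c (v t)) c)" using C by (intro orthonormal_expansion) auto
    ultimately have "cinner (u t) (\<Sigma> {x<..y} (v t))
        = cinner (\<Sum>b\<in>B. scaleC (cinner b (u t)) b) (\<Sigma> {x<..y} (\<Sum>c\<in>C. scaleC (cinner c (v t)) c))" by simp
    also have "\<dots> = (\<Sum>b\<in>B. \<Sum>c\<in>C. f b c t * cinner b (\<Sigma> {x<..y} c))"
      unfolding cinner_sum_left
      by (intro sum.cong refl) (simp add: bounded_clinearD[OF bounded_clinear] cinner_sum_right
          cinner_scaleC_left cinner_scaleC_right sum_distrib_left f_def mult_ac)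
    finally show ?thesis .
  qed
  have "has_stieltjes_integral \<Sigma> u v (\<Sum>b\<in>B. \<Sum>c\<in>C. scalar_integral (f b c) b c)"
    unfolding has_stieltjes_integral_iff expand rsum_sum
  proof (intro allI impI tendsto_sum rsum_tendsto_scalar_integral)
    fix a b' :: real and b c assume ab: "a < b'" "supp u \<union> supp v \<subseteq> {a..b'}"
    show "continuous_on UNIV (f b c)"
      unfolding f_def using C00_D(1)[OF u] C00_D(1)[OF v]
      by (intro continuous_intros continuous_on_cinner_right)
    show "f b c s = 0" if "s \<notin> {a..b'}" for s
      using supp_outside[of u "{a..b'}" s] that ab by (simp add: f_def cinner_zero_right)
  qed
  then show ?thesis by blast
qed

text \<open>The defining predicate ranges over all intervals containing the supports and would be
  vacuous without one. Compactness of the supports provides it.\<close>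

lemma stieltjes_integral_unique:
  assumes "u \<in> C00" "v \<in> C00" "has_stieltjes_integral \<Sigma> u v l"
  shows "stieltjes_integral \<Sigma> u v = l"
  unfolding stieltjes_integral_def
proof (rule the_equality)
  show "has_stieltjes_integral \<Sigma> u v l" by fact
  fix l' assume l': "has_stieltjes_integral \<Sigma> u v l'"
  obtain a b where "a < b" "supp u \<union> supp v \<subseteq> {a..b}"
    using compact_subset_interval[OF compact_Un[OF C00_D(2)[OF assms(1)] C00_D(2)[OF assms(2)]]] by blast
  then show "l' = l"
    using tendsto_unique[OF partitions_neq_bot[of a b]] l' assms(3)
    unfolding has_stieltjes_integral_iff by blast
qed

lemma stieltjes_tendsto:
  assumes "u \<in> C00" "v \<in> C00" "a < b" "supp u \<subseteq> {a..b}" "supp v \<subseteq> {a..b}"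
  shows "(rsum (\<lambda>x y t. cinner (u t) (\<Sigma> {x<..y} (v t))) \<longlongrightarrow> stieltjes_integral \<Sigma> u v) (partitions a b)"
  using ex_has_stieltjes_integral[OF assms(1,2)] stieltjes_integral_unique[OF assms(1,2)] assms(3-5)
  unfolding has_stieltjes_integral_iff by auto

lemma stieltjes_integralI:
  assumes "u \<in> C00" "v \<in> C00" "a < b" "supp u \<subseteq> {a..b}" "supp v \<subseteq> {a..b}"
    "(rsum (\<lambda>x y t. cinner (u t) (\<Sigma> {x<..y} (v t))) \<longlongrightarrow> l) (partitions a b)"
  shows "stieltjes_integral \<Sigma> u v = l"
  using tendsto_unique[OF partitions_neq_bot[OF assms(3)] stieltjes_tendsto[OF assms(1-5)] assms(6)] .

lemma C00_common_interval:
  assumes "u \<in> C00" "v \<in> C00" "z \<in> C00"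
  shows "\<exists>a b. a < b \<and> supp u \<subseteq> {a..b} \<and> supp v \<subseteq> {a..b} \<and> supp z \<subseteq> {a..b}"
proof -
  have "compact (supp u \<union> supp v \<union> supp z)" by (intro compact_Un C00_D assms)
  then show ?thesis using compact_subset_interval[of "supp u \<union> supp v \<union> supp z"] by auto
qed

lemma carr_C00_space: "carr Cc = C00"
  and zer_C00_space: "zer Cc = (\<lambda>s. 0)"
  and add_C00_space: "add Cc u v = (\<lambda>s. u s + v s)"
  and smul_C00_space: "smul Cc c u = (\<lambda>s. scaleC c (u s))"
  and ip_C00_space: "ip Cc u v = stieltjes_integral \<Sigma> u v"
  and sub_C00_space: "sub Cc u v = (\<lambda>s. u s - v s)"
  by (simp_all add: C00_space_def sub_def scaleC_minus_one)

lemmas C00_space_simps = carr_C00_space zer_C00_space add_C00_space smul_C00_space ip_C00_space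

text \<open>Nonnegativity, symmetry and linearity hold for each Riemann sum over an interval
  containing all supports involved, and pass to the limit.\<close>

lemma semi_ip_space_C00: "semi_ip_space Cc"
proof
  fix u v z :: "real \<Rightarrow> 'k" and c d :: complex
  show "zer Cc \<in> carr Cc" by (simp add: C00_space_simps C00_zero)
  show "add Cc (add Cc u v) z = add Cc u (add Cc v z)"
    "add Cc u v = add Cc v u"
    "add Cc u (zer Cc) = u"
    "add Cc u (smul Cc (- 1) u) = zer Cc"
    "smul Cc 1 u = u"
    "smul Cc c (smul Cc d u) = smul Cc (c * d) u"
    "smul Cc c (add Cc u v)
      = add Cc (smul Cc c u) (smul Cc c v)"
    "smul Cc (c + d) u = add Cc (smul Cc c u) (smul Cc d u)"
    by (simp_all add: C00_space_simps scaleC_minus_one scaleC_add_left scaleC_add_right scaleC_scaleC add_ac)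
  assume "u \<in> carr Cc"
  then have u: "u \<in> C00" by (simp add: C00_space_simps)
  then have cu: "(\<lambda>s. scaleC c (u s)) \<in> C00" for c by (rule C00_mult) simp
  then show "smul Cc c u \<in> carr Cc" by (simp add: C00_space_simps)
  obtain a b where ab: "a < b" "supp u \<subseteq> {a..b}" using C00_common_interval[OF u u u] by blast
  have "0 \<le> Re (rsum (\<lambda>x y t. cinner (u t) (\<Sigma> {x<..y} (u t))) P)" for P
    using nonneg_operator by (auto simp: rsum_def nonneg_operator_def intro!: sum_nonneg split: prod.splits)
  then show "0 \<le> Re (ip Cc u u)"
    unfolding ip_C00_space
    by (intro tendsto_lowerbound[OF tendsto_Re[OF stieltjes_tendsto[OF u u ab ab(2)]]]
        always_eventually partitions_neq_bot ab) simp
  assume "v \<in> carr Cc"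
  then have v: "v \<in> C00" by (simp add: C00_space_simps)
  show "add Cc u v \<in> carr Cc" using u v by (simp add: C00_space_simps C00_add)
  obtain a b where ab: "a < b" "supp u \<subseteq> {a..b}" "supp v \<subseteq> {a..b}" using C00_common_interval[OF u v v] by blast
  have "cinner (u t) (\<Sigma> {x<..y} (v t)) = cnj (cinner (v t) (\<Sigma> {x<..y} (u t)))" for x y t
    using nonneg_operator by (intro nonneg_operator_self_adjoint) auto
  then have "(rsum (\<lambda>x y t. cinner (u t) (\<Sigma> {x<..y} (v t))) \<longlongrightarrow> cnj (stieltjes_integral \<Sigma> v u)) (partitions a b)"
    using tendsto_cnj[OF stieltjes_tendsto[OF v u ab(1,3,2)]] by (simp add: rsum_cnj[abs_def])
  then show "ip Cc u v = cnj (ip Cc v u)"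
    unfolding ip_C00_space by (rule stieltjes_integralI[OF u v ab])
  have cv: "(\<lambda>s. scaleC c (v s)) \<in> C00" using v by (rule C00_mult) simp
  have supp_cv: "supp (\<lambda>s. scaleC c (v s)) \<subseteq> {a..b}" by (rule order_trans[OF supp_mono ab(3)]) auto
  have "(rsum (\<lambda>x y t. cinner (u t) (\<Sigma> {x<..y} (scaleC c (v t)))) \<longlongrightarrow> c * stieltjes_integral \<Sigma> u v) (partitions a b)"
    using tendsto_mult_left[OF stieltjes_tendsto[OF u v ab], of c]
    by (simp add: bounded_clinearD[OF bounded_clinear] cinner_scaleC_right rsum_cmult[abs_def])
  then show "ip Cc u (smul Cc c v) = c * ip Cc u v"
    unfolding ip_C00_space smul_C00_space by (rule stieltjes_integralI[OF u cv ab(1,2) supp_cv])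
  assume "z \<in> carr Cc"
  then have z: "z \<in> C00" by (simp add: C00_space_simps)
  obtain a b where ab: "a < b" "supp u \<subseteq> {a..b}" "supp v \<subseteq> {a..b}" "supp z \<subseteq> {a..b}"
    using C00_common_interval[OF u v z] by blast
  have vz: "(\<lambda>s. v s + z s) \<in> C00" by (rule C00_add[OF v z])
  have supp_vz: "supp (\<lambda>s. v s + z s) \<subseteq> {a..b}" using ab supp_add[of v z] by blast
  have "(rsum (\<lambda>x y t. cinner (u t) (\<Sigma> {x<..y} (v t + z t)))
      \<longlongrightarrow> stieltjes_integral \<Sigma> u v + stieltjes_integral \<Sigma> u z) (partitions a b)"
    using tendsto_add[OF stieltjes_tendsto[OF u v ab(1-3)] stieltjes_tendsto[OF u z ab(1,2,4)]]
    by (simp add: bounded_clinearD[OF bounded_clinear] cinner_add_right rsum_add[abs_def])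
  then show "ip Cc u (add Cc v z)
      = ip Cc u v + ip Cc u z"
    unfolding ip_C00_space add_C00_space by (rule stieltjes_integralI[OF u vz ab(1,2) supp_vz])
qed

sublocale C00: semi_ip_space Cc
  by (rule semi_ip_space_C00)

text \<open>For \<open>u = f x\<close> the Riemann sums are those of the squared modulus of
  \<open>f\<close> against the scalar measure of \<open>x\<close>, of total mass
  \<open>(x, \<Sigma> UNIV x)\<close>. This estimates the error when a basis vector is replaced by a
  nearby one.\<close>

lemma nrm_C00_scaleC_le:
  assumes f: "continuous_on UNIV f" and supp: "\<And>s. s \<notin> {a..b} \<Longrightarrow> f s = 0" and c: "\<And>s. cmod (f s) \<le> c"
  shows "(nrm Cc (\<lambda>s. scaleC (f s) x))\<^sup>2 \<le> c\<^sup>2 * Re (cinner x (\<Sigma> UNIV x))"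
proof -
  interpret finite_measure "scalar_measure \<Sigma> x" by (rule finite_scalar_measure)
  define u where "u s = scaleC (f s) x" for s
  have u: "u \<in> C00" unfolding u_def by (rule C00_const_mult[OF f supp])
  \<comment> \<open>A new interval replaces the given one, which may be degenerate or empty; the new
    one satisfies \<open>a < b\<close> and contains the support.\<close>
  obtain a b where ab: "a < b" "supp u \<subseteq> {a..b}" "\<And>s. s \<notin> {a..b} \<Longrightarrow> f s = 0"
  proof -
    have "compact (supp u \<union> {a..b})" using C00_D(2)[OF u] by (intro compact_Un) auto
    then obtain a' b' where "a' < b'" "supp u \<union> {a..b} \<subseteq> {a'..b'}" using compact_subset_interval by blast
    then show ?thesis using supp by (intro that[of a' b']) auto
  qed
  have meas: "f \<in> borel_measurable (scalar_measure \<Sigma> x)"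
    using borel_measurable_continuous_onI[OF f] measurable_cong_sets[OF sets_scalar_measure refl] by blast
  have "(rsum (\<lambda>r s t. cnj (f t) * f t * cinner x (\<Sigma> {r<..s} x))
      \<longlongrightarrow> (LINT s|scalar_measure \<Sigma> x. cnj (f s) * f s)) (partitions a b)"
    using ab f by (intro rsum_tendsto_scalar continuous_intros) auto
  moreover have "cnj (f t) * f t * cinner x (\<Sigma> {r<..s} x) = cinner (u t) (\<Sigma> {r<..s} (u t))" for r s t
    by (simp add: u_def bounded_clinearD(2)[OF bounded_clinear] cinner_scaleC_left cinner_scaleC_right)
  ultimately have "stieltjes_integral \<Sigma> u u = (LINT s|scalar_measure \<Sigma> x. cnj (f s) * f s)"
    by (intro stieltjes_integralI[OF u u ab(1,2,2)]) simp
  also have "cmod \<dots> \<le> (LINT s|scalar_measure \<Sigma> x. cmod (cnj (f s) * f s))" by (rule integral_norm_bound)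
  also have "\<dots> \<le> (LINT s|scalar_measure \<Sigma> x. c\<^sup>2)"
  proof (rule integral_mono)
    have le: "cmod (cnj (f s) * f s) \<le> c\<^sup>2" for s
      using power_mono[OF c norm_ge_zero, of s 2] by (simp add: norm_mult power2_eq_square)
    show "cmod (cnj (f s) * f s) \<le> c\<^sup>2" for s by (rule le)
    have "(\<lambda>s. cmod (cnj (f s) * f s)) \<in> borel_measurable (scalar_measure \<Sigma> x)"
      using meas by (simp add: norm_mult borel_measurable_times borel_measurable_norm)
    then show "integrable (scalar_measure \<Sigma> x) (\<lambda>s. cmod (cnj (f s) * f s))"
      using le by (intro integrable_const_bound[where B = "c\<^sup>2"]) auto
  qed simp
  also have "\<dots> = c\<^sup>2 * Re (cinner x (\<Sigma> UNIV x))" by (simp add: cinner_eq_measure)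
  finally have "cmod (stieltjes_integral \<Sigma> u u) \<le> c\<^sup>2 * Re (cinner x (\<Sigma> UNIV x))" .
  then show ?thesis
    using C00.nrm_power2[of u] u complex_Re_le_cmod[of "stieltjes_integral \<Sigma> u u"]
    unfolding u_def[symmetric] by (simp add: C00_space_simps)
qed

end

section \<open>Integrable functions annihilated by continuous test functions\<close>

text \<open>A real integrable function is tested on the set where it is positive. Applying this to
  both signs of the real and the imaginary part leaves only zero.\<close>

lemma AE_zero_if_set_integrals_zero:
  fixes h :: "'s \<Rightarrow> complex"
  assumes h: "integrable M h" and zero: "\<And>A. A \<in> sets M \<Longrightarrow> (LINT s:A|M. h s) = 0"
  shows "AE s in M. h s = 0"
proof -
  have nonpos: "AE s in M. g s \<le> 0"
    if g: "integrable M g" and g0: "\<And>A. A \<in> sets M \<Longrightarrow> (LINT s:A|M. g s) = 0" for g :: "'s \<Rightarrow> real"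
  proof -
    define A where "A = {s \<in> space M. g s > 0}"
    have A: "A \<in> sets M" unfolding A_def using g by measurable
    have "AE s in M. indicator A s *\<^sub>R g s = 0"
      using g0[OF A] integrable_mult_indicator[OF A g]
      by (subst integral_nonneg_eq_0_iff_AE[symmetric])
        (auto simp: set_lebesgue_integral_def A_def indicator_def)
    then show ?thesis
      using AE_space by eventually_elim (auto simp: A_def indicator_def not_less split: if_splits)
  qed
  have Re: "(LINT s:A|M. Re (h s)) = 0" and Im: "(LINT s:A|M. Im (h s)) = 0" if A: "A \<in> sets M" for A
    using zero[OF A] integrable_mult_indicator[OF A h]
      integral_Re[of M "\<lambda>s. indicator A s *\<^sub>R h s"] integral_Im[of M "\<lambda>s. indicator A s *\<^sub>R h s"]
    by (simp_all add: set_lebesgue_integral_def)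
  have neg: "(LINT s:A|M. - g s) = 0" if "(LINT s:A|M. g s) = 0" for g :: "'s \<Rightarrow> real" and A
    using that by (simp add: set_lebesgue_integral_def)
  have "AE s in M. Re (h s) \<le> 0" "AE s in M. - Re (h s) \<le> 0" "AE s in M. Im (h s) \<le> 0" "AE s in M. - Im (h s) \<le> 0"
    using nonpos[of "\<lambda>s. Re (h s)"] nonpos[of "\<lambda>s. - Re (h s)"] nonpos[of "\<lambda>s. Im (h s)"]
      nonpos[of "\<lambda>s. - Im (h s)"] h Re Im neg[OF Re] neg[OF Im] by simp_all
  then show ?thesis by eventually_elim (simp add: complex_eq_iff)
qed

text \<open>The vanishing is carried from continuous functions to compact sets, then to closed sets
  by exhaustion, to Borel sets by induction over a generating system stable under intersection, and
  to sets of the completion up to null sets.\<close>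

lemma AE_zero_if_continuous_integrals_zero:
  fixes h :: "real \<Rightarrow> complex"
  assumes sets_\<mu>: "sets \<mu> = sets borel" and h: "integrable (completion \<mu>) h"
    and zero: "\<And>f a b. continuous_on UNIV f \<Longrightarrow> (\<And>s. s \<notin> {a..b} \<Longrightarrow> f s = 0) \<Longrightarrow>
      (LINT s|completion \<mu>. complex_of_real (f s) * h s) = 0"
  shows "AE s in completion \<mu>. h s = 0"
proof (rule AE_zero_if_set_integrals_zero[OF h])
  let ?M = "completion \<mu>"
  have borel_M: "B \<in> sets ?M" if "B \<in> sets borel" for B using that sets_\<mu> by auto
  have space_M: "space ?M = UNIV" using sets_eq_imp_space_eq[OF sets_\<mu>] by simp
  have ind: "integrable ?M (\<lambda>s. indicator B s *\<^sub>R h s)" if "B \<in> sets borel" for B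
    using that by (intro integrable_mult_indicator borel_M h)
  have compact_zero: "(LINT s:C|?M. h s) = 0" if C: "compact C" for C
  proof (cases "C = {}")
    case False
    \<comment> \<open>Lipschitz cutoffs equal to 1 on \<open>C\<close> that converge pointwise to
      its indicator.\<close>
    define f where "f k s = max 0 (1 - real k * infdist s C)" for k s
    have cont: "continuous_on UNIV (f k)" for k unfolding f_def by (intro continuous_intros)
    obtain c where c: "\<And>x. x \<in> C \<Longrightarrow> \<bar>x\<bar> \<le> c"
      using compact_imp_bounded[OF C] by (auto simp: bounded_iff)
    \<comment> \<open>The index starts at 1 because \<open>f 0\<close> is constantly 1. From there
      on the cutoff vanishes at distance at least 1 from \<open>C\<close>.\<close>
    have "f (Suc k) s = 0" if s: "s \<notin> {- c - 1..c + 1}" for k s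
    proof -
      obtain x where x: "x \<in> C" "infdist s C = dist s x"
        using infdist_attains_inf[of C s] C False compact_imp_closed by blast
      have "infdist s C \<ge> 1" using c[OF x(1)] x(2) s by (auto simp: dist_real_def)
      then have "1 \<le> real (Suc k) * infdist s C"
        using mult_mono[of 1 "real (Suc k)" 1 "infdist s C"] by simp
      then show ?thesis by (simp add: f_def)
    qed
    then have f0: "(LINT s|?M. complex_of_real (f (Suc k) s) * h s) = 0" for k
      by (intro zero[OF cont])
    have "(\<lambda>k. LINT s|?M. complex_of_real (f (Suc k) s) * h s) \<longlonglongrightarrow> (LINT s|?M. indicator C s *\<^sub>R h s)"
    proof (rule integral_dominated_convergence[where w = "\<lambda>s. cmod (h s)"])
      show "(\<lambda>s. indicator C s *\<^sub>R h s) \<in> borel_measurable ?M"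
        using ind[OF borel_compact[OF C]] by simp
      show "(\<lambda>s. complex_of_real (f (Suc k) s) * h s) \<in> borel_measurable ?M" for k
      proof -
        have "f (Suc k) \<in> borel_measurable ?M"
          using borel_measurable_continuous_onI[OF cont] sets_\<mu>
          by (intro measurable_completion) (simp cong: measurable_cong_sets)
        then show ?thesis using h by measurable
      qed
      show "integrable ?M (\<lambda>s. cmod (h s))" using h by simp
      show "AE s in ?M. (\<lambda>k. complex_of_real (f (Suc k) s) * h s) \<longlonglongrightarrow> indicator C s *\<^sub>R h s"
      proof (rule AE_I2)
        fix s
        have "(\<lambda>k. f k s) \<longlonglongrightarrow> indicator C s"
        proof (cases "s \<in> C")
          case True
          then show ?thesis by (simp add: f_def)
        next
          case False
          then have pos: "infdist s C > 0"
            using C \<open>C \<noteq> {}\<close> compact_imp_closed in_closed_iff_infdist_zero[of C s] infdist_nonneg[of s C] by force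
          obtain K :: nat where K: "1 / infdist s C < real K" using reals_Archimedean2 by blast
          have "f k s = 0" if "k \<ge> K" for k
          proof -
            have "1 / infdist s C < real k" using K that by linarith
            then show ?thesis using pos by (simp add: f_def field_simps)
          qed
          then show ?thesis
            using False by (intro tendsto_eventually) (auto simp: eventually_sequentially)
        qed
        then have "(\<lambda>k. f (Suc k) s) \<longlonglongrightarrow> indicator C s" by (rule LIMSEQ_Suc)
        then show "(\<lambda>k. complex_of_real (f (Suc k) s) * h s) \<longlonglongrightarrow> indicator C s *\<^sub>R h s"
          unfolding scaleR_conv_of_real by (intro tendsto_mult tendsto_of_real tendsto_const)
      qed
      show "AE s in ?M. norm (complex_of_real (f (Suc k) s) * h s) \<le> cmod (h s)" for k
      proof (rule AE_I2)
        fix s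
        have "\<bar>f (Suc k) s\<bar> \<le> 1" using infdist_nonneg[of s C] by (auto simp: f_def)
        then show "norm (complex_of_real (f (Suc k) s) * h s) \<le> cmod (h s)"
          using mult_right_mono[of "\<bar>f (Suc k) s\<bar>" 1 "cmod (h s)"] by (simp add: norm_mult)
      qed
    qed
    then show ?thesis by (simp add: f0 set_lebesgue_integral_def LIMSEQ_const_iff)
  qed (simp add: set_lebesgue_integral_def)
  have limit: "(LINT s:(\<Union>i. A i)|?M. h s) = 0"
    if A: "\<And>i. A i \<in> sets borel" "incseq A" "\<And>i. (LINT s:A i|?M. h s) = 0" for A :: "nat \<Rightarrow> real set"
  proof -
    have "(\<lambda>i. LINT s|?M. indicator (A i) s *\<^sub>R h s) \<longlonglongrightarrow> (LINT s|?M. indicator (\<Union>i. A i) s *\<^sub>R h s)"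
    proof (rule integral_dominated_convergence[where w = "\<lambda>s. cmod (h s)"])
      show "AE s in ?M. (\<lambda>i. indicator (A i) s *\<^sub>R h s) \<longlonglongrightarrow> indicator (\<Union>i. A i) s *\<^sub>R h s"
        by (intro AE_I2 tendsto_scaleR LIMSEQ_indicator_incseq A tendsto_const)
      show "AE s in ?M. norm (indicator (A i) s *\<^sub>R h s) \<le> cmod (h s)" for i
        by (auto simp: indicator_def)
    qed (use h ind A in auto)
    then show ?thesis using A(3) by (simp add: set_lebesgue_integral_def LIMSEQ_const_iff)
  qed
  have closed_zero: "(LINT s:C|?M. h s) = 0" if C: "closed C" for C
  proof -
    have "(\<Union>i. C \<inter> {- real i..real i}) = C"
    proof -
      have "\<exists>i. - real i \<le> x \<and> x \<le> real i" for x
      proof -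
        obtain i where "\<bar>x\<bar> < real i" using reals_Archimedean2 by blast
        then show ?thesis by (intro exI[of _ i]) auto
      qed
      then show ?thesis by auto
    qed
    moreover have "(LINT s:(\<Union>i. C \<inter> {- real i..real i})|?M. h s) = 0"
    proof (rule limit)
      show "incseq (\<lambda>i. C \<inter> {- real i..real i})" by (auto simp: incseq_def)
      show "(LINT s:C \<inter> {- real i..real i}|?M. h s) = 0" for i
        using C by (intro compact_zero closed_Int_compact) auto
    qed (use C in auto)
    ultimately show ?thesis by simp
  qed
  have borel_zero: "(LINT s:B|?M. h s) = 0" if "B \<in> sets borel" for B
  proof -
    have "Int_stable (Collect closed :: real set set)" "Collect closed \<subseteq> Pow (UNIV :: real set)"
      "B \<in> sigma_sets UNIV (Collect closed)"
      using that by (auto simp: borel_eq_closed Int_stable_def)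
    then show ?thesis
    proof (induction B rule: sigma_sets_induct_disjoint)
      case (compl A)
      then have A: "A \<in> sets borel" by (simp add: borel_eq_closed)
      have "(LINT s:UNIV - A|?M. h s) = (LINT s:UNIV|?M. h s) - (LINT s:A|?M. h s)"
      proof -
        have "indicator (UNIV - A) s *\<^sub>R h s = indicator UNIV s *\<^sub>R h s - indicator A s *\<^sub>R h s" for s
          by (simp add: indicator_def)
        then show ?thesis
          unfolding set_lebesgue_integral_def using ind[OF A] h
          by (simp only:) (simp add: Bochner_Integration.integral_diff)
      qed
      then show ?case using compl.IH closed_zero[of UNIV] by simp
    next
      case (union A)
      then have A: "A i \<in> sets borel" for i by (auto simp: borel_eq_closed)
      \<comment> \<open>Finite partial unions turn the disjoint union into an increasing one, to
        which \<open>limit\<close> applies.\<close>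
      have "(LINT s:(\<Union>i. \<Union>j<i. A j)|?M. h s) = 0"
      proof (rule limit)
        show "incseq (\<lambda>i. \<Union>j<i. A j)" by (auto simp: incseq_def intro: less_le_trans)
        fix i
        show "(LINT s:(\<Union>j<i. A j)|?M. h s) = 0"
        proof -
          have "indicator (\<Union>j<i. A j) s *\<^sub>R h s = (\<Sum>j<i. indicator (A j) s *\<^sub>R h s)" for s
            using union(1) by (subst indicator_UN_disjoint)
              (auto simp: scaleR_sum_left intro: disjoint_family_on_mono[of _ UNIV])
          then have "(LINT s:(\<Union>j<i. A j)|?M. h s) = (\<Sum>j<i. LINT s:A j|?M. h s)"
            unfolding set_lebesgue_integral_def by (simp only: Bochner_Integration.integral_sum[OF ind[OF A]])
          then show ?thesis using union.IH by simp
        qed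
      qed (use A in auto)
      moreover have "(\<Union>i. \<Union>j<i. A j) = (\<Union>i. A i)" by auto
      ultimately show ?case by simp
    qed (simp_all add: closed_zero)
  qed
  fix A assume A: "A \<in> sets ?M"
  \<comment> \<open>A set of the completion is a Borel set together with part of a null set, so the
    integral over it is that over the Borel set.\<close>
  then obtain B N N' where B: "A = B \<union> N" "N \<subseteq> N'" "N' \<in> null_sets \<mu>" "B \<in> sets \<mu>"
    by (rule sets_completionE)
  then have BM: "B \<in> sets ?M" by auto
  have "AE s in ?M. s \<notin> N'" using B(3) by (intro AE_not_in null_sets_completionI)
  then have "AE s in ?M. indicator A s *\<^sub>R h s = indicator B s *\<^sub>R h s"
    by eventually_elim (use B in \<open>auto simp: indicator_def\<close>)
  then have "(LINT s:A|?M. h s) = (LINT s:B|?M. h s)"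
    unfolding set_lebesgue_integral_def
    using integrable_mult_indicator[OF A h] integrable_mult_indicator[OF BM h]
    by (intro integral_cong_AE) auto
  then show "(LINT s:A|?M. h s) = 0" using borel_zero B(4) sets_\<mu> by simp
qed

section \<open>The fibres of the direct integral\<close>

lemma (in semi_ip_space) nrm_sub_cancel_le:
  assumes "x \<in> carr S" "y \<in> carr S" "z \<in> carr S" "dst S y x < \<epsilon> / 2" "dst S y z < \<epsilon> / 2"
  shows "dst S x z < \<epsilon>"
  using nrm_sub_triangle[of x y z] nrm_sub_commute[of x y] assms by simp

locale direct_integral = operator_measure \<Sigma>
  for \<Sigma> :: "real set \<Rightarrow> 'k::chilbert_space \<Rightarrow> 'k" +
  fixes \<mu> :: "real measure" and I :: "nat set" and e :: "nat \<Rightarrow> 'k"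
    and \<phi> :: "nat \<Rightarrow> nat \<Rightarrow> real \<Rightarrow> complex" and E :: "real set"
  assumes control: "control_measure \<Sigma> \<mu>"
    and data: "direct_integral_data \<Sigma> \<mu> I e \<phi> E"
begin

abbreviation "cM \<equiv> completion \<mu>"
abbreviation "V \<equiv> cspan (e ` I)"
abbreviation "Pre \<equiv> pre_fibre I e \<phi>"
abbreviation "Hs \<equiv> fibre_space I e \<phi> E"
abbreviation "cf \<equiv> const_field I e \<phi> E"
abbreviation "cof \<equiv> coeff I e"

lemma sets_\<mu>: "sets \<mu> = sets borel"
  using control by (simp add: control_measure_def)

lemma space_cM: "space cM = UNIV"
  using sets_eq_imp_space_eq[OF sets_\<mu>] by simp

lemma borel_cM: "sets borel \<subseteq> sets cM"
  using sets_\<mu> by auto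

lemma e_inj: "inj_on e I" and e_independent: "complex_vector.independent (e ` I)"
  and V_dense: "closure V = UNIV"
  using data by (auto simp: direct_integral_data_def)

lemma \<phi>_integrable: "m \<in> I \<Longrightarrow> n \<in> I \<Longrightarrow> integrable cM (\<phi> m n)"
  and \<phi>_integral: "m \<in> I \<Longrightarrow> n \<in> I \<Longrightarrow> B \<in> sets borel \<Longrightarrow>
    (LINT s:B|cM. \<phi> m n s) = cinner (e m) (\<Sigma> B (e n))"
  using data by (auto simp: direct_integral_data_def)

lemma E_cM: "E \<in> sets cM" and AE_E: "AE s in cM. s \<in> E"
proof -
  have E: "E \<in> sets borel" "emeasure \<mu> (- E) = 0" using data by (auto simp: direct_integral_data_def)
  then show "E \<in> sets cM" using borel_cM by blast
  have "- E \<in> null_sets \<mu>" using E sets_\<mu> by (intro null_setsI) auto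
  then show "AE s in cM. s \<in> E" using AE_not_in[OF null_sets_completionI] by fastforce
qed

lemma semi_ip_space_Pre: "s \<in> E \<Longrightarrow> semi_ip_space (Pre s)"
  using data by (auto simp: direct_integral_data_def)

lemma Pre_simps: "carr (Pre s) = V" "zer (Pre s) = 0" "add (Pre s) = (+)" "smul (Pre s) = scaleC"
  "ip (Pre s) = fibre_ip I e \<phi> s"
  by (simp_all add: pre_fibre_def)

lemma e_in_V: "n \<in> I \<Longrightarrow> e n \<in> V"
  by (intro complex_vector.span_base) auto

lemma isometric_image_fibre:
  "s \<in> E \<Longrightarrow> isometric_image Inr (hilbert_completion (separation (Pre s))) (Hs s)"
  "s \<notin> E \<Longrightarrow> isometric_image Inl type_ips (Hs s)"
  by (simp_all add: isometric_image_def fibre_space_def type_ips_def Let_def)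

lemma hilbert_space_fibre: "hilbert_space (Hs s)"
proof (cases "s \<in> E")
  case True
  interpret P: semi_ip_space "Pre s" by (rule semi_ip_space_Pre[OF True])
  show ?thesis
    by (rule hilbert_space.hilbert_space_image[OF P.hilbert_space_completion_separation
          isometric_image_fibre(1)[OF True]])
next
  case False
  then show ?thesis
    by (intro hilbert_space.hilbert_space_image[OF hilbert_space_type_ips isometric_image_fibre(2)])
qed

sublocale F: hilbert_space "Hs s" for s
  by (rule hilbert_space_fibre)

lemma cf_in_E: "s \<in> E \<Longrightarrow> cf v s = Inr (cembed (Pre s) v)"
  and cf_notin_E: "s \<notin> E \<Longrightarrow> cf v s = Inl v"
  by (simp_all add: const_field_def cembed_def Let_def)

lemma cf_carr: "v \<in> V \<Longrightarrow> cf v s \<in> carr (Hs s)"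
  and cf_add: "v \<in> V \<Longrightarrow> w \<in> V \<Longrightarrow> add (Hs s) (cf v s) (cf w s) = cf (v + w) s"
  and cf_smul: "v \<in> V \<Longrightarrow> smul (Hs s) c (cf v s) = cf (scaleC c v) s"
  and cf_ip: "v \<in> V \<Longrightarrow> w \<in> V \<Longrightarrow>
    ip (Hs s) (cf v s) (cf w s) = (if s \<in> E then fibre_ip I e \<phi> s v w else cinner v w)"
proof -
  have "(v \<in> V \<longrightarrow> cf v s \<in> carr (Hs s)) \<and>
    (v \<in> V \<longrightarrow> w \<in> V \<longrightarrow> add (Hs s) (cf v s) (cf w s) = cf (v + w) s) \<and>
    (v \<in> V \<longrightarrow> smul (Hs s) c (cf v s) = cf (scaleC c v) s) \<and>
    (v \<in> V \<longrightarrow> w \<in> V \<longrightarrow>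
      ip (Hs s) (cf v s) (cf w s) = (if s \<in> E then fibre_ip I e \<phi> s v w else cinner v w))"
  proof (cases "s \<in> E")
    case True
    interpret P: semi_ip_space "Pre s" by (rule semi_ip_space_Pre[OF True])
    note carr = P.cembed_carr[unfolded Pre_simps]
    show ?thesis
      using True P.cembed_add[of v w] P.cembed_smul[of v c]
        P.cembed_ip[of v w]
      by (simp add: cf_in_E isometric_imageD[OF isometric_image_fibre(1)[OF True]] carr Pre_simps)
  next
    case False
    have D: "carr type_ips = (UNIV :: 'k set)" "add type_ips = ((+) :: 'k \<Rightarrow> _)"
      "smul type_ips = (scaleC :: _ \<Rightarrow> 'k \<Rightarrow> _)" "ip type_ips = (cinner :: 'k \<Rightarrow> _)"
      by (simp_all add: type_ips_def)
    show ?thesis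
      using False by (simp add: cf_notin_E isometric_imageD[OF isometric_image_fibre(2)[OF False]] D)
  qed
  then show "v \<in> V \<Longrightarrow> cf v s \<in> carr (Hs s)"
    "v \<in> V \<Longrightarrow> w \<in> V \<Longrightarrow> add (Hs s) (cf v s) (cf w s) = cf (v + w) s"
    "v \<in> V \<Longrightarrow> smul (Hs s) c (cf v s) = cf (scaleC c v) s"
    "v \<in> V \<Longrightarrow> w \<in> V \<Longrightarrow>
      ip (Hs s) (cf v s) (cf w s) = (if s \<in> E then fibre_ip I e \<phi> s v w else cinner v w)" by blast+
qed

text \<open>Over \<open>E\<close> this is the density of a space in its completion; elsewhere the
  fibre is the whole Hilbert space and the density of \<open>V\<close> enters.\<close>

lemma cf_dense:
  assumes X: "X \<in> carr (Hs s)" and "\<epsilon> > 0"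
  shows "\<exists>v\<in>V. dst (Hs s) (cf v s) X < \<epsilon>"
proof (cases "s \<in> E")
  case True
  interpret P: semi_ip_space "Pre s" by (rule semi_ip_space_Pre[OF True])
  interpret C: hilbert_space "hilbert_completion (separation (Pre s))"
    by (rule P.hilbert_space_completion_separation)
  note im = isometric_image_fibre(1)[OF True]
  obtain Y where Y: "Y \<in> carr (hilbert_completion (separation (Pre s)))" "X = Inr Y"
    using X by (auto simp: isometric_imageD(1)[OF im])
  obtain v where v: "v \<in> carr (Pre s)" "dst (hilbert_completion (separation (Pre s))) (cembed (Pre s) v) Y < \<epsilon>"
    using P.cembed_dense[OF Y(1) \<open>\<epsilon> > 0\<close>] by blast
  have "dst (Hs s) (cf v s) X < \<epsilon>"
    using v Y P.cembed_carr[OF v(1)]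
    by (simp add: cf_in_E[OF True] C.isometric_image_sub[OF im] C.isometric_image_nrm[OF im])
  then show ?thesis using v by (auto simp: Pre_simps)
next
  case False
  interpret C: hilbert_space "type_ips :: 'k ips" by (rule hilbert_space_type_ips)
  note im = isometric_image_fibre(2)[OF False]
  have carr: "x \<in> carr type_ips" for x :: 'k by (simp add: type_ips_def)
  obtain y where y: "X = Inl y" using X by (auto simp: isometric_imageD(1)[OF im])
  obtain v where v: "v \<in> V" "dist v y < \<epsilon>"
    using V_dense \<open>\<epsilon> > 0\<close> by (metis UNIV_I closure_approachable)
  have "dst (Hs s) (cf v s) X < \<epsilon>"
    using v(2) by (simp add: y cf_notin_E[OF False] C.isometric_image_sub[OF im carr carr]
        C.isometric_image_nrm[OF im carr] sub_type_ips nrm_type_ips dist_norm)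
  then show ?thesis using v by blast
qed

lemma V_sum: "(\<And>i. i \<in> A \<Longrightarrow> e' i \<in> V) \<Longrightarrow> (\<Sum>i\<in>A. scaleC (d i) (e' i)) \<in> V"
  by (intro complex_vector.span_sum complex_vector.span_scale)

lemma cf_sum_nrm_le:
  assumes "finite A" "\<And>i. i \<in> A \<Longrightarrow> b i \<in> V"
  shows "nrm (Hs s) (cf (\<Sum>i\<in>A. scaleC (d i) (b i)) s) \<le> (\<Sum>i\<in>A. cmod (d i) * nrm (Hs s) (cf (b i) s))"
  using assms
proof (induction A rule: finite_induct)
  case empty
  have "cf 0 s = smul (Hs s) 0 (cf 0 s)" by (subst cf_smul) (auto intro: complex_vector.span_zero)
  then have "nrm (Hs s) (cf 0 s) = cmod 0 * nrm (Hs s) (cf 0 s)"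
    by (metis F.nrm_smul cf_carr complex_vector.span_zero)
  then show ?case by simp
next
  case (insert i A)
  have V: "scaleC (d i) (b i) \<in> V" "(\<Sum>i\<in>A. scaleC (d i) (b i)) \<in> V" "b i \<in> V"
    using insert.prems by (auto intro: complex_vector.span_scale V_sum)
  have "nrm (Hs s) (cf (\<Sum>i\<in>insert i A. scaleC (d i) (b i)) s)
      = nrm (Hs s) (add (Hs s) (smul (Hs s) (d i) (cf (b i) s)) (cf (\<Sum>i\<in>A. scaleC (d i) (b i)) s))"
    using insert.hyps V by (simp add: cf_add cf_smul)
  also have "\<dots> \<le> nrm (Hs s) (smul (Hs s) (d i) (cf (b i) s)) + nrm (Hs s) (cf (\<Sum>i\<in>A. scaleC (d i) (b i)) s)"
    using V by (intro F.nrm_triangle F.smul_closed cf_carr)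
  finally show ?case
    using insert V by (simp add: F.nrm_smul cf_carr)
qed

lemma cf_sum_ip:
  assumes "finite A" "\<And>i. i \<in> A \<Longrightarrow> b i \<in> V" and X: "X \<in> carr (Hs s)"
  shows "ip (Hs s) (cf (\<Sum>i\<in>A. scaleC (d i) (b i)) s) X = (\<Sum>i\<in>A. cnj (d i) * ip (Hs s) (cf (b i) s) X)"
  using assms(1,2)
proof (induction A rule: finite_induct)
  case empty
  have "cf 0 s = smul (Hs s) 0 (cf 0 s)" by (subst cf_smul) (auto intro: complex_vector.span_zero)
  then have "ip (Hs s) (cf 0 s) X = 0"
    using F.ip_smul_left[OF cf_carr[OF complex_vector.span_zero] X, of 0] by simp
  then show ?case by simp
next
  case (insert i A)
  have V: "scaleC (d i) (b i) \<in> V" "(\<Sum>i\<in>A. scaleC (d i) (b i)) \<in> V" "b i \<in> V"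
    using insert.prems by (auto intro: complex_vector.span_scale V_sum)
  have "ip (Hs s) (cf (\<Sum>i\<in>insert i A. scaleC (d i) (b i)) s) X
      = ip (Hs s) (add (Hs s) (smul (Hs s) (d i) (cf (b i) s)) (cf (\<Sum>i\<in>A. scaleC (d i) (b i)) s)) X"
    using insert.hyps V by (simp add: cf_add cf_smul)
  also have "\<dots> = cnj (d i) * ip (Hs s) (cf (b i) s) X + ip (Hs s) (cf (\<Sum>i\<in>A. scaleC (d i) (b i)) s) X"
    using V X by (simp add: F.ip_add_left F.ip_smul_left cf_carr)
  finally show ?case using insert by simp
qed

section \<open>Coordinates with respect to the vectors \<open>e n\<close>\<close>

lemma coeff_e: "m \<in> I \<Longrightarrow> n \<in> I \<Longrightarrow> cof (e m) n = (if m = n then 1 else 0)"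
  using inj_onD[OF e_inj, of m n] by (auto simp: coeff_def complex_vector.representation_basis[OF e_independent])

lemma coeff_eq_0:
  assumes "G \<subseteq> I" "v \<in> cspan (e ` G)" "n \<in> I" "n \<notin> G"
  shows "cof v n = 0"
proof -
  have "complex_vector.representation (e ` I) v = complex_vector.representation (e ` G) v"
    using assms by (intro complex_vector.representation_extend[OF e_independent]) auto
  moreover have "e n \<notin> e ` G" using assms e_inj by (auto simp: inj_on_def)
  ultimately show ?thesis
    unfolding coeff_def using complex_vector.representation_ne_zero[of "e ` G" v "e n"] by auto
qed

text \<open>\<open>coeff\<close> refers to the full family, but by independence a vector in the span
  of a subfamily has the same representation there, which makes the sum finite over a set
  \<open>G\<close> fixed in advance.\<close>

lemma coeff_expansion:
  assumes "finite G" "G \<subseteq> I" "v \<in> cspan (e ` G)"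
  shows "v = (\<Sum>n\<in>G. scaleC (cof v n) (e n))"
proof -
  have ind: "complex_vector.independent (e ` G)"
    using assms(2) e_independent complex_vector.dependent_mono by blast
  have "complex_vector.representation (e ` I) v = complex_vector.representation (e ` G) v"
    using assms by (intro complex_vector.representation_extend[OF e_independent]) auto
  then have "(\<Sum>n\<in>G. scaleC (cof v n) (e n))
      = (\<Sum>b\<in>e ` G. scaleC (complex_vector.representation (e ` G) v b) b)"
    using inj_on_subset[OF e_inj assms(2)] by (simp add: sum.reindex coeff_def)
  also have "\<dots> = v"
    using assms by (intro complex_vector.sum_representation_eq[OF ind]) auto
  finally show ?thesis by simp
qed

lemma V_finite:
  assumes "v \<in> V"
  shows "\<exists>G. finite G \<and> G \<subseteq> I \<and> v \<in> cspan (e ` G)"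
proof -
  obtain T r where T: "finite T" "T \<subseteq> e ` I" "v = (\<Sum>b\<in>T. scaleC (r b) b)"
    using assms unfolding complex_vector.span_explicit by blast
  obtain G where G: "G \<subseteq> I" "finite G" "T = e ` G" using finite_subset_image[OF T(1,2)] by blast
  have "v \<in> cspan (e ` G)"
    unfolding T(3) G(3) by (intro complex_vector.span_sum complex_vector.span_scale complex_vector.span_base)
  then show ?thesis using G by blast
qed

lemma span_G_V: "G \<subseteq> I \<Longrightarrow> v \<in> cspan (e ` G) \<Longrightarrow> v \<in> V"
  using complex_vector.span_mono[of "e ` G" "e ` I"] by blast

text \<open>The index sets in \<open>fibre_ip\<close> depend on the vectors and would vary with
  \<open>s\<close> for vectors \<open>u s\<close>. Padding with zero terms gives a fixed finite
  range, so that measurability and limits can be handled term by term.\<close>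

lemma fibre_ip_eq:
  assumes G: "finite G" "G \<subseteq> I" and v: "v \<in> cspan (e ` G)" and w: "w \<in> cspan (e ` G)"
  shows "fibre_ip I e \<phi> s v w = (\<Sum>m\<in>G. \<Sum>n\<in>G. \<phi> m n s * cnj (cof v m) * cof w n)"
  unfolding fibre_ip_def
proof (rule sum.mono_neutral_cong_left[OF G(1)])
  show "{m \<in> I. cof v m \<noteq> 0} \<subseteq> G" using coeff_eq_0[OF G(2) v] by blast
  show "\<forall>m\<in>G - {m \<in> I. cof v m \<noteq> 0}. (\<Sum>n\<in>G. \<phi> m n s * cnj (cof v m) * cof w n) = 0"
    using G by auto
  fix m assume "m \<in> {m \<in> I. cof v m \<noteq> 0}"
  show "(\<Sum>n | n \<in> I \<and> cof w n \<noteq> 0. \<phi> m n s * cnj (cof v m) * cof w n)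
      = (\<Sum>n\<in>G. \<phi> m n s * cnj (cof v m) * cof w n)"
  proof (rule sum.mono_neutral_left[OF G(1)])
    show "{n \<in> I. cof w n \<noteq> 0} \<subseteq> G" using coeff_eq_0[OF G(2) w] by blast
    show "\<forall>n\<in>G - {n \<in> I. cof w n \<noteq> 0}. \<phi> m n s * cnj (cof v m) * cof w n = 0" using G by auto
  qed
qed

text \<open>The Gram matrix of the \<open>e n\<close> in the fibre over \<open>s\<close>. Including
  the fibres outside \<open>E\<close> gives one formula valid at every point.\<close>

definition Gram :: "nat \<Rightarrow> nat \<Rightarrow> real \<Rightarrow> complex" where
  "Gram m n s = (if s \<in> E then \<phi> m n s else cinner (e m) (e n))"

lemma Gram_measurable:
  assumes "m \<in> I" "n \<in> I"
  shows "Gram m n \<in> borel_measurable cM"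
proof -
  have "\<phi> m n \<in> borel_measurable cM" using \<phi>_integrable[OF assms] by simp
  moreover have "{s \<in> space cM. s \<in> E} \<in> sets cM" using E_cM space_cM by simp
  ultimately show ?thesis unfolding Gram_def[abs_def] by (intro measurable_If) auto
qed

lemma cf_ip_eq:
  assumes G: "finite G" "G \<subseteq> I" and v: "v \<in> cspan (e ` G)" and w: "w \<in> cspan (e ` G)"
  shows "ip (Hs s) (cf v s) (cf w s) = (\<Sum>m\<in>G. \<Sum>n\<in>G. Gram m n s * cnj (cof v m) * cof w n)"
proof (cases "s \<in> E")
  case True
  then show ?thesis using fibre_ip_eq[OF assms] G v w by (simp add: cf_ip span_G_V Gram_def)
next
  case False
  have "cinner v w = cinner (\<Sum>m\<in>G. scaleC (cof v m) (e m)) (\<Sum>n\<in>G. scaleC (cof w n) (e n))"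
    using coeff_expansion[OF G v] coeff_expansion[OF G w] by simp
  also have "\<dots> = (\<Sum>m\<in>G. \<Sum>n\<in>G. cinner (e m) (e n) * cnj (cof v m) * cof w n)"
    unfolding cinner_sum_left
    by (intro sum.cong refl)
      (simp add: cinner_sum_right cinner_scaleC_left cinner_scaleC_right sum_distrib_left mult_ac)
  finally show ?thesis using False G v w by (simp add: cf_ip span_G_V Gram_def)
qed

text \<open>The norm of a field is measurable because it is a supremum over the countable family
  \<open>comb\<close>.\<close>

definition gauss_rat :: "rat \<times> rat \<Rightarrow> complex" where
  "gauss_rat q = Complex (of_rat (fst q)) (of_rat (snd q))"

definition comb :: "(rat \<times> rat) list \<Rightarrow> 'k" where
  "comb l = (\<Sum>n \<in> I \<inter> {..<length l}. scaleC (gauss_rat (l ! n)) (e n))"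

lemma gauss_rat_dense: "\<eta> > 0 \<Longrightarrow> \<exists>q. cmod (z - gauss_rat q) < \<eta>"
proof -
  assume "\<eta> > 0"
  obtain p where p: "Re z < of_rat p" "of_rat p < Re z + \<eta> / 2"
    using of_rat_dense[of "Re z" "Re z + \<eta> / 2"] \<open>\<eta> > 0\<close> by auto
  obtain q where q: "Im z < of_rat q" "of_rat q < Im z + \<eta> / 2"
    using of_rat_dense[of "Im z" "Im z + \<eta> / 2"] \<open>\<eta> > 0\<close> by auto
  have "cmod (z - gauss_rat (p, q)) \<le> \<bar>Re (z - gauss_rat (p, q))\<bar> + \<bar>Im (z - gauss_rat (p, q))\<bar>"
    by (rule cmod_le)
  also have "\<dots> < \<eta>" using p q by (simp add: gauss_rat_def)
  finally show ?thesis by blast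
qed

lemma comb_V: "comb l \<in> V"
  unfolding comb_def by (intro V_sum e_in_V) auto

text \<open>The approximating list may depend on \<open>s\<close>, but the countable family from
  which it is taken does not.\<close>

lemma comb_dense:
  assumes v: "v \<in> V" and "\<epsilon> > 0"
  shows "\<exists>l. dst (Hs s) (cf v s) (cf (comb l) s) < \<epsilon>"
proof -
  obtain G where G: "finite G" "G \<subseteq> I" "v \<in> cspan (e ` G)" using V_finite[OF v] by blast
  obtain N where N: "G \<subseteq> {..<N}" using G(1) finite_nat_iff_bounded by blast
  \<comment> \<open>\<open>comb\<close> uses all indices of \<open>I\<close> below the length of the
    list, so \<open>G\<close> is enlarged to such an initial piece.\<close>
  define A where "A = I \<inter> {..<N}"
  have A: "finite A" "A \<subseteq> I" "v \<in> cspan (e ` A)"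
    using G N complex_vector.span_mono[of "e ` G" "e ` A"] by (auto simp: A_def image_mono)
  \<comment> \<open>The triangle inequality in the fibre bounds the error by
    \<open>\<epsilon> / K\<close> times the sum of the norms, which is \<open>K - 1\<close>.\<close>
  define K where "K = (\<Sum>n\<in>A. nrm (Hs s) (cf (e n) s)) + 1"
  have K: "K > 0"
    unfolding K_def using A(2) by (intro add_nonneg_pos sum_nonneg F.nrm_nonneg cf_carr e_in_V) auto
  have "\<forall>n. \<exists>q. cmod (cof v n - gauss_rat q) < \<epsilon> / K"
    using gauss_rat_dense \<open>\<epsilon> > 0\<close> K by simp
  then obtain q where q: "\<And>n. cmod (cof v n - gauss_rat (q n)) < \<epsilon> / K" by metis
  define l where "l = map q [0..<N]"
  have comb_l: "comb l = (\<Sum>n\<in>A. scaleC (gauss_rat (q n)) (e n))"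
    unfolding comb_def A_def l_def by (intro sum.cong) auto
  have "sub (Hs s) (cf v s) (cf (comb l) s) = cf (v + scaleC (- 1) (comb l)) s"
    by (simp only: sub_def cf_smul[OF comb_V] cf_add[OF v complex_vector.span_scale[OF comb_V]])
  also have "v + scaleC (- 1) (comb l) = (\<Sum>n\<in>A. scaleC (cof v n - gauss_rat (q n)) (e n))"
    by (subst coeff_expansion[OF A]) (simp add: scaleC_minus_one comb_l complex_vector.scale_left_diff_distrib sum_subtractf)
  finally have "dst (Hs s) (cf v s) (cf (comb l) s)
      \<le> (\<Sum>n\<in>A. cmod (cof v n - gauss_rat (q n)) * nrm (Hs s) (cf (e n) s))"
    using cf_sum_nrm_le[OF A(1), of e s "\<lambda>n. cof v n - gauss_rat (q n)"] A(2) e_in_V by auto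
  also have "\<dots> \<le> (\<Sum>n\<in>A. \<epsilon> / K * nrm (Hs s) (cf (e n) s))"
    using q A(2) by (intro sum_mono mult_right_mono less_imp_le F.nrm_nonneg cf_carr e_in_V) auto
  also have "\<dots> = \<epsilon> / K * (K - 1)" by (simp add: K_def sum_distrib_left)
  also have "\<dots> < \<epsilon>" using K \<open>\<epsilon> > 0\<close> by (simp add: field_simps)
  finally show ?thesis by blast
qed

text \<open>Lists of pairs of rationals form a countable type, so \<open>from_nat\<close> reaches
  every \<open>comb l\<close>.\<close>

definition wV :: "nat \<Rightarrow> 'k" where "wV k = comb (from_nat k)"

lemma wV_V: "wV k \<in> V"
  by (simp add: wV_def comb_V)

lemma cf_ip_measurable:
  assumes v: "v \<in> V" and w: "w \<in> V"
  shows "(\<lambda>s. ip (Hs s) (cf v s) (cf w s)) \<in> borel_measurable cM"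
proof -
  obtain G G' where "finite G" "G \<subseteq> I" "v \<in> cspan (e ` G)"
    "finite G'" "G' \<subseteq> I" "w \<in> cspan (e ` G')"
    using V_finite[OF v] V_finite[OF w] by blast
  then have G: "finite (G \<union> G')" "G \<union> G' \<subseteq> I" "v \<in> cspan (e ` (G \<union> G'))"
      "w \<in> cspan (e ` (G \<union> G'))"
    using complex_vector.span_mono[of "e ` G" "e ` (G \<union> G')"] complex_vector.span_mono[of "e ` G'" "e ` (G \<union> G')"]
    by auto
  show ?thesis
    unfolding cf_ip_eq[OF G] using G(2)
    by (intro borel_measurable_sum borel_measurable_times Gram_measurable borel_measurable_const) auto
qed

text \<open>Density of the countable family takes two approximations: an element of the fibre by a
  vector of \<open>V\<close>, and that vector by a rational combination.\<close>

sublocale MF: measurable_hilbert_field cM Hs "\<lambda>k. cf (wV k)"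
proof
  show "space cM = UNIV" by (rule space_cM)
  show "cf (wV k) s \<in> carr (Hs s)" for k s by (intro cf_carr wV_V)
  show "(\<lambda>s. nrm (Hs s) (cf (wV k) s)) \<in> borel_measurable cM" for k
    unfolding nrm_def using cf_ip_measurable[OF wV_V wV_V, of k k] by measurable
  fix X s and \<epsilon> :: real assume X: "X \<in> carr (Hs s)" and "\<epsilon> > 0"
  then have "\<epsilon> / 2 > 0" by simp
  obtain v where v: "v \<in> V" "dst (Hs s) (cf v s) X < \<epsilon> / 2" using cf_dense[OF X \<open>\<epsilon> / 2 > 0\<close>] by blast
  obtain l where l: "dst (Hs s) (cf v s) (cf (comb l) s) < \<epsilon> / 2"
    using comb_dense[OF v(1) \<open>\<epsilon> / 2 > 0\<close>] by blast
  have "dst (Hs s) X (cf (comb l) s) < \<epsilon>"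
    using F.nrm_sub_cancel_le[OF X cf_carr[OF v(1)] cf_carr[OF comb_V] v(2) l] .
  then show "\<exists>k. dst (Hs s) X (cf (wV k) s) < \<epsilon>"
    unfolding wV_def by (metis from_nat_to_nat)
qed

lemma e_eq_wV: "n \<in> I \<Longrightarrow> \<exists>k. e n = wV k"
proof -
  assume n: "n \<in> I"
  \<comment> \<open>The coefficient 1 stands at position \<open>n\<close>, counted from 0, after
    \<open>n\<close> zero entries.\<close>
  define l :: "(rat \<times> rat) list" where "l = replicate n (0, 0) @ [(1, 0)]"
  have "comb l = (\<Sum>m \<in> I \<inter> {..<length l}. if m = n then e m else 0)"
    unfolding comb_def
  proof (intro sum.cong refl)
    fix m assume "m \<in> I \<inter> {..<length l}"
    then have "m \<le> n" by (simp add: l_def)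
    moreover have "Complex 1 0 = 1" "Complex 0 0 = 0" by (simp_all add: complex_eq_iff)
    ultimately show "scaleC (gauss_rat (l ! m)) (e m) = (if m = n then e m else 0)"
      by (cases "m = n") (simp_all add: l_def nth_append gauss_rat_def)
  qed
  also have "\<dots> = e n" using n by (subst sum.delta) (auto simp: l_def)
  finally have "e n = wV (to_nat l)" by (simp add: wV_def)
  then show ?thesis by blast
qed

text \<open>A pairing with a rational combination is a finite combination of pairings with the
  \<open>e n\<close>; conversely each \<open>e n\<close> occurs among the \<open>wV k\<close>. So
  both families of test vectors define the same fields.\<close>

lemma measurable_fields_eq: "measurable_fields \<mu> I e \<phi> E = MF.fields"
proof (intro equalityI subsetI)
  fix g assume "g \<in> measurable_fields \<mu> I e \<phi> E"
  then have g: "\<And>s. g s \<in> carr (Hs s)"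
    "\<And>n. n \<in> I \<Longrightarrow> (\<lambda>s. ip (Hs s) (cf (e n) s) (g s)) \<in> borel_measurable cM"
    by (auto simp: measurable_fields_def)
  have "(\<lambda>s. ip (Hs s) (cf (wV k) s) (g s)) \<in> borel_measurable cM" for k
  proof -
    have "ip (Hs s) (cf (wV k) s) (g s) = (\<Sum>n \<in> I \<inter> {..<length (from_nat k :: (rat \<times> rat) list)}.
        cnj (gauss_rat (from_nat k ! n)) * ip (Hs s) (cf (e n) s) (g s))" for s
      unfolding wV_def comb_def using e_in_V g(1) by (intro cf_sum_ip) auto
    then show ?thesis
      using g(2) by (auto intro!: borel_measurable_sum borel_measurable_times)
  qed
  then show "g \<in> MF.fields" using g(1) by (simp add: MF.fields_def)
next
  fix g assume "g \<in> MF.fields"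
  then show "g \<in> measurable_fields \<mu> I e \<phi> E"
    using e_eq_wV by (fastforce simp: MF.fields_def measurable_fields_def)
qed

lemma square_integrable_fields_eq: "square_integrable_fields \<mu> I e \<phi> E = MF.L2"
  by (simp add: square_integrable_fields_def MF.L2_def measurable_fields_eq)

lemma direct_integral_space_eq: "direct_integral_space \<mu> I e \<phi> E = separation MF.L2"
  by (simp add: direct_integral_space_def square_integrable_fields_eq separation_def MF.null_space_L2
      AE_completion_iff)

lemma hilbert_space_direct_integral: "hilbert_space (direct_integral_space \<mu> I e \<phi> E)"
  unfolding direct_integral_space_eq by (rule MF.L2.hilbert_space_separation[OF MF.complete_ips_L2])

end

section \<open>The isometry\<close>

context direct_integral
begin

abbreviation "Bz \<equiv> berezanskii_space \<Sigma>"

definition D :: "(real \<Rightarrow> 'k) set" where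
  "D = {u \<in> C00. \<exists>G. finite G \<and> G \<subseteq> I \<and> range u \<subseteq> cspan (e ` G)}"

definition J :: "(real \<Rightarrow> 'k) \<Rightarrow> real \<Rightarrow> 'k fibre" where
  "J u s = cf (u s) s"

lemma D_C00: "u \<in> D \<Longrightarrow> u \<in> C00"
  by (simp add: D_def)

lemma D_common:
  assumes "u \<in> D" "v \<in> D"
  shows "\<exists>G. finite G \<and> G \<subseteq> I \<and> (\<forall>s. u s \<in> cspan (e ` G)) \<and> (\<forall>s. v s \<in> cspan (e ` G))"
proof -
  obtain G G' where G: "finite G" "G \<subseteq> I" "range u \<subseteq> cspan (e ` G)"
    and G': "finite G'" "G' \<subseteq> I" "range v \<subseteq> cspan (e ` G')"
    using assms by (auto simp: D_def)
  have "u s \<in> cspan (e ` (G \<union> G'))" "v s \<in> cspan (e ` (G \<union> G'))" for s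
    using G(3) G'(3) complex_vector.span_mono[OF image_mono[OF Un_upper1], of e G G']
      complex_vector.span_mono[OF image_mono[OF Un_upper2], of e G' G] by blast+
  then show ?thesis using G G' by (intro exI[of _ "G \<union> G'"]) auto
qed

lemma D_V: "u \<in> D \<Longrightarrow> u s \<in> V"
  using D_common[of u u] span_G_V by blast

lemma D_add:
  assumes "u \<in> D" "v \<in> D"
  shows "(\<lambda>s. u s + v s) \<in> D"
proof -
  obtain G where "finite G" "G \<subseteq> I" "\<And>s. u s \<in> cspan (e ` G)" "\<And>s. v s \<in> cspan (e ` G)"
    using D_common[OF assms] by blast
  then show ?thesis
    using C00_add[OF D_C00[OF assms(1)] D_C00[OF assms(2)]]
    by (auto simp: D_def intro!: exI[of _ G] complex_vector.span_add)
qed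

lemma D_mult:
  assumes "u \<in> D" "continuous_on UNIV f"
  shows "(\<lambda>s. scaleC (f s) (u s)) \<in> D"
proof -
  obtain G where "finite G" "G \<subseteq> I" "\<And>s. u s \<in> cspan (e ` G)"
    using D_common[OF assms(1,1)] by blast
  then show ?thesis
    using C00_mult[OF D_C00[OF assms(1)] assms(2)]
    by (auto simp: D_def intro!: exI[of _ G] complex_vector.span_scale)
qed

lemma D_const_mult:
  assumes "continuous_on UNIV f" "\<And>s. s \<notin> {a..b} \<Longrightarrow> f s = 0" and v: "v \<in> V"
  shows "(\<lambda>s. scaleC (f s) v) \<in> D"
proof -
  obtain G where "finite G" "G \<subseteq> I" "v \<in> cspan (e ` G)"
    using V_finite[OF v] by blast
  then show ?thesis
    using C00_const_mult[OF assms(1,2)]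
    by (auto simp: D_def intro!: exI[of _ G] complex_vector.span_scale)
qed

lemma D_zero: "(\<lambda>s. 0) \<in> D"
  using C00_zero by (auto simp: D_def intro!: exI[of _ "{}"])

text \<open>The coordinates in the possibly oblique basis \<open>e n\<close> are linear in those of
  an orthonormal basis of the same finite-dimensional span, and the latter are continuous inner
  products.\<close>

lemma coeff_continuous:
  assumes u: "u \<in> D" and "n \<in> I"
  shows "continuous_on UNIV (\<lambda>s. cof (u s) n)"
proof -
  obtain G where G: "finite G" "G \<subseteq> I" "\<And>s. u s \<in> cspan (e ` G)"
    using D_common[OF u u] by blast
  obtain B where B: "finite B" "orthonormal B" "cspan B = cspan (e ` G)"
    using gram_schmidt[of "e ` G"] G(1) by auto
  have BV: "b \<in> V" if "b \<in> B" for b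
    using that B(3) complex_vector.span_base[of b B] span_G_V[OF G(2)] by auto
  have "cof (u s) n = (\<Sum>b\<in>B. cinner b (u s) * cof b n)" for s
  proof -
    have "u s = (\<Sum>b\<in>B. scaleC (cinner b (u s)) b)"
      using B G(3)[of s] by (intro orthonormal_expansion) auto
    then have "cof (u s) n = cof (\<Sum>b\<in>B. scaleC (cinner b (u s)) b) n" by simp
    also have "\<dots> = (\<Sum>b\<in>B. cinner b (u s) * cof b n)"
      using BV by (simp add: coeff_def complex_vector.representation_sum[OF e_independent]
          complex_vector.representation_scale[OF e_independent] complex_vector.span_scale)
    finally show ?thesis .
  qed
  then show ?thesis
    using C00_D(1)[OF D_C00[OF u]] by (auto intro!: continuous_intros continuous_on_cinner_right)
qed

lemma coeff_zero: "cof 0 n = 0"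
  by (simp add: coeff_def complex_vector.representation_zero)

text \<open>Both the Riemann sums and the fibrewise inner products expand over the same finite
  set of densities \<open>\<phi> m n\<close>.\<close>

lemma J_ip:
  assumes u: "u \<in> D" and v: "v \<in> D"
  shows "(\<lambda>s. ip (Hs s) (J u s) (J v s)) \<in> borel_measurable cM"
    and "integrable cM (\<lambda>s. ip (Hs s) (J u s) (J v s))"
    and "(LINT s|cM. ip (Hs s) (J u s) (J v s)) = stieltjes_integral \<Sigma> u v"
proof -
  obtain G where G: "finite G" "G \<subseteq> I" and uG: "\<And>s. u s \<in> cspan (e ` G)"
    and vG: "\<And>s. v s \<in> cspan (e ` G)"
    using D_common[OF u v] by blast
  define f where "f m n s = cnj (cof (u s) m) * cof (v s) n" for m n s
  have f_cont: "continuous_on UNIV (f m n)" if "m \<in> I" "n \<in> I" for m n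
    unfolding f_def using that u v by (intro continuous_intros coeff_continuous)
  have f_meas: "f m n \<in> borel_measurable cM" if "m \<in> I" "n \<in> I" for m n
    using borel_measurable_continuous_onI[OF f_cont[OF that]] borel_cM space_cM by (auto simp: measurable_def)
  obtain a b where ab: "a < b" "supp u \<subseteq> {a..b}" "supp v \<subseteq> {a..b}"
    using C00_common_interval[OF D_C00[OF u] D_C00[OF v] D_C00[OF v]] by blast
  have f_supp: "f m n s = 0" if "s \<notin> {a..b}" for m n s
    using supp_outside[OF ab(2) that] by (simp add: f_def coeff_zero)
  have eq: "ip (Hs s) (J u s) (J v s) = (\<Sum>m\<in>G. \<Sum>n\<in>G. f m n s * Gram m n s)" for s
    unfolding J_def cf_ip_eq[OF G uG vG] f_def by (simp add: mult_ac)
  show meas: "(\<lambda>s. ip (Hs s) (J u s) (J v s)) \<in> borel_measurable cM"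
    unfolding eq using G(2) by (intro borel_measurable_sum borel_measurable_times f_meas Gram_measurable) auto
  have int: "integrable cM (\<lambda>s. f m n s * \<phi> m n s)" if "m \<in> G" "n \<in> G" for m n
    using that G(2) by (intro integrable_continuous_mult[OF borel_cM \<phi>_integrable f_cont f_supp]) auto
  have int_sum: "integrable cM (\<lambda>s. \<Sum>m\<in>G. \<Sum>n\<in>G. f m n s * \<phi> m n s)"
    using int by (intro Bochner_Integration.integrable_sum)
  \<comment> \<open>\<open>Gram\<close> and \<open>\<phi>\<close> agree on \<open>E\<close>, whose
    complement is null.\<close>
  have AE_eq: "AE s in cM. (\<Sum>m\<in>G. \<Sum>n\<in>G. f m n s * \<phi> m n s) = ip (Hs s) (J u s) (J v s)"
    using AE_E by eventually_elim (simp add: eq Gram_def)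
  show "integrable cM (\<lambda>s. ip (Hs s) (J u s) (J v s))"
    using integrable_cong_AE_imp[OF int_sum meas AE_eq] .
  have "(LINT s|cM. ip (Hs s) (J u s) (J v s)) = (LINT s|cM. (\<Sum>m\<in>G. \<Sum>n\<in>G. f m n s * \<phi> m n s))"
    using AE_eq meas int_sum by (intro integral_cong_AE) (auto elim: AE_mp)
  also have "\<dots> = (\<Sum>m\<in>G. \<Sum>n\<in>G. LINT s|cM. f m n s * \<phi> m n s)"
    using int by (simp add: Bochner_Integration.integral_sum)
  also have "\<dots> = stieltjes_integral \<Sigma> u v"
  proof (rule stieltjes_integralI[OF D_C00[OF u] D_C00[OF v] ab, symmetric])
    have expand: "cinner (u t) (\<Sigma> {x<..y} (v t)) = (\<Sum>m\<in>G. \<Sum>n\<in>G. f m n t * (LINT s:{x<..y}|cM. \<phi> m n s))"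
      for x y t
    proof -
      have "cinner (u t) (\<Sigma> {x<..y} (v t)) = cinner (\<Sum>m\<in>G. scaleC (cof (u t) m) (e m))
          (\<Sigma> {x<..y} (\<Sum>n\<in>G. scaleC (cof (v t) n) (e n)))"
        using coeff_expansion[OF G uG, of t] coeff_expansion[OF G vG, of t] by simp
      also have "\<dots> = (\<Sum>m\<in>G. \<Sum>n\<in>G. f m n t * cinner (e m) (\<Sigma> {x<..y} (e n)))"
        unfolding cinner_sum_left
        by (intro sum.cong refl) (simp add: bounded_clinearD[OF bounded_clinear] cinner_sum_right
            cinner_scaleC_left cinner_scaleC_right sum_distrib_left f_def mult_ac)
      also have "\<dots> = (\<Sum>m\<in>G. \<Sum>n\<in>G. f m n t * (LINT s:{x<..y}|cM. \<phi> m n s))"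
        using G(2) by (intro sum.cong refl) (simp add: \<phi>_integral subset_iff)
      finally show ?thesis .
    qed
    show "(rsum (\<lambda>x y t. cinner (u t) (\<Sigma> {x<..y} (v t)))
        \<longlongrightarrow> (\<Sum>m\<in>G. \<Sum>n\<in>G. LINT s|cM. f m n s * \<phi> m n s)) (partitions a b)"
      unfolding expand rsum_sum
    proof (intro tendsto_sum)
      fix m n assume "m \<in> G" "n \<in> G"
      then have "m \<in> I" "n \<in> I" using G(2) by auto
      then show "(rsum (\<lambda>x y t. f m n t * (LINT s:{x<..y}|cM. \<phi> m n s))
          \<longlongrightarrow> (LINT s|cM. f m n s * \<phi> m n s)) (partitions a b)"
        by (intro rsum_tendsto_integral[OF borel_cM \<phi>_integrable f_cont f_supp ab(1)])
    qed
  qed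
  finally show "(LINT s|cM. ip (Hs s) (J u s) (J v s)) = stieltjes_integral \<Sigma> u v" .
qed

lemma J_L2: "u \<in> D \<Longrightarrow> J u \<in> carr MF.L2"
  unfolding MF.carr_L2
proof
  assume u: "u \<in> D"
  show "J u \<in> MF.fields"
    unfolding measurable_fields_eq[symmetric] measurable_fields_def
  proof (intro CollectI conjI allI ballI)
    show "J u s \<in> carr (Hs s)" for s using D_V[OF u] by (simp add: J_def cf_carr)
    fix n assume n: "n \<in> I"
    obtain G' where G': "finite G'" "G' \<subseteq> I" "\<And>s. u s \<in> cspan (e ` G')"
      using D_common[OF u u] by blast
    \<comment> \<open>Adding \<open>n\<close> lets \<open>e n\<close> and all \<open>u s\<close> be
      expanded over one index set.\<close>
    define G where "G = insert n G'"
    have G: "finite G" "G \<subseteq> I" "e n \<in> cspan (e ` G)" "\<And>s. u s \<in> cspan (e ` G)"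
      using G' n complex_vector.span_mono[of "e ` G'" "e ` G"]
      by (auto simp: G_def intro: complex_vector.span_base)
    have "(\<lambda>s. cof (u s) k) \<in> borel_measurable cM" if "k \<in> G" for k
      using borel_measurable_continuous_onI[OF coeff_continuous[OF u, of k]] borel_cM space_cM that G(2)
      by (auto simp: measurable_def)
    then show "(\<lambda>s. ip (Hs s) (cf (e n) s) (J u s)) \<in> borel_measurable cM"
      unfolding J_def cf_ip_eq[OF G] using G(2)
      by (intro borel_measurable_sum borel_measurable_times Gram_measurable borel_measurable_const) auto
  qed
  have "(nrm (Hs s) (J u s))\<^sup>2 = Re (ip (Hs s) (J u s) (J u s))" for s
    using D_V[OF u] by (intro F.nrm_power2) (simp add: J_def cf_carr)
  then show "integrable cM (\<lambda>s. (nrm (Hs s) (J u s))\<^sup>2)"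
    using J_ip(2)[OF u u] by simp
qed

section \<open>Density of \<open>D\<close> in \<open>C00\<close>\<close>

lemma C00_sum:
  assumes "finite A" "\<And>i. i \<in> A \<Longrightarrow> g i \<in> C00"
  shows "(\<lambda>s. \<Sum>i\<in>A. g i s) \<in> C00 \<and>
    nrm Cc (\<lambda>s. \<Sum>i\<in>A. g i s) \<le> (\<Sum>i\<in>A. nrm Cc (g i))"
  using assms
proof (induction A rule: finite_induct)
  case empty
  then show ?case using C00_zero C00.nrm_zer by (simp add: zer_C00_space)
next
  case (insert i A)
  then have IH: "(\<lambda>s. \<Sum>i\<in>A. g i s) \<in> C00" and gi: "g i \<in> C00" by auto
  have "nrm Cc (add Cc (g i) (\<lambda>s. \<Sum>i\<in>A. g i s))
      \<le> nrm Cc (g i) + nrm Cc (\<lambda>s. \<Sum>i\<in>A. g i s)"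
    using IH gi by (intro C00.nrm_triangle) (auto simp: carr_C00_space)
  then show ?case
    using insert C00_add[OF gi IH] by (simp add: add_C00_space)
qed

lemma D_sum: "finite A \<Longrightarrow> (\<And>i. i \<in> A \<Longrightarrow> g i \<in> D) \<Longrightarrow> (\<lambda>s. \<Sum>i\<in>A. g i s) \<in> D"
  by (induction A rule: finite_induct) (auto intro: D_zero D_add)

text \<open>The coordinate functions of \<open>u\<close> are kept and each basis vector
  \<open>b\<close> is replaced by a nearby \<open>v b\<close> in \<open>V\<close>. The error is a
  sum of functions \<open>f b\<close> times the fixed vectors \<open>v b - b\<close>.\<close>

lemma D_dense:
  assumes u: "u \<in> C00" and "\<epsilon> > 0"
  shows "\<exists>v\<in>D. dst Cc v u < \<epsilon>"
proof -
  obtain B where B: "finite B" "orthonormal B" "range u \<subseteq> cspan B" using C00_D(3)[OF u] by blast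
  define f where "f b s = cinner b (u s)" for b s
  have f_cont: "continuous_on UNIV (f b)" for b
    unfolding f_def using C00_D(1)[OF u] by (intro continuous_on_cinner_right)
  obtain a a' where ab: "a < a'" "supp u \<subseteq> {a..a'}" using C00_common_interval[OF u u u] by blast
  have f_supp: "f b s = 0" if "s \<notin> {a..a'}" for b s
    using supp_outside[OF ab(2) that] by (simp add: f_def cinner_zero_right)
  have "\<exists>c. \<forall>s. cmod (f b s) \<le> c" for b
  proof -
    have "compact (f b ` {a..a'})"
      using f_cont[of b] by (intro compact_continuous_image) (auto intro: continuous_on_subset)
    then obtain c where c: "\<And>s. s \<in> {a..a'} \<Longrightarrow> cmod (f b s) \<le> c"
      using compact_imp_bounded bounded_iff by (metis imageI)
    have "cmod (f b s) \<le> max c 0" for s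
      using c[of s] f_supp[of s b] by (cases "s \<in> {a..a'}") (auto simp: le_max_iff_disj)
    then show ?thesis by blast
  qed
  then obtain c where c: "\<And>b s. cmod (f b s) \<le> c b" by metis
  have c0: "c b \<ge> 0" for b using c[of b 0] norm_ge_zero order_trans by blast
  \<comment> \<open>A bound of the operator \<open>\<Sigma> UNIV\<close>; it turns the estimate by
    \<open>(x, \<Sigma> UNIV x)\<close> into one by the norm of \<open>x\<close>.\<close>
  obtain K where K: "K > 0" "\<And>x. norm (\<Sigma> UNIV x) \<le> norm x * K"
  proof -
    have "bounded_linear (\<Sigma> UNIV)" using bounded_clinear[of UNIV] by (simp add: bounded_clinear_def)
    then show ?thesis using bounded_linear.pos_bounded that by blast
  qed
  have le: "nrm Cc (\<lambda>s. scaleC (f b s) x) \<le> c b * (sqrt K * norm x)" for b x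
  proof (rule power2_le_imp_le)
    have "Re (cinner x (\<Sigma> UNIV x)) \<le> norm x * (norm x * K)"
      using complex_Re_le_cmod[of "cinner x (\<Sigma> UNIV x)"] cinner_norm_le[of x "\<Sigma> UNIV x"]
        mult_left_mono[OF K(2)[of x] norm_ge_zero[of x]] by linarith
    then have "(c b)\<^sup>2 * Re (cinner x (\<Sigma> UNIV x)) \<le> (c b)\<^sup>2 * (norm x * (norm x * K))"
      by (intro mult_left_mono) auto
    also have "\<dots> = (c b * (sqrt K * norm x))\<^sup>2"
      using K(1) by (simp add: power_mult_distrib) (simp add: power2_eq_square)
    finally show "(nrm Cc (\<lambda>s. scaleC (f b s) x))\<^sup>2 \<le> (c b * (sqrt K * norm x))\<^sup>2"
      using nrm_C00_scaleC_le[of "f b" a a' "c b" x, OF f_cont f_supp c] by linarith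
    show "0 \<le> c b * (sqrt K * norm x)" using c0 K by simp
  qed
  \<comment> \<open>With each \<open>v b\<close> within \<open>\<epsilon> / L\<close> of
    \<open>b\<close>, the total error is at most \<open>(L - 1) * (\<epsilon> / L)\<close>.\<close>
  define L where "L = (\<Sum>b\<in>B. c b * sqrt K) + 1"
  have L: "L > 0" unfolding L_def using c0 K by (intro add_nonneg_pos sum_nonneg) auto
  have "\<forall>b. \<exists>v. v \<in> V \<and> dist v b < \<epsilon> / L"
    using V_dense L \<open>\<epsilon> > 0\<close> by (metis UNIV_I closure_approachable divide_pos_pos)
  then obtain v where v: "\<And>b. v b \<in> V" "\<And>b. dist (v b) b < \<epsilon> / L" by metis
  define u' where "u' s = (\<Sum>b\<in>B. scaleC (f b s) (v b))" for s
  have "u' \<in> D"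
    unfolding u'_def using B(1) D_const_mult[OF f_cont f_supp v(1)] by (intro D_sum)
  have u_eq: "u s = (\<Sum>b\<in>B. scaleC (f b s) b)" for s
    unfolding f_def using B by (intro orthonormal_expansion) auto
  have fx: "(\<lambda>s. scaleC (f b s) x) \<in> C00" for b x by (rule C00_const_mult[OF f_cont f_supp])
  have sub_eq: "sub Cc u' u = (\<lambda>s. \<Sum>b\<in>B. scaleC (f b s) (v b - b))"
    unfolding sub_C00_space u'_def by (subst u_eq) (simp add: sum_subtractf complex_vector.scale_right_diff_distrib)
  have "dst Cc u' u \<le> (\<Sum>b\<in>B. nrm Cc (\<lambda>s. scaleC (f b s) (v b - b)))"
    unfolding sub_eq by (rule conjunct2[OF C00_sum[OF B(1)]]) (rule fx)
  also have "\<dots> \<le> (\<Sum>b\<in>B. c b * sqrt K * (\<epsilon> / L))"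
  proof (rule sum_mono)
    fix b
    have "c b * (sqrt K * norm (v b - b)) \<le> c b * (sqrt K * (\<epsilon> / L))"
      using v(2)[of b] c0[of b] K(1) by (intro mult_left_mono) (auto simp: dist_norm)
    then show "nrm Cc (\<lambda>s. scaleC (f b s) (v b - b)) \<le> c b * sqrt K * (\<epsilon> / L)"
      using le[of b "v b - b"] by (simp add: mult.assoc)
  qed
  also have "\<dots> = (L - 1) * (\<epsilon> / L)" by (simp only: L_def sum_distrib_right[symmetric] add_diff_cancel_right')
  also have "\<dots> < \<epsilon>" using L \<open>\<epsilon> > 0\<close> by (simp add: field_simps)
  finally show ?thesis using \<open>u' \<in> D\<close> by blast
qed

text \<open>The test functions separate the points \<open>s\<close>, giving an exceptional null set
  for each \<open>n\<close>. These are merged, as \<open>I\<close> is countable, before the density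
  of \<open>V\<close> in a single fibre is used.\<close>

lemma orthogonal_to_J_imp_null:
  assumes g: "g \<in> carr MF.L2" and orth: "\<And>u. u \<in> D \<Longrightarrow> ip MF.L2 (J u) g = 0"
  shows "AE s in cM. g s = zer (Hs s)"
proof -
  have gf: "g \<in> MF.fields" using g by (simp add: MF.carr_L2)
  have "AE s in cM. ip (Hs s) (cf (e n) s) (g s) = 0" if n: "n \<in> I" for n
  proof (rule AE_zero_if_continuous_integrals_zero[OF sets_\<mu>])
    \<comment> \<open>The squared norm of \<open>e n\<close> in almost every fibre is the diagonal
      density \<open>\<phi> n n\<close>, so the constant field is square-integrable and its pairing
      with \<open>g\<close> integrable, as the test lemma demands.\<close>
    have "integrable cM (\<lambda>s. (nrm (Hs s) (cf (e n) s))\<^sup>2)"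
    proof (rule integrable_cong_AE_imp)
      show "integrable cM (\<lambda>s. Re (\<phi> n n s))" using \<phi>_integrable[OF n n] by simp
      have eq: "(nrm (Hs s) (cf (e n) s))\<^sup>2 = Re (ip (Hs s) (cf (e n) s) (cf (e n) s))" for s
        using n by (intro F.nrm_power2 cf_carr e_in_V)
      show "(\<lambda>s. (nrm (Hs s) (cf (e n) s))\<^sup>2) \<in> borel_measurable cM"
        unfolding eq using cf_ip_measurable[OF e_in_V[OF n] e_in_V[OF n]] by measurable
      have fibre: "fibre_ip I e \<phi> s (e n) (e n) = \<phi> n n s" for s
        using fibre_ip_eq[of "{n}" "e n" "e n" s] n coeff_e[OF n n] complex_vector.span_base[of "e n" "{e n}"]
        by simp
      show "AE s in cM. Re (\<phi> n n s) = (nrm (Hs s) (cf (e n) s))\<^sup>2"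
        using AE_E by eventually_elim (simp add: eq cf_ip e_in_V n fibre)
    qed
    moreover have "(\<lambda>s. cf (e n) s) \<in> MF.fields"
      using n by (auto simp: MF.fields_def intro!: cf_carr e_in_V cf_ip_measurable wV_V)
    ultimately have "(\<lambda>s. cf (e n) s) \<in> carr MF.L2" by (simp add: MF.carr_L2)
    then show "integrable cM (\<lambda>s. ip (Hs s) (cf (e n) s) (g s))" using g by (rule MF.integrable_ip)
    fix f :: "real \<Rightarrow> real" and a b assume f: "continuous_on UNIV f" "\<And>s. s \<notin> {a..b} \<Longrightarrow> f s = 0"
    have "(\<lambda>s. scaleC (complex_of_real (f s)) (e n)) \<in> D"
      using f n by (intro D_const_mult[of _ a b] continuous_intros e_in_V) auto
    then have "0 = ip MF.L2 (J (\<lambda>s. scaleC (complex_of_real (f s)) (e n))) g" by (simp add: orth)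
    also have "\<dots> = (LINT s|cM. complex_of_real (f s) * ip (Hs s) (cf (e n) s) (g s))"
      unfolding MF.ip_L2
    proof (intro Bochner_Integration.integral_cong refl)
      fix s
      have "J (\<lambda>s. scaleC (complex_of_real (f s)) (e n)) s = smul (Hs s) (complex_of_real (f s)) (cf (e n) s)"
        using n by (simp add: J_def cf_smul e_in_V)
      then show "ip (Hs s) (J (\<lambda>s. scaleC (complex_of_real (f s)) (e n)) s) (g s)
          = complex_of_real (f s) * ip (Hs s) (cf (e n) s) (g s)"
        using n by (simp add: F.ip_smul_left cf_carr e_in_V MF.fields_carr[OF gf])
    qed
    finally show "(LINT s|cM. complex_of_real (f s) * ip (Hs s) (cf (e n) s) (g s)) = 0" by simp
  qed
  then have "AE s in cM. \<forall>n\<in>I. ip (Hs s) (cf (e n) s) (g s) = 0"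
    by (subst AE_ball_countable) auto
  then show ?thesis
  proof eventually_elim
    case (elim s)
    have gs: "g s \<in> carr (Hs s)" by (rule MF.fields_carr[OF gf])
    have orth_V: "ip (Hs s) (cf v s) (g s) = 0" if v: "v \<in> V" for v
    proof -
      obtain G where G: "finite G" "G \<subseteq> I" "v \<in> cspan (e ` G)" using V_finite[OF v] by blast
      have "ip (Hs s) (cf v s) (g s) = ip (Hs s) (cf (\<Sum>n\<in>G. scaleC (cof v n) (e n)) s) (g s)"
        using coeff_expansion[OF G] by simp
      also have "\<dots> = (\<Sum>n\<in>G. cnj (cof v n) * ip (Hs s) (cf (e n) s) (g s))"
        using G(1,2) gs by (intro cf_sum_ip e_in_V) auto
      also have "\<dots> = 0" using elim G(2) by (intro sum.neutral) auto
      finally show ?thesis .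
    qed
    have "nrm (Hs s) (g s) \<le> 0 + \<epsilon>" if pos: "\<epsilon> > 0" for \<epsilon>
    proof -
      obtain v where v: "v \<in> V" "dst (Hs s) (cf v s) (g s) < \<epsilon>"
        using cf_dense[OF gs pos] by blast
      \<comment> \<open>Orthogonality removes the cross term, so the distance from
        \<open>g s\<close> to any \<open>cf v s\<close> is at least the norm of \<open>g s\<close>,
        while density makes it arbitrarily small.\<close>
      have "(nrm (Hs s) (g s))\<^sup>2 \<le> (dst (Hs s) (cf v s) (g s))\<^sup>2"
        using orth_V[OF v(1)] by (simp add: F.nrm_sub_power2 cf_carr v(1) gs)
      then have "nrm (Hs s) (g s) \<le> dst (Hs s) (cf v s) (g s)"
        by (rule power2_le_imp_le) (simp add: cf_carr v(1) gs)
      then show ?thesis using v(2) by simp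
    qed
    then have "nrm (Hs s) (g s) \<le> 0" by (rule field_le_epsilon)
    then show ?case using F.ip_definite[OF gs] F.nrm_nonneg[OF gs] F.nrm_eq_0_iff[OF gs] by auto
  qed
qed

section \<open>Dense images of \<open>D\<close> in the two Hilbert spaces\<close>

lemma J_add: "u \<in> D \<Longrightarrow> v \<in> D \<Longrightarrow> add MF.L2 (J u) (J v) = J (\<lambda>s. u s + v s)"
  and J_smul: "u \<in> D \<Longrightarrow> smul MF.L2 c (J u) = J (\<lambda>s. scaleC c (u s))"
  by (auto simp: MF.add_L2 MF.smul_L2 J_def cf_add cf_smul D_V)

text \<open>The orthogonality criterion requires a definite space, so it is applied to the cosets of
  the fields \<open>J u\<close>. They form a subspace because \<open>J\<close> is linear on
  \<open>D\<close>.\<close>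

lemma J_dense:
  assumes "X \<in> carr (separation MF.L2)" "\<epsilon> > 0"
  shows "\<exists>u\<in>D. dst (separation MF.L2) (coset MF.L2 (null_space MF.L2) (J u)) X < \<epsilon>"
proof -
  let ?c = "coset MF.L2 (null_space MF.L2)"
  interpret S: hilbert_space "separation MF.L2"
    by (rule MF.L2.hilbert_space_separation[OF MF.complete_ips_L2])
  note im = isometric_imageD[OF MF.L2.isometric_image_separation]
  have "\<exists>a\<in>(\<lambda>u. ?c (J u)) ` D. dst (separation MF.L2) a X < \<epsilon>"
  proof (rule S.dense_if_orthogonal_trivial[OF _ _ _ _ _ assms])
    show "(\<lambda>u. ?c (J u)) ` D \<subseteq> carr (separation MF.L2)" using J_L2 by (auto simp: im(1))
    show "(\<lambda>u. ?c (J u)) ` D \<noteq> {}" using D_zero by auto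
    show "add (separation MF.L2) x y \<in> (\<lambda>u. ?c (J u)) ` D"
      if "x \<in> (\<lambda>u. ?c (J u)) ` D" "y \<in> (\<lambda>u. ?c (J u)) ` D" for x y
      using that D_add by (auto simp: im(3) J_L2 J_add)
    show "smul (separation MF.L2) c x \<in> (\<lambda>u. ?c (J u)) ` D" if "x \<in> (\<lambda>u. ?c (J u)) ` D" for c x
      using that D_mult[of _ "\<lambda>_. c"] by (auto simp: im(4) J_L2 J_smul)
    fix Y assume Y: "Y \<in> carr (separation MF.L2)" "\<And>a. a \<in> (\<lambda>u. ?c (J u)) ` D \<Longrightarrow> ip (separation MF.L2) a Y = 0"
    then obtain g where g: "g \<in> carr MF.L2" "Y = ?c g" by (auto simp: im(1))
    have "ip MF.L2 (J u) g = 0" if "u \<in> D" for u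
      using Y(2)[of "?c (J u)"] that g J_L2[OF that] by (simp add: im(5))
    then have "g \<in> null_space MF.L2"
      using orthogonal_to_J_imp_null[OF g(1)] g(1) by (simp add: MF.null_space_L2)
    then have "ip MF.L2 g g = 0" by (simp add: null_space_def)
    then have "ip (separation MF.L2) Y Y = 0" using g by (simp add: im(5))
    then show "Y = zer (separation MF.L2)" by (rule S.ip_definite[OF Y(1)])
  qed
  then show ?thesis by blast
qed

text \<open>Half of \<open>\<epsilon>\<close> pays for approximating \<open>X\<close> from
  \<open>C00\<close>, the other half for passing from \<open>C00\<close> to \<open>D\<close>, where
  \<open>cembed\<close> preserves distances.\<close>

lemma cembed_D_dense:
  assumes X: "X \<in> carr Bz" and "\<epsilon> > 0"
  shows "\<exists>u\<in>D. dst Bz (cembed Cc u) X < \<epsilon>"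
proof -
  let ?\<iota> = "cembed Cc"
  interpret B: hilbert_space Bz
    unfolding berezanskii_space_def by (rule C00.hilbert_space_completion_separation)
  note \<iota>_carr = C00.cembed_carr[folded berezanskii_space_def]
  note \<iota>_ip = C00.cembed_ip[folded berezanskii_space_def]
  have "\<epsilon> / 2 > 0" using \<open>\<epsilon> > 0\<close> by simp
  obtain v where v: "v \<in> carr Cc"
      "dst Bz (?\<iota> v) X < \<epsilon> / 2"
    using C00.cembed_dense[folded berezanskii_space_def, OF X \<open>\<epsilon> / 2 > 0\<close>] by blast
  obtain u where u: "u \<in> D" "dst Cc u v < \<epsilon> / 2"
    using D_dense[OF v(1)[unfolded carr_C00_space] \<open>\<epsilon> / 2 > 0\<close>] by blast
  have uc: "u \<in> carr Cc" using D_C00[OF u(1)] by (simp add: carr_C00_space)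
  have "dst Bz (?\<iota> v) (?\<iota> u) = dst Cc v u"
    using uc v(1) by (simp add: nrm_def B.ip_simps \<iota>_carr \<iota>_ip C00.ip_simps)
  also have "\<dots> < \<epsilon> / 2"
    using u(2) v(1) uc by (subst C00.nrm_sub_commute) auto
  finally show ?thesis
    using B.nrm_sub_cancel_le[OF \<iota>_carr[OF uc] \<iota>_carr[OF v(1)] X _ v(2)] u(1) by blast
qed

text \<open>The common index set is \<open>D\<close>, mapped by \<open>cembed\<close> to one side
  and by the coset of \<open>J u\<close> to the other; \<open>J_ip\<close> supplies the equality of
  inner products.\<close>

lemma isometrically_isomorphic_berezanskii_direct_integral:
  "isometrically_isomorphic Bz (direct_integral_space \<mu> I e \<phi> E)"
  unfolding direct_integral_space_eq
proof (rule isometrically_isomorphic_if_dense)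
  show "hilbert_space Bz"
    unfolding berezanskii_space_def by (rule C00.hilbert_space_completion_separation)
  show "hilbert_space (separation MF.L2)"
    by (rule MF.L2.hilbert_space_separation[OF MF.complete_ips_L2])
  note im = isometric_imageD[OF MF.L2.isometric_image_separation]
  fix u assume u: "u \<in> D"
  show "cembed Cc u \<in> carr Bz"
    unfolding berezanskii_space_def using D_C00[OF u]
    by (intro C00.cembed_carr) (simp add: carr_C00_space)
  show "coset MF.L2 (null_space MF.L2) (J u) \<in> carr (separation MF.L2)"
    using J_L2[OF u] by (simp add: im(1))
  fix v assume v: "v \<in> D"
  show "ip (separation MF.L2) (coset MF.L2 (null_space MF.L2) (J u)) (coset MF.L2 (null_space MF.L2) (J v))
    = ip Bz (cembed Cc u) (cembed Cc v)"
    unfolding berezanskii_space_def using J_ip(3)[OF u v] J_L2[OF u] J_L2[OF v] D_C00[OF u] D_C00[OF v]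
    by (simp add: im(5) C00.cembed_ip carr_C00_space ip_C00_space MF.ip_L2)
qed (rule cembed_D_dense J_dense; assumption)+

end

theorem theorem2p12:
  fixes \<Sigma> :: "real set \<Rightarrow> 'k::chilbert_space \<Rightarrow> 'k"
    and \<mu> :: "real measure"
    and I :: "nat set"
    and e :: "nat \<Rightarrow> 'k"
    and \<phi> :: "nat \<Rightarrow> nat \<Rightarrow> real \<Rightarrow> complex"
    and E :: "real set"
  assumes "\<exists>D :: 'k set. countable D \<and> closure D = UNIV"
    and "nonneg_operator_measure \<Sigma>"
    and "control_measure \<Sigma> \<mu>"
    and "direct_integral_data \<Sigma> \<mu> I e \<phi> E"
  shows "hilbert_space (berezanskii_space \<Sigma>) \<and>
    hilbert_space (direct_integral_space \<mu> I e \<phi> E) \<and>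
    isometrically_isomorphic (berezanskii_space \<Sigma>) (direct_integral_space \<mu> I e \<phi> E)"
proof -
  interpret direct_integral \<Sigma> \<mu> I e \<phi> E
    using assms(2-4) by (simp add: direct_integral_def direct_integral_axioms_def operator_measure_def)
  have "hilbert_space (berezanskii_space \<Sigma>)"
    unfolding berezanskii_space_def by (rule C00.hilbert_space_completion_separation)
  then show ?thesis using hilbert_space_direct_integral isometrically_isomorphic_berezanskii_direct_integral by blast
qed

end
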